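(* Assume the special case of the Lander--Parkin--Selfridge conjecture stated in the context. Then there is an absolute constant $C$ such that $\widetilde f(x)\le C(\log x)^4$ for all sufficiently large real $x$.
   Context: Conjecture (Lander--Parkin--Selfridge, special case): if $k\ge25$ is an integer, then there do not exist distinct positive integers $a_1,b_1,\ldots,a_{12},b_{12}$ such that $\sum_{i=1}^{12}a_i^k=\sum_{i=1}^{12}b_i^k$. $\mathbb{N}$ denotes the set of positive integers. $V_\infty=\{x^k:x,k\in\mathbb{N},\ k\ge2\}$ is the set of perfect powers. For a nonzero integer $n$, a set $A\subseteq\mathbb{N}$ has property $D_{\le\infty}(n)$ if $ab+n\in V_\infty$ for all $a,b\in A$ with $a\ne b$. For real $x\ge1$, $\widetilde f(x)=\max\{|A|:A\subseteq[1,x]\cap\mathbb{N}\text{ has property }D_{\le\infty}(n)\text{ for some integer }n\text{ with }1\le|n|\le x\}$. *)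

theory Defs
  imports Complex_Main
begin

text \<open>The positive integers are rendered as the elements \<open>\<ge> 1\<close> of \<^typ>\<open>nat\<close>.\<close>

definition LPS_special_case :: bool where
  "LPS_special_case \<longleftrightarrow>
     (\<forall>k::nat. k \<ge> 25 \<longrightarrow>
        \<not> (\<exists>a b :: nat \<Rightarrow> nat.
              (\<forall>i\<in>{1..12}. a i \<ge> 1 \<and> b i \<ge> 1) \<and>
              inj_on a {1..12} \<and> inj_on b {1..12} \<and> a ` {1..12} \<inter> b ` {1..12} = {} \<and>
              (\<Sum>i=1..12. a i ^ k) = (\<Sum>i=1..12. b i ^ k)))"

text \<open>Note that \<open>1\<close> is a perfect power while \<open>0\<close> is not. The set is typed over \<^typ>\<open>int\<close>
  because \<open>a * b + n\<close> may be negative.\<close>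

definition perfect_powers :: "int set"  (\<open>V\<^sub>\<infinity>\<close>) where
  "V\<^sub>\<infinity> = {int (x ^ k) | x k :: nat. x \<ge> 1 \<and> k \<ge> 2}"

definition has_property_D :: "int \<Rightarrow> nat set \<Rightarrow> bool" where
  "has_property_D n A \<longleftrightarrow> (\<forall>a\<in>A. \<forall>b\<in>A. a \<noteq> b \<longrightarrow> int a * int b + n \<in> V\<^sub>\<infinity>)"

definition D_set_sizes :: "real \<Rightarrow> nat set" where
  "D_set_sizes x =
     {card A | A :: nat set. A \<subseteq> {a. 1 \<le> a \<and> real a \<le> x} \<and>
        (\<exists>n::int. 1 \<le> \<bar>n\<bar> \<and> real_of_int \<bar>n\<bar> \<le> x \<and> has_property_D n A)}"

definition f_tilde :: "real \<Rightarrow> nat" where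
  "f_tilde x = Max (D_set_sizes x)"

text \<open>For \<open>x \<ge> 1\<close> the maximum is taken over a finite nonempty set.\<close>

lemma finite_D_set_sizes: "finite (D_set_sizes x)"
proof -
  have fin: "finite {a::nat. 1 \<le> a \<and> real a \<le> x}"
    by (rule finite_subset[of _ "{..nat \<lfloor>x\<rfloor>}"]) (auto simp: le_nat_floor)
  have "D_set_sizes x \<subseteq> card ` Pow {a::nat. 1 \<le> a \<and> real a \<le> x}"
    unfolding D_set_sizes_def by auto
  with fin show ?thesis
    by (meson finite_Pow_iff finite_imageI finite_subset)
qed

lemma D_set_sizes_nonempty:
  assumes "x \<ge> 1"
  shows "D_set_sizes x \<noteq> {}"
proof -
  have "has_property_D 1 {}"
    by (simp add: has_property_D_def)
  with assms have "card ({} :: nat set) \<in> D_set_sizes x"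
    unfolding D_set_sizes_def by (intro CollectI exI[of _ "{}"] conjI exI[of _ "1::int"]) auto
  then show ?thesis
    by blast
qed

end

theory Submission
  imports Defs "HOL-Number_Theory.Number_Theory" "HOL-Computational_Algebra.Squarefree"
begin

text \<open>Let \<open>N = |A|\<close> and \<open>L = ln x\<close>. If \<open>k \<ge> 25\<close> and two elements \<open>a, a'\<close> of \<open>A\<close> have three common partners
  \<open>b\<^sub>i\<close> for which all \<open>a b\<^sub>i + n\<close> and \<open>a' b\<^sub>i + n\<close> are \<open>k\<close>-th powers, the vanishing of a \<open>3 \<times> 3\<close> determinant yields
  an equality between two sums of three \<open>k\<close>-th powers, which the conjecture excludes up to degenerate
  coincidences. Hence common neighbourhoods are bounded and only \<open>O(L N\<^sup>3\<^sup>/\<^sup>2)\<close> pairs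
  use an exponent \<open>k \<ge> 25\<close>.

  All other exponents share a factor with the product \<open>P\<close> of the primes below \<open>25\<close>. For a prime \<open>p\<close> that is
  \<open>1\<close> modulo \<open>P\<close>, the corresponding powers miss the residues on which a character of order \<open>P\<close> takes a given
  primitive \<open>P\<close>-th root of unity as its value; by the bilinear character sum bound this forces at least
  \<open>N\<^sup>2 / (3 P \<surd>p)\<close> coincidences modulo \<open>p\<close> within \<open>A\<close>. Gallagher's larger sieve over such primes between
  \<open>Y\<close> and \<open>Y\<^sup>2\<close>, with \<open>Y\<close> of order \<open>L\<^sup>2\<close>, then gives \<open>N = O(L\<^sup>2)\<close>, which is stronger than required.

  Enough such primes exist by Mertens' theorem for the residue class \<open>1\<close>, which is proved
  by Shapiro's elementary method.\<close>

subsection \<open>Dirichlet convolution and Chebyshev's bound\<close>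

text \<open>All exponents below 25 are handled at once, at the price of a constant depending on
  \<open>P\<close>: one character of order \<open>P\<close> serves them all, and such a character
  exists only for primes that are 1 modulo \<open>P\<close>. Mertens' theorem comes with an additive
  error of unknown size. This is why the sieving primes fill a range from \<open>Y\<close> to
  \<open>Y\<^sup>2\<close>: its main term grows like \<open>ln Y\<close> and finally beats the
  error, which leaves a sum of \<open>ln p / p\<close> of at least 2. Exchanging
  \<open>1 / p\<close> for \<open>1 / sqrt p\<close> gains \<open>sqrt Y\<close>, the larger sieve
  asks for a multiple of \<open>P * L\<close>, and so \<open>Y\<close> has the order of
  \<open>(P * L)\<^sup>2\<close>; the resulting bound is a multiple of \<open>P * Y\<close>. The
  core of Mertens' theorem is that L(1,\<chi>) does not vanish. For real \<chi> this rests on the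
  positivity of the divisor sums of \<chi>, for the others on a count: \<chi> and its conjugate
  would outweigh the principal character. As \<open>P\<close> is squarefree, enough characters arise
  by lifting those modulo primes, which are discrete logarithms; the structure of the unit group of
  a general modulus does not enter.\<close>

definition dconv :: "(nat \<Rightarrow> 'a::comm_semiring_1) \<Rightarrow> (nat \<Rightarrow> 'a) \<Rightarrow> nat \<Rightarrow> 'a" where
  "dconv f g n = (\<Sum>d | d dvd n. f d * g (n div d))"

text \<open>At \<open>0\<close> the divisor set is infinite, so every convolution vanishes there; this is what
  makes the laws below hold as equations between functions.\<close>

lemma dconv_0 [simp]: "dconv f g 0 = 0"
  by (simp add: dconv_def)

lemma dconv_commute: "dconv f g = dconv g f"
proof
  fix n
  show "dconv f g n = dconv g f n"
  proof (cases "n = 0")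
    case False
    then show ?thesis
      unfolding dconv_def
      by (intro sum.reindex_bij_witness[of _ "\<lambda>d. n div d" "\<lambda>d. n div d"]) (auto simp: mult.commute)
  qed simp
qed

lemma dconv_assoc: "dconv f (dconv g h) = dconv (dconv f g) h"
proof
  fix n
  show "dconv f (dconv g h) n = dconv (dconv f g) h n"
  proof (cases "n = 0")
    case False
    have fin: "finite {d. d dvd k}" if "k dvd n" for k
      using False that by (intro finite_divisors_nat) (auto intro: dvd_pos_nat)
    have "dconv f (dconv g h) n =
        (\<Sum>(d, e)\<in>Sigma {d. d dvd n} (\<lambda>d. {e. e dvd n div d}). f d * (g e * h (n div d div e)))"
      unfolding dconv_def using fin
      by (subst sum.Sigma[symmetric]) (auto simp: sum_distrib_left div_dvd_iff_mult)
    also have "\<dots> = (\<Sum>(k, d)\<in>Sigma {k. k dvd n} (\<lambda>k. {d. d dvd k}). f d * g (k div d) * h (n div k))"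
      by (rule sum.reindex_bij_witness[of _ "\<lambda>(k, d). (d, k div d)" "\<lambda>(d, e). (d * e, d)"])
         (use False in \<open>auto simp: div_mult2_eq mult.assoc dvd_div_iff_mult
            elim!: dvdE intro: dvd_trans\<close>)
    also have "\<dots> = dconv (dconv f g) h n"
      unfolding dconv_def using fin
      by (subst sum.Sigma[symmetric]) (auto simp: sum_distrib_right)
    finally show ?thesis .
  qed simp
qed

lemma dconv_delta_right: "n > 0 \<Longrightarrow> dconv f (\<lambda>d. if d = 1 then 1 else 0) n = f n"
  unfolding dconv_def
  by (subst sum.mono_neutral_right[of _ "{n}"]) (auto elim!: dvdE)

lemma dconv_add_left: "dconv (\<lambda>n. f n + g n) h n = dconv f h n + dconv g h n"
  by (simp add: dconv_def distrib_right sum.distrib)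

text \<open>Leibniz rule: an additive \<open>D\<close>, in practice the logarithm, splits over
  \<open>d\<close> and \<open>n div d\<close>. It plays the role of differentiating a Dirichlet
  series.\<close>

lemma dconv_derivation:
  fixes f g D :: "nat \<Rightarrow> 'a::comm_semiring_1"
  assumes "\<And>a b. a > 0 \<Longrightarrow> b > 0 \<Longrightarrow> D (a * b) = D a + D b"
  shows "D n * dconv f g n = dconv (\<lambda>d. D d * f d) g n + dconv f (\<lambda>d. D d * g d) n"
proof (cases "n = 0")
  case False
  have "D n * (f d * g (n div d)) = D d * f d * g (n div d) + f d * (D (n div d) * g (n div d))"
    if "d dvd n" for d
    using that False assms by (auto elim!: dvdE simp: algebra_simps)
  then show ?thesis
    by (simp add: dconv_def sum_distrib_left flip: sum.distrib)
qed simp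

text \<open>Both sides run over the pairs \<open>(d, e)\<close> with
  \<open>d * e \<le> N\<close>.\<close>

lemma sum_dconv:
  "(\<Sum>n=1..N. dconv f g n) = (\<Sum>d=1..N. f d * (\<Sum>e=1..N div d. g e))"
proof -
  have "(\<Sum>n=1..N. dconv f g n) = (\<Sum>(n, d)\<in>Sigma {1..N} (\<lambda>n. {d. d dvd n}). f d * g (n div d))"
    unfolding dconv_def by (subst sum.Sigma[symmetric]) auto
  also have "\<dots> = (\<Sum>(d, e)\<in>Sigma {1..N} (\<lambda>d. {1..N div d}). f d * g e)"
    by (rule sum.reindex_bij_witness[of _ "\<lambda>(d, e). (d * e, d)" "\<lambda>(n, d). (d, n div d)"])
       (auto simp: less_eq_div_iff_mult_less_eq mult.commute Suc_le_eq
          elim!: dvdE, metis Suc_leI le_trans mult.right_neutral mult_le_mono2 One_nat_def)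
  also have "\<dots> = (\<Sum>d=1..N. f d * (\<Sum>e=1..N div d. g e))"
    by (subst sum.Sigma[symmetric]) (auto simp: sum_distrib_left)
  finally show ?thesis .
qed

lemma dconv_completely_multiplicative:
  fixes h :: "nat \<Rightarrow> 'a::comm_semiring_1"
  assumes "\<And>a b. h (a * b) = h a * h b"
  shows "h n * dconv f g n = dconv (\<lambda>d. h d * f d) (\<lambda>d. h d * g d) n"
  unfolding dconv_def sum_distrib_left
proof (intro sum.cong refl)
  fix d assume "d \<in> {d. d dvd n}"
  then have "h n = h d * h (n div d)"
    by (metis assms dvd_mult_div_cancel mem_Collect_eq)
  then show "h n * (f d * g (n div d)) = h d * f d * (h (n div d) * g (n div d))"
    by (simp add: ac_simps)
qed

section \<open>Chebyshev and Mertens estimates for the von Mangoldt function\<close>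

lemma dconv_mangoldt_one:
  "dconv mangoldt (\<lambda>_. 1) n = (of_real (ln (real n)) :: 'a::{real_algebra_1,comm_semiring_1})"
  by (cases "n = 0") (simp_all add: dconv_def mangoldt_sum)

lemma ln_fact_conv_mangoldt:
  "ln (fact N) = (\<Sum>d=1..N. mangoldt d * real (N div d))"
proof -
  have "ln (fact N) = (\<Sum>n=1..N. ln (real n))"
    by (induction N) (auto simp: ln_mult)
  also have "\<dots> = (\<Sum>n=1..N. dconv mangoldt (\<lambda>_. 1) n)"
    by (intro sum.cong) (auto simp: dconv_mangoldt_one)
  also have "\<dots> = (\<Sum>d=1..N. mangoldt d * real (N div d))"
    by (subst sum_dconv) simp
  finally show ?thesis .
qed

text \<open>The central binomial coefficient is at most \<open>2 ^ (2 * n)\<close>, while in its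
  logarithm each \<open>d\<close> in \<open>{n<..2*n}\<close> has weight exactly 1 and all other
  weights are nonnegative.\<close>

lemma sum_mangoldt_double_le:
  "(\<Sum>d=1..2*n. mangoldt d) \<le> (\<Sum>d=1..n. mangoldt d) + 2 * real n * ln 2"
proof -
  have eq: "ln (fact n) = (\<Sum>d=1..2*n. mangoldt d * real (n div d))"
    unfolding ln_fact_conv_mangoldt by (rule sum.mono_neutral_left) auto
  have "(\<Sum>d\<in>{n<..2*n}. mangoldt d) = (\<Sum>d\<in>{n<..2*n}. mangoldt d * (real (2*n div d) - 2 * real (n div d)))"
  proof (rule sum.cong)
    fix d assume d: "d \<in> {n<..2*n}"
    then have "2 * n div d = 1" "n div d = 0"
      by (auto simp: div_nat_eqI)
    then show "mangoldt d = mangoldt d * (real (2*n div d) - 2 * real (n div d))"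
      by simp
  qed auto
  also have "\<dots> \<le> (\<Sum>d=1..2*n. mangoldt d * (real (2*n div d) - 2 * real (n div d)))"
  proof (rule sum_mono2)
    fix d :: nat
    have "2 * (n div d) \<le> 2 * n div d"
      by (cases "d = 0") (simp_all add: less_eq_div_iff_mult_less_eq)
    then have "real (2*n div d) - 2 * real (n div d) \<ge> 0"
      by linarith
    then show "mangoldt d * (real (2*n div d) - 2 * real (n div d)) \<ge> 0"
      by (intro mult_nonneg_nonneg mangoldt_nonneg)
  qed auto
  also have "\<dots> = ln (fact (2*n)) - 2 * ln (fact n)"
    unfolding eq ln_fact_conv_mangoldt[of "2*n"]
    by (simp add: sum_subtractf sum_distrib_left algebra_simps)
  also have "\<dots> = ln (real (2 * n choose n))"
    by (simp add: binomial_fact ln_div ln_mult)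
  also have "\<dots> \<le> ln (2 ^ (2 * n))"
    by (subst ln_le_cancel_iff) (use binomial_le_pow2[of "2*n" n] in \<open>auto simp flip: of_nat_le_iff\<close>)
  also have "\<dots> = 2 * real n * ln 2"
    by (simp add: ln_realpow)
  finally have "(\<Sum>d\<in>{n<..2*n}. mangoldt d) \<le> 2 * real n * ln 2" .
  moreover have "sum mangoldt {1..2*n} = sum mangoldt {1..n} + (sum mangoldt {n<..2*n} :: real)"
    by (subst sum.union_disjoint[symmetric]) (auto intro: sum.cong)
  ultimately show ?thesis
    by simp
qed

lemma sum_mangoldt_le: "(\<Sum>d=1..N. mangoldt d) \<le> 4 * real N"
proof (induction N rule: less_induct)
  case (less N)
  show ?case
  proof (cases "N \<le> 1")
    case True
    then show ?thesis by (cases N) auto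
  next
    case False
    \<comment> \<open>Rounding up makes \<open>2 * n\<close> cover \<open>N\<close>; the recursion
      then costs \<open>4 * n + 2 * n\<close>, and \<open>6 * n \<le> 4 * N\<close> holds from
      \<open>N = 2\<close> on.\<close>
    define n where "n = (N + 1) div 2"
    have n: "n < N" "N \<le> 2 * n" "2 * n \<le> N + 1"
      using False by (auto simp: n_def)
    have "(\<Sum>d=1..N. mangoldt d) \<le> (\<Sum>d=1..2*n. mangoldt d :: real)"
      using n by (intro sum_mono2) (auto simp: mangoldt_nonneg)
    also have "\<dots> \<le> (\<Sum>d=1..n. mangoldt d) + 2 * real n * ln 2"
      by (rule sum_mangoldt_double_le)
    also have "\<dots> \<le> 4 * real n + 2 * real n * 1"
      using ln_2_less_1 less.IH[OF n(1)] by (intro add_mono mult_left_mono) auto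
    also have "\<dots> \<le> 4 * real N"
      using n False by linarith
    finally show ?thesis .
  qed
qed

lemma ln_fact_bounds:
  assumes "N \<ge> 1"
  shows "ln (fact N) \<le> real N * ln (real N)" "ln (fact N) \<ge> real N * ln (real N) - real N"
proof -
  have "ln (fact N) \<le> ln (real N ^ N)"
    using assms fact_le_power[of N] by (subst ln_le_cancel_iff) (auto simp: fact_le_power)
  then show "ln (fact N) \<le> real N * ln (real N)"
    using assms by (simp add: ln_realpow)
  \<comment> \<open>The single term \<open>k = N\<close> of the exponential series at
    \<open>N\<close> yields \<open>N ^ N / fact N \<le> exp N\<close>, a weak form of Stirling's
    formula.\<close>
  have "(\<Sum>k\<in>{N}. real N ^ k /\<^sub>R fact k) \<le> (\<Sum>k. real N ^ k /\<^sub>R fact k)"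
    by (intro sum_le_suminf summable_exp_generic) auto
  then have "real N ^ N / fact N \<le> exp (real N)"
    by (simp add: exp_def field_simps)
  then have "ln (real N ^ N / fact N) \<le> ln (exp (real N))"
    using assms by (subst ln_le_cancel_iff) auto
  then show "ln (fact N) \<ge> real N * ln (real N) - real N"
    using assms by (simp add: ln_div ln_realpow)
qed

text \<open>Replacing \<open>N div d\<close> by \<open>N / d\<close> in the formula for
  \<open>ln (fact N)\<close> changes the sum by at most \<open>4 * N\<close>, by Chebyshev's bound.
  Division by \<open>N\<close> leaves the constant 4; the constant 1 comes from
  \<open>ln_fact_bounds\<close>.\<close>

lemma sum_mangoldt_over_n_bounds:
  assumes "N \<ge> 1"
  shows "(\<Sum>d=1..N. mangoldt d / real d) \<le> ln (real N) + 4"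
    and "(\<Sum>d=1..N. mangoldt d / real d) \<ge> ln (real N) - 1"
proof -
  have le: "ln (fact N) \<le> real N * (\<Sum>d=1..N. mangoldt d / real d)"
    unfolding ln_fact_conv_mangoldt sum_distrib_left
  proof (intro sum_mono)
    fix d
    have "real (N div d) \<le> real N / real d"
      by (rule of_nat_div_le_of_nat)
    then show "mangoldt d * real (N div d) \<le> real N * (mangoldt d / real d)"
      using mult_left_mono[OF _ mangoldt_nonneg[of d], of "real (N div d)" "real N / real d"] by (simp add: field_simps)
  qed
  have "real N * (\<Sum>d=1..N. mangoldt d / real d) - (\<Sum>d=1..N. mangoldt d) \<le> ln (fact N)"
    unfolding ln_fact_conv_mangoldt sum_distrib_left sum_subtractf[symmetric]
  proof (intro sum_mono)
    fix d
    have "real N / real d - 1 \<le> real (N div d)"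
      using floor_divide_of_nat_eq[of N d, where ?'a = real] by linarith
    from mult_left_mono[OF this mangoldt_nonneg[of d]]
    show "real N * (mangoldt d / real d) - mangoldt d \<le> mangoldt d * real (N div d)"
      by (simp add: field_simps)
  qed
  with sum_mangoldt_le[of N] ln_fact_bounds[OF assms]
  have "real N * (\<Sum>d=1..N. mangoldt d / real d) \<le> real N * (ln (real N) + 4)"
    by (simp add: algebra_simps)
  then show "(\<Sum>d=1..N. mangoldt d / real d) \<le> ln (real N) + 4"
    using assms by simp
  from le ln_fact_bounds[OF assms]
  have "real N * (\<Sum>d=1..N. mangoldt d / real d) \<ge> real N * (ln (real N) - 1)"
    by (simp add: algebra_simps)
  then show "(\<Sum>d=1..N. mangoldt d / real d) \<ge> ln (real N) - 1"
    using assms by simp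
qed

text \<open>By \<open>ln p \<le> 2 * sqrt p\<close> the left side is at most
  \<open>2 / (p * sqrt p)\<close>, which a telescoping difference dominates.\<close>

lemma ln_over_square_le:
  assumes "p \<ge> (2::nat)"
  shows "ln (real p) / real p ^ 2 \<le> 4 * (1 / sqrt (real (p - 1)) - 1 / sqrt (real p))"
proof -
  define s t where "s = sqrt (real p)" and "t = sqrt (real (p - 1))"
  have st: "s > 0" "t > 0" "t \<le> s" "s\<^sup>2 = real p" "s\<^sup>2 = t\<^sup>2 + 1"
    using assms by (auto simp: s_def t_def)
  have "ln (real p) = 2 * ln s"
    using st(1) unfolding st(4)[symmetric] by (simp add: ln_realpow)
  also have "\<dots> \<le> 2 * s"
    using ln_le_minus_one[of s] st by linarith
  finally have "ln (real p) / real p ^ 2 \<le> 2 * s / (s\<^sup>2)\<^sup>2"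
    unfolding st(4) by (intro divide_right_mono) auto
  also have "\<dots> = 4 / (s * s * (2 * s))"
    using st by (simp add: power2_eq_square divide_simps)
  also have "\<dots> \<le> 4 / (s * t * (s + t))"
    using st by (intro divide_left_mono mult_mono) auto
  also have "\<dots> = 4 * ((s\<^sup>2 - t\<^sup>2) / (s * t * (s + t)))"
    using st by simp
  also have "\<dots> = 4 * (1 / t - 1 / s)"
    using st(1-3) by (simp add: power2_eq_square divide_simps) (simp add: algebra_simps)
  finally show ?thesis
    by (simp add: s_def t_def)
qed

lemma sum_ln_over_square_le: "(\<Sum>p=2..N. ln (real p) / real p ^ 2) \<le> 4"
proof -
  have "(\<Sum>p=2..N. ln (real p) / real p ^ 2) \<le>
      (\<Sum>p=2..N. 4 * (1 / sqrt (real (p - 1)) - 1 / sqrt (real p)))"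
    by (intro sum_mono ln_over_square_le) auto
  also have "\<dots> \<le> 4"
  proof (cases "N \<ge> 2")
    case True
    have "(\<Sum>p=2..N. 4 * (1 / sqrt (real (p - 1)) - 1 / sqrt (real p))) =
      4 * (\<Sum>p=Suc 1..N. - (1 / sqrt (real p)) - - (1 / sqrt (real (p - 1))))"
      by (simp add: sum_distrib_left numeral_2_eq_2)
    also have "\<dots> = 4 * (1 - 1 / sqrt (real N))"
      using True by (subst sum_telescope'') auto
    finally show ?thesis
      using True by simp
  qed auto
  finally show ?thesis .
qed

text \<open>Only proper prime powers contribute, and for each \<open>p\<close> the geometric series
  over the exponents from 2 on is at most \<open>2 / p\<^sup>2\<close>. This allows sums of
  \<open>mangoldt d / d\<close> to be exchanged for sums over primes.\<close>

lemma sum_mangoldt_nonprime_le: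
  "(\<Sum>d | d \<in> {1..N} \<and> \<not> prime d. mangoldt d / real d) \<le> 8"
proof -
  define f where "f = (\<lambda>(p, k). p ^ k :: nat)"
  define I where "I = {p \<in> {2..N}. prime p} \<times> {2..N}"
  have fin: "finite I"
    by (auto simp: I_def)
  have "(\<Sum>d | d \<in> {1..N} \<and> \<not> prime d. mangoldt d / real d) =
        (\<Sum>d | d \<in> {1..N} \<and> \<not> prime d \<and> primepow d. mangoldt d / real d)"
    by (intro sum.mono_neutral_right) (auto simp: mangoldt_def)
  also have "\<dots> \<le> (\<Sum>d\<in>f ` I. mangoldt d / real d)"
  proof (intro sum_mono2)
    show "{d. d \<in> {1..N} \<and> \<not> prime d \<and> primepow d} \<subseteq> f ` I"
    proof clarify
      fix d assume d: "d \<in> {1..N}" "\<not> prime d" "primepow d"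
      then obtain p k where pk: "prime p" "k > 0" "d = p ^ k"
        by (auto simp: primepow_def)
      then have "k \<noteq> 1"
        using d by auto
      moreover have "p \<ge> 2"
        using pk prime_ge_2_nat by auto
      moreover have "p \<le> p ^ k"
        using pk prime_ge_1_nat by (intro self_le_power) auto
      moreover have "k \<le> p ^ k"
        using less_exp[of k] power_mono[of 2 p k] \<open>p \<ge> 2\<close> by linarith
      then have "k \<le> N"
        using pk(3) d(1) by simp
      ultimately have "(p, k) \<in> I"
        using pk d by (auto simp: I_def)
      then show "d \<in> f ` I"
        using pk by (force simp: f_def)
    qed
  qed (use fin in \<open>auto simp: mangoldt_nonneg\<close>)
  also have "\<dots> \<le> (\<Sum>pk\<in>I. mangoldt (f pk) / real (f pk))"
    using sum_image_le[OF fin, of "\<lambda>d. mangoldt d / real d" f] by (simp add: mangoldt_nonneg o_def)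
  also have "\<dots> = (\<Sum>(p, k)\<in>I. ln (real p) / real p ^ k)"
    by (intro sum.cong) (auto simp: I_def f_def)
  also have "\<dots> = (\<Sum>p | p \<in> {2..N} \<and> prime p. \<Sum>k=2..N. ln (real p) / real p ^ k)"
    unfolding I_def by (subst sum.cartesian_product[symmetric]) auto
  also have "\<dots> \<le> (\<Sum>p | p \<in> {2..N} \<and> prime p. 2 * (ln (real p) / real p ^ 2))"
  proof (intro sum_mono)
    fix p assume p: "p \<in> {p. p \<in> {2..N} \<and> prime p}"
    then have p2: "real p \<ge> 2"
      by simp
    have "(\<Sum>k=2..N. (1 / real p) ^ k) = ((1 / real p)\<^sup>2 - (1 / real p) ^ Suc N) / (1 - 1 / real p)"
      using p by (subst sum_gp) auto
    also have "\<dots> \<le> (1 / real p)\<^sup>2 / (1 / 2)"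
      using p2 by (intro frac_le) auto
    finally have "(\<Sum>k=2..N. (1 / real p) ^ k) \<le> 2 / real p ^ 2"
      by (simp add: field_simps)
    from mult_left_mono[OF this, of "ln (real p)"] p2
    show "(\<Sum>k=2..N. ln (real p) / real p ^ k) \<le> 2 * (ln (real p) / real p ^ 2)"
      by (simp add: sum_distrib_left power_one_over field_simps)
  qed
  also have "\<dots> \<le> (\<Sum>p=2..N. 2 * (ln (real p) / real p ^ 2))"
    by (intro sum_mono2) auto
  also have "\<dots> \<le> 8"
    unfolding sum_distrib_left[symmetric] using sum_ln_over_square_le[of N] by simp
  finally show ?thesis .
qed

subsection \<open>Characters modulo m\<close>

text \<open>Dirichlet characters modulo \<open>m\<close>, extended by 0 to all integers. The domain
  is \<open>int\<close> because they are applied to \<open>a * b + n\<close>, which may be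
  negative.\<close>

definition dchar :: "nat \<Rightarrow> (int \<Rightarrow> complex) \<Rightarrow> bool" where
  "dchar m \<chi> \<longleftrightarrow> (\<forall>a b. \<chi> (a * b) = \<chi> a * \<chi> b) \<and>
     (\<forall>a b. [a = b] (mod int m) \<longrightarrow> \<chi> a = \<chi> b) \<and>
     (\<forall>a. \<chi> a \<noteq> 0 \<longleftrightarrow> coprime a (int m))"

lemma dchar_mult: "dchar m \<chi> \<Longrightarrow> \<chi> (a * b) = \<chi> a * \<chi> b"
  and dchar_cong: "dchar m \<chi> \<Longrightarrow> [a = b] (mod int m) \<Longrightarrow> \<chi> a = \<chi> b"
  and dchar_eq_0_iff: "dchar m \<chi> \<Longrightarrow> \<chi> a = 0 \<longleftrightarrow> \<not> coprime a (int m)"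
  unfolding dchar_def by blast+

lemma dchar_1: "dchar m \<chi> \<Longrightarrow> \<chi> 1 = 1"
  using dchar_mult[of m \<chi> 1 1] dchar_eq_0_iff[of m \<chi> 1] by simp

lemma dchar_power: "dchar m \<chi> \<Longrightarrow> \<chi> (a ^ k) = \<chi> a ^ k"
  by (induction k) (simp_all add: dchar_1 dchar_mult)

lemma dchar_mod: "dchar m \<chi> \<Longrightarrow> \<chi> (a mod int m) = \<chi> a"
  by (rule dchar_cong) auto

lemma dchar_power_totient:
  assumes "dchar m \<chi>" "m > 0" "coprime a (int m)"
  shows "\<chi> a ^ totient m = 1"
proof -
  define b where "b = nat (a mod int m)"
  have b: "int b = a mod int m"
    using assms by (simp add: b_def)
  then have "coprime (int b) (int m)"
    using assms by simp
  then have "[b ^ totient m = 1] (mod m)"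
    by (intro euler_theorem) simp
  then have "[int b ^ totient m = 1] (mod int m)"
    by (metis cong_int_iff of_nat_1 of_nat_power)
  then have "\<chi> (int b ^ totient m) = 1"
    using dchar_cong[OF assms(1)] dchar_1[OF assms(1)] by metis
  then show ?thesis
    using assms b by (simp add: dchar_power dchar_mod)
qed

lemma norm_dchar:
  assumes "dchar m \<chi>" "m > 0"
  shows "norm (\<chi> a) = (if coprime a (int m) then 1 else 0)"
proof (cases "coprime a (int m)")
  case True
  have "norm (\<chi> a) ^ totient m = 1"
    using dchar_power_totient[OF assms True] by (metis norm_one norm_power)
  then show ?thesis
    using True assms power_eq_imp_eq_base[of "norm (\<chi> a)" "totient m" 1] by simp
next
  case False
  then show ?thesis
    using dchar_eq_0_iff[OF assms(1)] by simp
qed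

lemma norm_dchar_le_1: "dchar m \<chi> \<Longrightarrow> m > 0 \<Longrightarrow> norm (\<chi> a) \<le> 1"
  by (simp add: norm_dchar)

lemma dchar_mult_cnj:
  "dchar m \<chi> \<Longrightarrow> m > 0 \<Longrightarrow> \<chi> a * cnj (\<chi> a) = (if coprime a (int m) then 1 else 0)"
  by (simp add: complex_norm_square[symmetric] norm_dchar)

text \<open>A character is determined by its values on one period, and these are 0 or roots of unity
  of order dividing \<open>totient m\<close>.\<close>

lemma finite_dchars:
  assumes "m > 0"
  shows "finite {\<chi>. dchar m \<chi>}"
proof (rule finite_subset)
  let ?R = "insert 0 {z :: complex. z ^ totient m = 1}"
  show "{\<chi>. dchar m \<chi>} \<subseteq> (\<lambda>f a. f (a mod int m)) ` ({0..<int m} \<rightarrow>\<^sub>E ?R)"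
  proof clarify
    fix \<chi> assume \<chi>: "dchar m \<chi>"
    have "restrict \<chi> {0..<int m} \<in> {0..<int m} \<rightarrow>\<^sub>E ?R"
      using dchar_power_totient[OF \<chi> assms] dchar_eq_0_iff[OF \<chi>] by auto
    moreover have "\<chi> = (\<lambda>a. restrict \<chi> {0..<int m} (a mod int m))"
      using assms \<chi> by (auto simp: dchar_mod)
    ultimately show "\<chi> \<in> (\<lambda>f a. f (a mod int m)) ` ({0..<int m} \<rightarrow>\<^sub>E ?R)"
      by blast
  qed
  show "finite ((\<lambda>f a. f (a mod int m)) ` ({0..<int m} \<rightarrow>\<^sub>E ?R))"
    using assms by (intro finite_imageI finite_PiE) (auto intro!: finite_roots_unity simp: Suc_le_eq)
qed

lemma dchar_times: "dchar m \<chi> \<Longrightarrow> dchar m \<psi> \<Longrightarrow> dchar m (\<lambda>a. \<chi> a * \<psi> a)"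
  unfolding dchar_def by (auto simp: ac_simps)

lemma dchar_cnj: "dchar m \<chi> \<Longrightarrow> dchar m (\<lambda>a. cnj (\<chi> a))"
  unfolding dchar_def by auto

lemma dchar_pow: "dchar m \<chi> \<Longrightarrow> k > 0 \<Longrightarrow> dchar m (\<lambda>a. \<chi> a ^ k)"
  unfolding dchar_def by (auto simp: power_mult_distrib)

definition principal_dchar :: "nat \<Rightarrow> int \<Rightarrow> complex" where
  "principal_dchar m a = (if coprime a (int m) then 1 else 0)"

lemma dchar_principal_dchar: "dchar m (principal_dchar m)"
proof -
  have "coprime a (int m) \<longleftrightarrow> coprime b (int m)" if "[a = b] (mod int m)" for a b
    using that cong_imp_coprime cong_sym by blast
  then show ?thesis
    unfolding dchar_def principal_dchar_def by auto
qed

lemma nonprincipal_obtain: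
  assumes "dchar m \<chi>" "\<chi> \<noteq> principal_dchar m"
  obtains c where "coprime c (int m)" "\<chi> c \<noteq> 1"
proof -
  obtain c where "\<chi> c \<noteq> principal_dchar m c"
    using assms by blast
  then show ?thesis
    using that[of c] dchar_eq_0_iff[OF assms(1), of c] by (auto simp: principal_dchar_def split: if_splits)
qed

text \<open>Multiplication by a unit \<open>c\<close> with \<open>\<chi> c \<noteq> 1\<close>
  permutes the residues and scales the sum by \<open>\<chi> c\<close>.\<close>

lemma sum_dchar_period:
  assumes "dchar m \<chi>" "\<chi> \<noteq> principal_dchar m" "m > 0"
  shows "(\<Sum>a\<in>{0..<int m}. \<chi> a) = 0"
proof -
  obtain c where c: "coprime c (int m)" "\<chi> c \<noteq> 1"
    using nonprincipal_obtain assms by blast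
  have inj: "inj_on (\<lambda>a. c * a mod int m) {0..<int m}"
  proof (rule inj_onI)
    fix a b assume ab: "a \<in> {0..<int m}" "b \<in> {0..<int m}" "c * a mod int m = c * b mod int m"
    then have "[a = b] (mod int m)"
      using c(1) cong_mult_lcancel[of c "int m" a b] by (auto simp: cong_def)
    then show "a = b"
      using ab by (simp add: cong_def)
  qed
  have "(\<lambda>a. c * a mod int m) ` {0..<int m} = {0..<int m}"
    using assms by (intro endo_inj_surj inj) auto
  then have "(\<Sum>a\<in>{0..<int m}. \<chi> a) = (\<Sum>a\<in>{0..<int m}. \<chi> (c * a mod int m))"
    using sum.reindex[OF inj, of \<chi>] by (simp add: o_def)
  also have "\<dots> = \<chi> c * (\<Sum>a\<in>{0..<int m}. \<chi> a)"
    using assms by (simp add: dchar_mod dchar_mult sum_distrib_left)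
  finally show ?thesis
    using c(2) by auto
qed

text \<open>Complete periods cancel, so only a piece shorter than \<open>m\<close> remains, with
  terms of norm at most 1.\<close>

lemma norm_sum_dchar_le:
  assumes "dchar m \<chi>" "\<chi> \<noteq> principal_dchar m" "m > 0"
  shows "norm (\<Sum>n=1..N. \<chi> (int n)) \<le> real m"
proof -
  define S where "S = (\<lambda>k. \<Sum>n<k. \<chi> (int n))"
  have "S m = (\<Sum>a\<in>int ` {..<m}. \<chi> a)"
    unfolding S_def by (subst sum.reindex) auto
  also have "int ` {..<m} = {0..<int m}"
    by (metis atLeast0LessThan image_int_atLeastLessThan of_nat_0)
  finally have Sm: "S m = 0"
    using sum_dchar_period[OF assms] by simp
  have period: "S (m + k) = S k" for k
  proof (induction k)
    case (Suc k)
    have "\<chi> (int (m + k)) = \<chi> (int k)"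
      by (rule dchar_cong[OF assms(1)]) (simp add: cong_def)
    then show ?case
      using Suc by (simp add: S_def)
  qed (use Sm in \<open>simp add: S_def\<close>)
  have S: "norm (S k) \<le> real m" for k
  proof (induction k rule: less_induct)
    case (less k)
    show ?case
    proof (cases "k < m")
      case True
      have "norm (S k) \<le> (\<Sum>n<k. 1)"
        unfolding S_def using assms by (intro sum_norm_le norm_dchar_le_1) auto
      then show ?thesis
        using True by simp
    next
      case False
      then show ?thesis
        using less[of "k - m"] assms period[of "k - m"] by simp
    qed
  qed
  obtain c where c: "coprime c (int m)" "\<chi> c \<noteq> 1"
    using nonprincipal_obtain assms by blast
  have "m \<noteq> 1"
    using c dchar_cong[OF assms(1), of c 1] dchar_1[OF assms(1)] by (auto simp: cong_def)
  then have "\<chi> 0 = 0"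
    using dchar_eq_0_iff[OF assms(1), of 0] by simp
  then have "(\<Sum>n=1..N. \<chi> (int n)) = S (Suc N)"
    unfolding S_def by (intro sum.mono_neutral_left) (auto simp: not_less_eq_eq)
  then show ?thesis
    using S by simp
qed

text \<open>The character is the discrete logarithm to a primitive root \<open>g\<close>, followed
  by the map of exponents to roots of unity. Its faithfulness, the last conclusion, serves to
  separate residues; its value at \<open>g\<close> serves the sieve.\<close>

lemma primitive_dchar_exists:
  assumes "prime p"
  obtains \<chi> g where "dchar p \<chi>" "coprime g (int p)" "\<chi> g = cis (2 * pi / real (p - 1))"
    "\<And>a. \<chi> a = 1 \<Longrightarrow> [a = 1] (mod int p)"
proof -
  have p: "p > 1"
    using assms prime_gt_1_nat by blast
  obtain g where g: "residue_primroot p g"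
    using prime_primitive_root_exists[OF p assms] by blast
  then have cop: "coprime p g" and ord: "ord p g = p - 1"
    using assms by (auto simp: residue_primroot_def totient_prime)
  have bij: "bij_betw (\<lambda>i. g ^ i mod p) {..<p - 1} (totatives p)"
    using residue_primroot_is_generator[OF p g] assms by (simp add: totient_prime)
  define w where "w = cis (2 * pi / real (p - 1))"
  have wp: "w ^ (p - 1) = 1"
    using p by (simp add: w_def DeMoivre)
  have w_mod: "w ^ i = w ^ j" if "[i = j] (mod (p - 1))" for i j
  proof -
    have "w ^ i = w ^ (i mod (p - 1))" for i
    proof -
      have "w ^ i = w ^ ((p - 1) * (i div (p - 1)) + i mod (p - 1))"
        by simp
      also have "\<dots> = w ^ (i mod (p - 1))"
        unfolding power_add power_mult wp by simp
      finally show ?thesis .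
    qed
    from this[of i] this[of j] show ?thesis
      using that by (simp add: cong_def)
  qed
  have ex: "\<exists>i<p - 1. [a = int (g ^ i)] (mod int p)" if "coprime a (int p)" for a
  proof -
    have a: "a mod int p = int (nat (a mod int p))"
      using p by simp
    have "coprime (a mod int p) (int p)"
      using that p by simp
    moreover from this have "a mod int p \<noteq> 0"
      using p by (intro notI) simp
    ultimately have "coprime (nat (a mod int p)) p" "nat (a mod int p) > 0"
      using p a pos_mod_sign[of "int p" a] by (metis coprime_int_iff, linarith)
    then have "nat (a mod int p) \<in> totatives p"
      using p by (auto simp: totatives_def nat_le_iff intro: less_imp_le)
    then obtain i where i: "i < p - 1" "nat (a mod int p) = g ^ i mod p"
      using bij by (auto simp: bij_betw_def)
    have "a mod int p = int (g ^ i) mod int p"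
      using a unfolding i(2) by (simp add: zmod_int)
    then show ?thesis
      using i(1) by (auto simp: cong_def)
  qed
  \<comment> \<open>The exponent matters only modulo \<open>p - 1\<close>: \<open>ind_unique\<close>
    turns any other representation into a congruence, under which the powers of \<open>w\<close>
    agree.\<close>
  define ind where "ind = (\<lambda>a. SOME i. i < p - 1 \<and> [a = int (g ^ i)] (mod int p))"
  have ind: "ind a < p - 1 \<and> [a = int (g ^ ind a)] (mod int p)" if "coprime a (int p)" for a
    unfolding ind_def by (rule someI_ex) (rule ex[OF that])
  have ind_unique: "[ind a = i] (mod (p - 1))" if "coprime a (int p)" "[a = int (g ^ i)] (mod int p)" for a i
  proof -
    have "[int (g ^ ind a) = int (g ^ i)] (mod int p)"
      using ind[OF that(1)] that(2) by (meson cong_sym cong_trans)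
    then show ?thesis
      using order_divides_expdiff[OF cop] ord by (simp only: cong_int_iff)
  qed
  define \<chi> where "\<chi> = (\<lambda>a. if coprime a (int p) then w ^ ind a else 0)"
  have "dchar p \<chi>"
    unfolding dchar_def
  proof (intro conjI allI impI)
    fix a b :: int
    show "\<chi> (a * b) = \<chi> a * \<chi> b"
    proof (cases "coprime a (int p) \<and> coprime b (int p)")
      case True
      then have "[a * b = int (g ^ (ind a + ind b))] (mod int p)"
        using cong_mult[of a _ "int p" b] ind by (simp add: power_add)
      then have "w ^ ind (a * b) = w ^ (ind a + ind b)"
        using True by (intro w_mod ind_unique) auto
      then show ?thesis
        using True by (simp add: \<chi>_def power_add)
    qed (auto simp: \<chi>_def)
    assume "[a = b] (mod int p)"
    moreover from this have "coprime a (int p) \<longleftrightarrow> coprime b (int p)"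
      using cong_imp_coprime cong_sym by blast
    ultimately show "\<chi> a = \<chi> b"
      unfolding \<chi>_def using ind[of b] by (auto intro!: w_mod ind_unique intro: cong_trans)
  qed (auto simp: \<chi>_def w_def)
  moreover have "coprime (int g) (int p)"
    using cop by (simp add: coprime_commute)
  moreover from this have "\<chi> (int g) = w"
    using w_mod[OF ind_unique[of "int g" 1]] by (simp add: \<chi>_def)
  moreover have "[a = 1] (mod int p)" if "\<chi> a = 1" for a
  proof -
    have a: "coprime a (int p)" "w ^ ind a = 1"
      using that by (auto simp: \<chi>_def split: if_splits)
    have "cis (2 * pi * real (ind a) / real (p - 1)) = cis (2 * pi * real 0 / real (p - 1))"
      using a(2) by (simp add: w_def DeMoivre mult_ac)
    then have "ind a = 0"
      using inj_onD[OF bij_betw_imp_inj_on[OF bij_betw_roots_unity[of "p - 1"]], of "ind a" 0] ind[OF a(1)] p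
      by simp
    then show ?thesis
      using ind[OF a(1)] by simp
  qed
  ultimately show ?thesis
    using that[of \<chi> "int g"] by (simp add: w_def)
qed

section \<open>Separation and orthogonality of characters for squarefree moduli\<close>

lemma squarefree_dvd_nat:
  fixes m :: nat and a :: int
  assumes "squarefree m" "\<And>p. prime p \<Longrightarrow> p dvd m \<Longrightarrow> int p dvd a"
  shows "int m dvd a"
proof (cases "a = 0")
  case False
  have "m dvd nat \<bar>a\<bar>"
  proof (rule multiplicity_le_imp_dvd)
    show "m \<noteq> 0"
      using assms(1) by (intro notI) simp
    fix p :: nat
    assume p: "prime p"
    show "multiplicity p m \<le> multiplicity p (nat \<bar>a\<bar>)"
    proof (cases "p dvd m")
      case True
      then have "p dvd nat \<bar>a\<bar>"
        using assms(2)[OF p] by (simp add: nat_abs_dvd_iff flip: int_dvd_int_iff)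
      then have "multiplicity p (nat \<bar>a\<bar>) \<ge> 1"
        using False p by (intro multiplicity_geI) auto
      moreover have "multiplicity p m \<le> 1"
        using assms(1) p \<open>m \<noteq> 0\<close> by (simp add: squarefree_factorial_semiring'')
      ultimately show ?thesis
        by simp
    qed (simp add: not_dvd_imp_multiplicity_0)
  qed
  then show ?thesis
    by (simp add: nat_dvd_iff)
qed simp

lemma dchar_lift:
  assumes "dchar d \<chi>" "d dvd m"
  shows "dchar m (\<lambda>a. if coprime a (int m) then \<chi> a else 0)"
proof -
  have *: "coprime a (int d)" if "coprime a (int m)" for a
    using that assms(2) by (meson coprime_divisors dvd_refl of_nat_dvd_iff)
  have **: "[a = b] (mod int d)" if "[a = b] (mod int m)" for a b
    using that assms(2) by (meson cong_dvd_modulus of_nat_dvd_iff)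
  have ***: "coprime a (int m) \<longleftrightarrow> coprime b (int m)" if "[a = b] (mod int m)" for a b
    using that cong_imp_coprime cong_sym by blast
  show ?thesis
    unfolding dchar_def using *** dchar_cong[OF assms(1) **] dchar_eq_0_iff[OF assms(1)] *
    by (auto simp: dchar_mult[OF assms(1)])
qed

text \<open>For squarefree \<open>m\<close>, a unit that is not 1 modulo \<open>m\<close> already
  differs from 1 modulo some prime \<open>p\<close> dividing \<open>m\<close>; the faithful
  character modulo \<open>p\<close> is lifted to \<open>m\<close>.\<close>

lemma dchar_separates:
  assumes "squarefree m" "coprime n (int m)" "\<not> [n = 1] (mod int m)"
  obtains \<chi> where "dchar m \<chi>" "\<chi> n \<noteq> 1"
proof -
  obtain p where p: "prime p" "p dvd m" "\<not> int p dvd n - 1"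
    using squarefree_dvd_nat[of m "n - 1"] assms(1,3) by (auto simp: cong_iff_dvd_diff)
  obtain \<chi> where \<chi>: "dchar p \<chi>" "\<And>a. \<chi> a = 1 \<Longrightarrow> [a = 1] (mod int p)"
    using primitive_dchar_exists[OF p(1)] by metis
  have "\<chi> n \<noteq> 1"
    using \<chi>(2) p(3) by (auto simp: cong_iff_dvd_diff)
  then show ?thesis
    using that[OF dchar_lift[OF \<chi>(1) p(2)]] assms(2) by simp
qed

lemma sum_dchars:
  assumes "squarefree m" "m > 0"
  shows "(\<Sum>\<chi> | dchar m \<chi>. \<chi> n) = (if [n = 1] (mod int m) then of_nat (card {\<chi>. dchar m \<chi>}) else 0)"
proof -
  consider "[n = 1] (mod int m)" | "\<not> coprime n (int m)" "\<not> [n = 1] (mod int m)"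
    | "coprime n (int m)" "\<not> [n = 1] (mod int m)"
    by blast
  then show ?thesis
  proof cases
    case 1
    have "\<chi> n = 1" if "dchar m \<chi>" for \<chi>
      using dchar_cong[OF that 1] dchar_1[OF that] by metis
    then have "(\<Sum>\<chi> | dchar m \<chi>. \<chi> n) = (\<Sum>\<chi> | dchar m \<chi>. 1)"
      by (intro sum.cong) auto
    then show ?thesis
      using 1 by simp
  next
    case 2
    then have "\<chi> n = 0" if "dchar m \<chi>" for \<chi>
      using dchar_eq_0_iff[OF that] by simp
    then have "(\<Sum>\<chi> | dchar m \<chi>. \<chi> n) = 0"
      by (intro sum.neutral) auto
    then show ?thesis
      using 2 by simp
  next
    case 3
    then obtain \<psi> where \<psi>: "dchar m \<psi>" "\<psi> n \<noteq> 1"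
      using dchar_separates assms by blast
    \<comment> \<open>Twisting by \<open>\<psi>\<close> is a bijection of the characters, inverse to
      twisting by the conjugate: on units the two factors cancel, and elsewhere
      \<open>\<chi>\<close> vanishes.\<close>
    have triv: "\<chi> a * (\<psi> a * cnj (\<psi> a)) = \<chi> a" if "dchar m \<chi>" for \<chi> a
      using dchar_mult_cnj[OF \<psi>(1) assms(2), of a] dchar_eq_0_iff[OF that, of a] by auto
    have "(\<Sum>\<chi> | dchar m \<chi>. \<chi> n) = (\<Sum>\<chi> | dchar m \<chi>. \<psi> n * \<chi> n)"
      by (rule sum.reindex_bij_witness[of _ "\<lambda>\<chi> a. \<psi> a * \<chi> a" "\<lambda>\<chi> a. cnj (\<psi> a) * \<chi> a"])
         (use triv in \<open>auto intro!: dchar_times dchar_cnj \<psi>(1) simp: fun_eq_iff mult_ac\<close>)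
    then have "(\<Sum>\<chi> | dchar m \<chi>. \<chi> n) = 0"
      using \<psi>(2) by (simp flip: sum_distrib_left)
    then show ?thesis
      using 3 by simp
  qed
qed

subsection \<open>Partial sums of character series\<close>

text \<open>Summation by parts. Partial sums that start at \<open>Suc M\<close> are differences of
  two initial sums, hence the factor 2.\<close>

lemma abel_summation_bound:
  fixes c :: "nat \<Rightarrow> complex" and f :: "nat \<Rightarrow> real"
  assumes B: "\<And>N. norm (\<Sum>n=1..N. c n) \<le> B"
    and f0: "\<And>n. n > M \<Longrightarrow> f n \<ge> 0" and f: "\<And>n. n > M \<Longrightarrow> f (Suc n) \<le> f n"
  shows "norm (\<Sum>n=Suc M..N. c n * of_real (f n)) \<le> 2 * B * f (Suc M)"
proof -
  define S where "S = (\<lambda>k. \<Sum>n=Suc M..k. c n)"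
  have S: "norm (S k) \<le> 2 * B" for k
  proof (cases "k > M")
    case True
    have "(\<Sum>n=1..M. c n) + S k = (\<Sum>n=1..k. c n)"
      using sum.ub_add_nat[of 1 M c "k - M"] True by (simp add: S_def)
    then have "S k = (\<Sum>n=1..k. c n) - (\<Sum>n=1..M. c n)"
      by (simp add: algebra_simps)
    also have "norm \<dots> \<le> B + B"
      using B by (intro norm_triangle_le_diff add_mono)
    finally show ?thesis by simp
  next
    case False
    then show ?thesis
      using B[of 0] by (simp add: S_def)
  qed
  have B0: "B \<ge> 0"
    using B[of 0] by simp
  have *: "norm ((\<Sum>n=Suc M..N. c n * of_real (f n)) - S N * of_real (f N)) \<le> 2 * B * (f (Suc M) - f N)"
    if "Suc M \<le> N" for N
    using that
  proof (induction N rule: dec_induct)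
    case (step N)
    then have N: "N > M" by simp
    have "(\<Sum>n=Suc M..Suc N. c n * of_real (f n)) - S (Suc N) * of_real (f (Suc N)) =
      ((\<Sum>n=Suc M..N. c n * of_real (f n)) - S N * of_real (f N)) + S N * of_real (f N - f (Suc N))"
      using N by (simp add: S_def algebra_simps)
    also have "norm \<dots> \<le> 2 * B * (f (Suc M) - f N) + 2 * B * (f N - f (Suc N))"
    proof (intro norm_triangle_mono)
      show "norm (S N * of_real (f N - f (Suc N))) \<le> 2 * B * (f N - f (Suc N))"
        unfolding norm_mult norm_of_real using f[OF N] S[of N] B0 by (intro mult_mono) auto
    qed (rule step.IH)
    finally show ?case
      by (simp add: algebra_simps)
  qed (auto simp: S_def)
  show ?thesis
  proof (cases "N > M")
    case True
    have "norm (\<Sum>n=Suc M..N. c n * of_real (f n)) \<le>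
        norm ((\<Sum>n=Suc M..N. c n * of_real (f n)) - S N * of_real (f N)) + norm (S N * of_real (f N))"
      using norm_triangle_sub by (simp add: algebra_simps)
    also have "norm (S N * of_real (f N)) \<le> 2 * B * f N"
      unfolding norm_mult norm_of_real using f0[OF True] S[of N] B0 by (intro mult_mono) auto
    finally show ?thesis
      using *[of N] True by (simp add: algebra_simps)
  next
    case False
    then show ?thesis
      using B0 f0[of "Suc M"] by simp
  qed
qed

lemma limit_with_rate:
  fixes T :: "nat \<Rightarrow> 'a::banach"
  assumes T: "\<And>N K. N \<le> K \<Longrightarrow> norm (T K - T N) \<le> e N" and e: "e \<longlonglongrightarrow> 0"
  obtains L where "\<And>N. norm (T N - L) \<le> e N"
proof -
  have "Cauchy T"
  proof (rule metric_CauchyI)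
    fix r :: real assume "r > 0"
    then obtain M where M: "\<And>n. n \<ge> M \<Longrightarrow> norm (e n) < r / 2"
      using LIMSEQ_D[OF e, of "r / 2"] by auto
    have "dist (T m) (T n) < r" if "m \<ge> M" "n \<ge> M" for m n
    proof -
      have "dist (T m) (T n) \<le> dist (T m) (T M) + dist (T n) (T M)"
        by (rule dist_triangle2)
      also have "\<dots> \<le> e M + e M"
        unfolding dist_norm using T that by (intro add_mono) auto
      also have "\<dots> < r"
        using M[of M] by simp
      finally show ?thesis .
    qed
    then show "\<exists>M. \<forall>m\<ge>M. \<forall>n\<ge>M. dist (T m) (T n) < r"
      by blast
  qed
  then obtain L where L: "T \<longlonglongrightarrow> L"
    using Cauchy_convergent_iff convergent_def by blast
  have "norm (T N - L) \<le> e N" for N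
  proof (rule LIMSEQ_le_const2)
    show "(\<lambda>K. norm (T K - T N)) \<longlonglongrightarrow> norm (T N - L)"
      by (subst norm_minus_commute) (intro tendsto_norm tendsto_diff L tendsto_const)
    show "\<exists>M. \<forall>K\<ge>M. norm (T K - T N) \<le> e N"
      using T by blast
  qed
  then show ?thesis
    using that by blast
qed

text \<open>The constant is zeta(1/2). The sum minus \<open>2 * sqrt k\<close> decreases in
  \<open>k\<close>, and its steps are at most those of \<open>1 / sqrt k\<close>, which
  telescope.\<close>

lemma sum_inverse_sqrt_asymp:
  obtains c :: real where
    "\<And>k. k \<ge> 1 \<Longrightarrow> \<bar>(\<Sum>e=1..k. 1 / sqrt (real e)) - 2 * sqrt (real k) - c\<bar> \<le> 1 / sqrt (real k)"
proof -
  define u where "u = (\<lambda>k. (\<Sum>e=1..Suc k. 1 / sqrt (real e)) - 2 * sqrt (real (Suc k)))"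
  have step: "u (Suc k) \<le> u k \<and> u k - u (Suc k) \<le> 1 / sqrt (real (Suc k)) - 1 / sqrt (real (Suc (Suc k)))" for k
  proof -
    define s t where "s = sqrt (real (Suc (Suc k)))" and "t = sqrt (real (Suc k))"
    have st: "s > 0" "t > 0" "t \<le> s" "s\<^sup>2 = t\<^sup>2 + 1"
      by (auto simp: s_def t_def)
    have "(s - t) * (s + t) = 1"
      using st(4) by (simp add: power2_eq_square algebra_simps)
    then have d: "s - t = 1 / (s + t)"
      using st by (simp add: field_simps)
    have "u k - u (Suc k) = 2 * (s - t) - 1 / s"
      by (simp add: u_def s_def t_def)
    moreover have "2 * (s - t) \<ge> 1 / s" "2 * (s - t) \<le> 1 / t"
      unfolding d using st by (auto simp: field_simps)
    ultimately show ?thesis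
      by (auto simp: s_def t_def)
  qed
  have "u N - u K \<ge> 0 \<and> u N - u K \<le> 1 / sqrt (real (Suc N)) - 1 / sqrt (real (Suc K))" if "N \<le> K" for N K
    using that
  proof (induction K rule: dec_induct)
    case (step k)
    then show ?case using \<open>\<And>k. u (Suc k) \<le> u k \<and> _ k\<close>[of k] by linarith
  qed auto
  then have "norm (u K - u N) \<le> 1 / sqrt (real (Suc N))" if "N \<le> K" for N K
    using that by (smt (verit) real_norm_def divide_nonneg_nonneg real_sqrt_ge_zero of_nat_0_le_iff)
  moreover have "(\<lambda>N. 1 / sqrt (real (Suc N))) \<longlonglongrightarrow> 0"
    by (intro tendsto_divide_0[OF tendsto_const] filterlim_at_top_imp_at_infinity
          filterlim_compose[OF sqrt_at_top] filterlim_compose[OF filterlim_real_sequentially] filterlim_Suc)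
  ultimately obtain c where c: "\<And>N. norm (u N - c) \<le> 1 / sqrt (real (Suc N))"
    by (rule limit_with_rate) auto
  have "\<bar>(\<Sum>e=1..k. 1 / sqrt (real e)) - 2 * sqrt (real k) - c\<bar> \<le> 1 / sqrt (real k)" if "k \<ge> 1" for k
    using c[of "k - 1"] that by (cases k) (auto simp: u_def)
  then show ?thesis
    using that by blast
qed

lemma sum_inverse_sqrt_le: "(\<Sum>e=1..k. 1 / sqrt (real e)) \<le> 2 * sqrt (real k)"
proof (induction k)
  case (Suc k)
  define s t where "s = sqrt (real (Suc k))" and "t = sqrt (real k)"
  have st: "s > 0" "t \<ge> 0" "t \<le> s" "s\<^sup>2 = t\<^sup>2 + 1"
    by (auto simp: s_def t_def)
  have "s * t \<le> s\<^sup>2 - 1/2"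
    using sum_power2_ge_zero[of "s - t" 0] st(4) by (simp add: power2_eq_square algebra_simps)
  then have "1 / s \<le> 2 * s - 2 * t"
    using st by (simp add: field_simps power2_eq_square)
  then show ?case
    using Suc by (simp add: s_def t_def)
qed auto

text \<open>With \<open>k = N div d\<close> and \<open>y = N / d\<close>, passing from
  \<open>sqrt k\<close> to \<open>sqrt y\<close> costs at most \<open>2 / sqrt y\<close>, and the
  error \<open>1 / sqrt k\<close> is at most \<open>2 / sqrt y\<close> as well; hence the factor
  4.\<close>

lemma sum_inverse_sqrt_real:
  obtains c :: real where
    "\<And>N d. d \<ge> 1 \<Longrightarrow> d \<le> N \<Longrightarrow>
       \<bar>(\<Sum>e=1..N div d. 1 / sqrt (real e)) - 2 * sqrt (real N / real d) - c\<bar> \<le> 4 * sqrt (real d / real N)"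
proof -
  obtain c :: real where c: "\<And>k. k \<ge> 1 \<Longrightarrow>
      \<bar>(\<Sum>e=1..k. 1 / sqrt (real e)) - 2 * sqrt (real k) - c\<bar> \<le> 1 / sqrt (real k)"
    by (rule sum_inverse_sqrt_asymp) blast
  have "\<bar>(\<Sum>e=1..N div d. 1 / sqrt (real e)) - 2 * sqrt (real N / real d) - c\<bar> \<le> 4 * sqrt (real d / real N)"
    if d: "d \<ge> 1" "d \<le> N" for N d :: nat
  proof -
    define k where "k = N div d"
    define y where "y = real N / real d"
    have k: "k \<ge> 1"
      using d by (simp add: k_def div_greater_zero_iff Suc_le_eq)
    have ky: "real k \<le> y" "y < real k + 1"
      unfolding k_def y_def using floor_divide_of_nat_eq[of N d, where ?'a = real] by linarith+
    have y: "y \<ge> 1" "y \<le> 2 * real k"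
      using ky k by linarith+
    have "1 / sqrt (real k) \<le> 2 / sqrt y"
    proof -
      have "sqrt y \<le> sqrt (4 * real k)"
        using y by (intro real_sqrt_le_mono) auto
      also have "\<dots> = 2 * sqrt (real k)"
        by (simp add: real_sqrt_mult)
      finally show ?thesis
        using k y by (simp add: field_simps)
    qed
    moreover have "\<bar>2 * sqrt (real k) - 2 * sqrt y\<bar> \<le> 2 / sqrt y"
    proof -
      have "(sqrt y - sqrt (real k)) * sqrt y \<le> (sqrt y - sqrt (real k)) * (sqrt y + sqrt (real k))"
        using ky by (intro mult_left_mono) auto
      also have "\<dots> = y - real k"
        using y k by (simp add: algebra_simps)
      also have "\<dots> \<le> 1"
        using ky by simp
      finally have "sqrt y - sqrt (real k) \<le> 1 / sqrt y"
        using y by (simp add: field_simps)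
      then show ?thesis
        using ky by simp
    qed
    moreover have "sqrt (real d / real N) = 1 / sqrt y"
      using d by (simp add: y_def real_sqrt_divide)
    ultimately show ?thesis
      using c[OF k] unfolding y_def[symmetric] k_def[symmetric] by linarith
  qed
  then show ?thesis
    using that by blast
qed

section \<open>Character series at 1 and their twists by the von Mangoldt function\<close>

context
  fixes m :: nat and \<chi> :: "int \<Rightarrow> complex"
  assumes m: "m > 0" and \<chi>: "dchar m \<chi>" "\<chi> \<noteq> principal_dchar m"
begin

text \<open>The limit is L(1,\<chi>). The rate, from Abel summation, is used whether the limit
  vanishes or not.\<close>

lemma dchar_sum_limit:
  obtains L where "\<And>N. norm ((\<Sum>n=1..N. \<chi> (int n) / of_nat n) - L) \<le> 2 * real m / (real N + 1)"
proof -
  define T where "T = (\<lambda>N. \<Sum>n=1..N. \<chi> (int n) / of_nat n)"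
  have "norm (T K - T N) \<le> 2 * real m * (1 / real (Suc N))" if "N \<le> K" for N K
  proof -
    have "T K - T N = (\<Sum>n=Suc N..K. \<chi> (int n) * of_real (1 / real n))"
      using sum.ub_add_nat[of 1 N "\<lambda>n. \<chi> (int n) / of_nat n" "K - N"] that by (simp add: T_def)
    also have "norm \<dots> \<le> 2 * real m * (1 / real (Suc N))"
      using norm_sum_dchar_le[OF \<chi> m] by (intro abel_summation_bound) (auto simp: frac_le)
    finally show ?thesis .
  qed
  moreover have "(\<lambda>N. 2 * real m * (1 / real (Suc N))) \<longlonglongrightarrow> 0"
    using tendsto_mult_right_zero[OF LIMSEQ_inverse_real_of_nat, of "2 * real m"] by (simp add: field_simps)
  ultimately obtain L where "\<And>N. norm (T N - L) \<le> 2 * real m * (1 / real (Suc N))"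
    by (rule limit_with_rate) auto
  then show ?thesis
    using that[of L] by (simp add: T_def add.commute)
qed

lemma dchar_ln_sum_bounded:
  obtains B where "\<And>N. norm (\<Sum>n=1..N. \<chi> (int n) / of_nat n * of_real (ln (real n))) \<le> B"
proof -
  define f where "f = (\<lambda>n. ln (real n) / real n)"
  \<comment> \<open>\<open>ln n / n\<close> decreases only from \<open>n = 3\<close> on, as
    \<open>exp 1 \<le> 3\<close>; the terms with \<open>n \<le> 2\<close> are bounded by 1
    each.\<close>
  have mono: "f (Suc n) \<le> f n" if "n > 2" for n
  proof -
    have "ln (real (Suc n)) = ln (real n) + ln (1 + 1 / real n)"
    proof -
      have "real (Suc n) = real n * (1 + 1 / real n)"
        using that by (simp add: field_simps)
      then show ?thesis
        using that by (metis ln_mult_pos add_pos_nonneg less_nat_zero_code neq0_conv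
            of_nat_0_less_iff zero_le_divide_1_iff zero_less_one of_nat_0_le_iff)
    qed
    moreover have "ln (1 + 1 / real n) \<le> 1 / real n"
      by (intro ln_add_one_self_le_self) auto
    moreover have "1 \<le> ln (real n)"
      using that exp_le by (subst ln_ge_iff) auto
    ultimately have "real n * ln (real (Suc n)) \<le> real (Suc n) * ln (real n)"
      using that by (simp add: field_simps)
    then show ?thesis
      using that by (simp add: f_def field_simps)
  qed
  have tail: "norm (\<Sum>n=Suc 2..N. \<chi> (int n) * of_real (f n)) \<le> 2 * real m * f (Suc 2)" for N
    using norm_sum_dchar_le[OF \<chi> m] mono by (intro abel_summation_bound) (auto simp: f_def)
  have "norm (\<Sum>n=1..N. \<chi> (int n) / of_nat n * of_real (ln (real n))) \<le> 2 + 2 * real m * f (Suc 2)" for N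
  proof -
    have eq: "\<chi> (int n) / of_nat n * of_real (ln (real n)) = \<chi> (int n) * of_real (f n)" for n
      by (simp add: f_def)
    have "(\<Sum>n=1..N. \<chi> (int n) * of_real (f n)) =
       (\<Sum>n\<in>{1..N} \<inter> {..2}. \<chi> (int n) * of_real (f n)) + (\<Sum>n=Suc 2..N. \<chi> (int n) * of_real (f n))"
      by (subst sum.union_disjoint[symmetric]) (auto intro!: sum.cong)
    moreover have "norm (\<Sum>n\<in>{1..N} \<inter> {..2}. \<chi> (int n) * of_real (f n)) \<le> (\<Sum>n\<in>{1..N} \<inter> {..2}. 1)"
    proof (intro sum_norm_le)
      fix n assume n: "n \<in> {1..N} \<inter> {..2}"
      then have "\<bar>f n\<bar> \<le> 1"
        using ln_le_minus_one[of "real n"] by (auto simp: f_def field_simps)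
      then show "norm (\<chi> (int n) * of_real (f n)) \<le> 1"
        unfolding norm_mult norm_of_real using norm_dchar_le_1[OF \<chi>(1) m] by (intro mult_le_one) auto
    qed
    moreover have "(\<Sum>n\<in>{1..N} \<inter> {..2}. 1 :: real) \<le> 2"
      using card_mono[of "{1..2::nat}" "{1..N} \<inter> {..2}"] by simp
    ultimately show ?thesis
      unfolding eq using tail[of N] norm_triangle_mono by (smt (verit, best))
  qed
  then show ?thesis
    using that by blast
qed

text \<open>Here \<open>t\<close> stands for the error of the partial sums. At
  \<open>N div d\<close> it is of order \<open>d / N\<close>, which cancels the denominator
  \<open>d\<close> and leaves Chebyshev's sum divided by \<open>N\<close>.\<close>

lemma sum_mangoldt_div_le:
  assumes "N \<ge> 1" and T: "\<And>k. norm (t k) \<le> 2 * real m / (real k + 1)"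
  shows "norm (\<Sum>d=1..N. \<chi> (int d) * mangoldt d / of_nat d * t (N div d)) \<le> 8 * real m"
proof -
  have "norm (\<Sum>d=1..N. \<chi> (int d) * mangoldt d / of_nat d * t (N div d)) \<le>
      (\<Sum>d=1..N. 2 * real m / real N * mangoldt d)"
  proof (intro sum_norm_le)
    fix d assume d: "d \<in> {1..N}"
    have "real N / real d \<le> real (N div d) + 1"
      using floor_divide_of_nat_eq[of N d, where ?'a = real] by linarith
    then have "2 * real m / (real (N div d) + 1) \<le> 2 * real m / (real N / real d)"
      using d by (intro divide_left_mono mult_pos_pos) auto
    then have "norm (t (N div d)) \<le> 2 * real m * real d / real N"
      using T[of "N div d"] by simp
    moreover have "norm (\<chi> (int d) * mangoldt d / of_nat d) \<le> 1 * mangoldt d / real d"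
      unfolding norm_mult norm_divide norm_mangoldt norm_of_nat using norm_dchar_le_1[OF \<chi>(1) m]
      by (intro divide_right_mono mult_right_mono) (auto simp: mangoldt_nonneg)
    ultimately have "norm (\<chi> (int d) * mangoldt d / of_nat d * t (N div d)) \<le>
       (1 * mangoldt d / real d) * (2 * real m * real d / real N)"
      unfolding norm_mult[of _ "t _"] by (intro mult_mono) (auto simp: mangoldt_nonneg)
    then show "norm (\<chi> (int d) * mangoldt d / of_nat d * t (N div d)) \<le> 2 * real m / real N * mangoldt d"
      using d by (simp add: field_simps)
  qed
  also have "\<dots> = 2 * real m / real N * (\<Sum>d=1..N. mangoldt d)"
    by (simp add: sum_distrib_left)
  also have "\<dots> \<le> 2 * real m / real N * (4 * real N)"
    by (intro mult_left_mono sum_mangoldt_le) auto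
  finally show ?thesis
    using assms(1) by simp
qed

lemma dchar_completely_multiplicative:
  "\<chi> (int (a * b)) / of_nat (a * b) = (\<chi> (int a) / of_nat a) * (\<chi> (int b) / of_nat b)"
  by (simp add: dchar_mult[OF \<chi>(1)])

text \<open>Since \<open>ln\<close> is \<open>mangoldt\<close> convolved with 1, the bounded series
  with \<open>ln\<close> equals \<open>L\<close> times the wanted sum up to a bounded error, and
  \<open>L\<close> can be divided out.\<close>

lemma dchar_mangoldt_bounded:
  assumes L: "\<And>N. norm ((\<Sum>n=1..N. \<chi> (int n) / of_nat n) - L) \<le> 2 * real m / (real N + 1)" and "L \<noteq> 0"
  obtains B where "\<And>N. norm (\<Sum>d=1..N. \<chi> (int d) * mangoldt d / of_nat d) \<le> B"
proof -
  obtain B where B: "\<And>N. norm (\<Sum>n=1..N. \<chi> (int n) / of_nat n * of_real (ln (real n))) \<le> B"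
    by (rule dchar_ln_sum_bounded) blast
  define T where "T = (\<lambda>N. \<Sum>n=1..N. \<chi> (int n) / of_nat n)"
  define M where "M = (\<lambda>N. \<Sum>d=1..N. \<chi> (int d) * mangoldt d / of_nat d)"
  have "norm (M N) \<le> (B + 8 * real m) / norm L" if N: "N \<ge> 1" for N
  proof -
    have "(\<Sum>n=1..N. \<chi> (int n) / of_nat n * of_real (ln (real n))) =
        (\<Sum>n=1..N. dconv (\<lambda>d. \<chi> (int d) / of_nat d * mangoldt d) (\<lambda>d. \<chi> (int d) / of_nat d * 1) n)"
      unfolding dconv_mangoldt_one[symmetric]
      by (intro sum.cong refl dconv_completely_multiplicative dchar_completely_multiplicative)
    also have "\<dots> = (\<Sum>d=1..N. \<chi> (int d) * mangoldt d / of_nat d * T (N div d))"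
      unfolding sum_dconv by (simp add: T_def mult_ac)
    also have "\<dots> = L * M N + (\<Sum>d=1..N. \<chi> (int d) * mangoldt d / of_nat d * (T (N div d) - L))"
      unfolding M_def sum_distrib_left by (subst sum.distrib[symmetric]) (simp add: algebra_simps diff_divide_distrib)
    finally have "L * M N = (\<Sum>n=1..N. \<chi> (int n) / of_nat n * of_real (ln (real n))) -
        (\<Sum>d=1..N. \<chi> (int d) * mangoldt d / of_nat d * (T (N div d) - L))"
      by simp
    also have "norm \<dots> \<le> B + 8 * real m"
      by (rule order.trans[OF norm_triangle_ineq4], intro add_mono B sum_mangoldt_div_le N)
        (use L in \<open>simp add: T_def\<close>)
    finally show ?thesis
      using \<open>L \<noteq> 0\<close> by (simp add: norm_mult field_simps)
  qed
  moreover have "norm (M 0) \<le> (B + 8 * real m) / norm L"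
    using B[of 0] by (simp add: M_def)
  ultimately show ?thesis
    using that unfolding M_def by (metis less_one not_le)
qed

end

subsection \<open>Nonvanishing of character series\<close>

definition mu :: "nat \<Rightarrow> complex" where
  "mu n = (if squarefree n then (-1) ^ card (prime_factors n) else 0)"

lemma norm_mu_le: "norm (mu n) \<le> 1"
  by (simp add: mu_def norm_power)

lemma mu_prime_mult:
  assumes "prime p" "\<not> p dvd a" "a > 0"
  shows "mu (p * a) = - mu a"
proof -
  have cop: "coprime p a"
    using assms by (simp add: prime_imp_coprime)
  have "prime_factors (p * a) = insert p (prime_factors a)"
    using assms by (simp add: prime_factors_product prime_prime_factors)
  moreover have "p \<notin> prime_factors a"
    using assms by auto
  moreover have "squarefree (p * a) \<longleftrightarrow> squarefree a"
    using squarefree_mult_coprime[OF cop squarefree_prime[OF assms(1)]] squarefree_mono[of a "p * a"] by auto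
  ultimately show ?thesis
    by (simp add: mu_def)
qed

text \<open>For a prime \<open>p\<close> dividing \<open>n\<close>, the divisors \<open>a\<close>
  prime to \<open>p\<close> cancel against the divisors \<open>p * a\<close>; the remaining ones are
  divisible by \<open>p\<^sup>2\<close>.\<close>

lemma sum_mu_divisors:
  assumes "n > 0"
  shows "(\<Sum>d | d dvd n. mu d) = (if n = 1 then 1 else 0)"
proof (cases "n = 1")
  case True
  have "{d::nat. d dvd 1} = {1}"
    by auto
  then show ?thesis
    using True by (simp add: mu_def)
next
  case False
  then obtain p where p: "prime p" "p dvd n"
    using prime_factor_nat by blast
  have fin: "finite {d. d dvd n}"
    using assms by simp
  define A where "A = {d. d dvd n \<and> \<not> p dvd d}"
  have pos: "a > 0" if "a dvd n" for a
    using that assms by (rule dvd_pos_nat[rotated])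
  have "(\<Sum>d | d dvd n. mu d) = (\<Sum>d\<in>A. mu d) + (\<Sum>d | d dvd n \<and> p dvd d. mu d)"
    unfolding A_def using fin by (subst sum.union_disjoint[symmetric]) (auto intro!: sum.cong)
  also have "(\<Sum>d | d dvd n \<and> p dvd d. mu d) = (\<Sum>d\<in>(*) p ` A. mu d)"
  proof (rule sum.mono_neutral_right)
    show "(*) p ` A \<subseteq> {d. d dvd n \<and> p dvd d}"
      using p by (auto simp: A_def prime_imp_coprime intro!: divides_mult)
    show "\<forall>d\<in>{d. d dvd n \<and> p dvd d} - (*) p ` A. mu d = 0"
    proof
      fix d assume d: "d \<in> {d. d dvd n \<and> p dvd d} - (*) p ` A"
      then obtain a where a: "d = p * a"
        by auto
      with d have "a dvd n" "a \<notin> A"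
        by (auto dest: dvd_mult_right)
      then have "p dvd a"
        by (auto simp: A_def)
      then have "p\<^sup>2 dvd d"
        by (simp add: a power2_eq_square)
      then have "\<not> squarefree d"
        using p(1) by (metis not_prime_unit squarefreeD)
      then show "mu d = 0"
        by (simp add: mu_def)
    qed
  qed (use fin in auto)
  also have "\<dots> = (\<Sum>a\<in>A. mu (p * a))"
    using p(1) by (subst sum.reindex) (auto intro!: inj_onI)
  also have "\<dots> = (\<Sum>a\<in>A. - mu a)"
    using p(1) pos by (intro sum.cong mu_prime_mult) (auto simp: A_def)
  finally show ?thesis
    using False by (simp add: sum_negf)
qed

lemma dconv_mu_one: "dconv mu (\<lambda>_. 1) = (\<lambda>n. if n = 1 then 1 else 0)"
proof
  fix n show "dconv mu (\<lambda>_. 1) n = (if n = 1 then 1 else 0)"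
    using sum_mu_divisors[of n] by (cases "n = 0") (auto simp: dconv_def)
qed

text \<open>The Leibniz rule applied to \<open>dconv mu (\<lambda>_. 1)\<close>, whose product with
  \<open>ln\<close> vanishes because \<open>ln 1 = 0\<close>.\<close>

lemma dconv_mu_ln_one:
  assumes "n > 0"
  shows "dconv (\<lambda>d. of_real (ln (real d)) * mu d) (\<lambda>_. 1) n = - mangoldt n"
proof -
  have "(\<lambda>d. of_real (ln (real d))) = dconv mangoldt (\<lambda>_. 1 :: complex)"
    by (rule ext) (simp add: dconv_mangoldt_one)
  then have "dconv mu (\<lambda>d. of_real (ln (real d))) = dconv mu (dconv mangoldt (\<lambda>_. 1))"
    by simp
  also have "\<dots> = dconv mangoldt (dconv mu (\<lambda>_. 1))"
    by (metis dconv_assoc dconv_commute)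
  finally have 1: "dconv mu (\<lambda>d. of_real (ln (real d))) n = mangoldt n"
    using dconv_delta_right[OF assms] by (simp add: dconv_mu_one)
  have "of_real (ln (real n)) * dconv mu (\<lambda>_. 1) n = 0"
    by (simp add: dconv_mu_one)
  also have "of_real (ln (real n)) * dconv mu (\<lambda>_. 1) n =
      dconv (\<lambda>d. of_real (ln (real d)) * mu d) (\<lambda>_. 1) n + dconv mu (\<lambda>d. of_real (ln (real d)) * 1) n"
    by (rule dconv_derivation) (simp add: ln_mult)
  finally show ?thesis
    using 1 by (simp add: eq_neg_iff_add_eq_0)
qed

text \<open>If L(1,\<chi>) = 0, the partial sums \<open>T\<close> themselves are small, so the sum
  of \<open>H d * mu d * T (N div d)\<close> with weights \<open>ln N - ln d\<close> is bounded.
  Moebius inversion evaluates it as \<open>ln N\<close> plus the von Mangoldt sum. A zero thus shows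
  up as a term \<open>- ln N\<close>.\<close>

lemma dchar_mangoldt_vanishing:
  assumes m: "m > 0" and \<chi>: "dchar m \<chi>"
    and T: "\<And>N. norm (\<Sum>n=1..N. \<chi> (int n) / of_nat n) \<le> 2 * real m / (real N + 1)"
    and N: "N \<ge> 1"
  shows "norm ((\<Sum>d=1..N. \<chi> (int d) * mangoldt d / of_nat d) + of_real (ln (real N))) \<le> 2 * real m"
proof -
  define H where "H = (\<lambda>n. \<chi> (int n) / of_nat n)"
  have H: "H (a * b) = H a * H b" for a b
    using dchar_mult[OF \<chi>] by (simp add: H_def)
  have H1: "H 1 = 1"
    using dchar_1[OF \<chi>] by (simp add: H_def)
  define T where "T = (\<lambda>N. \<Sum>n=1..N. H n)"
  have 1: "(\<Sum>d=1..N. H d * mu d * T (N div d)) = 1"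
  proof -
    have "(\<Sum>d=1..N. H d * mu d * T (N div d)) = (\<Sum>n=1..N. H n * dconv mu (\<lambda>_. 1) n)"
      unfolding dconv_completely_multiplicative[of H, OF H] sum_dconv by (simp add: T_def)
    also have "\<dots> = (\<Sum>n\<in>{1}. H n)"
      unfolding dconv_mu_one using N by (intro sum.mono_neutral_cong_right) auto
    finally show ?thesis
      using H1 by simp
  qed
  have 2: "(\<Sum>d=1..N. H d * (of_real (ln (real d)) * mu d) * T (N div d)) = - (\<Sum>d=1..N. H d * mangoldt d)"
  proof -
    have "(\<Sum>d=1..N. H d * (of_real (ln (real d)) * mu d) * T (N div d)) =
        (\<Sum>n=1..N. H n * dconv (\<lambda>d. of_real (ln (real d)) * mu d) (\<lambda>_. 1) n)"
      unfolding dconv_completely_multiplicative[of H, OF H] sum_dconv by (simp add: T_def)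
    also have "\<dots> = (\<Sum>n=1..N. - (H n * mangoldt n))"
      by (intro sum.cong) (auto simp: dconv_mu_ln_one)
    finally show ?thesis
      by (simp add: sum_negf)
  qed
  have "(\<Sum>d=1..N. H d * mangoldt d) + of_real (ln (real N)) =
     of_real (ln (real N)) * (\<Sum>d=1..N. H d * mu d * T (N div d)) -
       (\<Sum>d=1..N. H d * (of_real (ln (real d)) * mu d) * T (N div d))"
    unfolding 1 2 by simp
  also have "\<dots> = (\<Sum>d=1..N. H d * mu d * T (N div d) * of_real (ln (real N) - ln (real d)))"
    unfolding sum_distrib_left by (subst sum_subtractf[symmetric]) (simp add: algebra_simps)
  also have "norm \<dots> \<le> (\<Sum>d=1..N. 2 * real m / real N * (ln (real N) - ln (real d)))"
  proof (intro sum_norm_le)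
    fix d assume d: "d \<in> {1..N}"
    have "norm (H d) \<le> 1 / real d"
      unfolding H_def norm_divide norm_of_nat by (intro divide_right_mono norm_dchar_le_1[OF \<chi> m]) auto
    moreover have "norm (mu d) \<le> 1"
      by (rule norm_mu_le)
    moreover have "norm (T (N div d)) \<le> 2 * real m * real d / real N"
    proof -
      have "real N / real d \<le> real (N div d) + 1"
        using floor_divide_of_nat_eq[of N d, where ?'a = real] by linarith
      then have "2 * real m / (real (N div d) + 1) \<le> 2 * real m / (real N / real d)"
        using d by (intro divide_left_mono mult_pos_pos) auto
      then show ?thesis
        using assms(3)[of "N div d"] by (simp add: T_def H_def)
    qed
    moreover have "ln (real N) - ln (real d) \<ge> 0"
      using d by simp
    ultimately have "norm (H d * mu d * T (N div d) * of_real (ln (real N) - ln (real d))) \<le>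
       1 / real d * 1 * (2 * real m * real d / real N) * (ln (real N) - ln (real d))"
      unfolding norm_mult norm_of_real by (intro mult_mono) auto
    then show "norm (H d * mu d * T (N div d) * of_real (ln (real N) - ln (real d))) \<le>
       2 * real m / real N * (ln (real N) - ln (real d))"
      using d by simp
  qed
  also have "\<dots> = 2 * real m / real N * (real N * ln (real N) - ln (fact N))"
  proof -
    have "ln (fact N) = (\<Sum>n=1..N. ln (real n))"
      by (induction N) (auto simp: ln_mult)
    then show ?thesis
      unfolding sum_distrib_left[symmetric] by (simp add: sum_subtractf)
  qed
  also have "\<dots> \<le> 2 * real m / real N * real N"
    using ln_fact_bounds(2)[OF N] by (intro mult_left_mono) auto
  finally show ?thesis
    using N by (simp add: H_def field_simps)
qed

lemma ln_le_harmonic: "ln (real (Suc n)) \<le> (\<Sum>k=1..n. 1 / real k)"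
proof (induction n)
  case (Suc n)
  have "real (Suc (Suc n)) = real (Suc n) * (1 + 1 / real (Suc n))"
    by (simp add: field_simps)
  then have "ln (real (Suc (Suc n))) = ln (real (Suc n)) + ln (1 + 1 / real (Suc n))"
    by (metis ln_mult_pos add_pos_nonneg of_nat_0_less_iff zero_less_Suc zero_le_divide_1_iff
        zero_less_one of_nat_0_le_iff)
  also have "ln (1 + 1 / real (Suc n)) \<le> 1 / real (Suc n)"
    by (intro ln_add_one_self_le_self) auto
  finally show ?case
    using Suc by simp
qed auto

text \<open>Dirichlet's hyperbola method: \<open>d > K\<close> and
  \<open>d * e \<le> K\<^sup>2\<close> force \<open>e \<le> K\<close>. In the second part
  \<open>u\<close> occurs only in sums starting at \<open>Suc K\<close>, to which Abel summation
  applies.\<close>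

lemma hyperbola_split:
  fixes u v :: "nat \<Rightarrow> real"
  assumes "K \<ge> 1"
  shows "(\<Sum>d=1..K\<^sup>2. u d * (\<Sum>e=1..K\<^sup>2 div d. v e)) =
    (\<Sum>d=1..K. u d * (\<Sum>e=1..K\<^sup>2 div d. v e)) + (\<Sum>e=1..K. v e * (\<Sum>d=Suc K..K\<^sup>2 div e. u d))"
proof -
  have K: "K \<le> K\<^sup>2"
    by (simp add: power2_nat_le_imp_le self_le_power assms)
  have "(\<Sum>d=1..K\<^sup>2. u d * (\<Sum>e=1..K\<^sup>2 div d. v e)) =
    (\<Sum>d=1..K. u d * (\<Sum>e=1..K\<^sup>2 div d. v e)) + (\<Sum>d=Suc K..K\<^sup>2. u d * (\<Sum>e=1..K\<^sup>2 div d. v e))"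
    using sum.ub_add_nat[of 1 K _ "K\<^sup>2 - K"] K by simp
  also have "(\<Sum>d=Suc K..K\<^sup>2. u d * (\<Sum>e=1..K\<^sup>2 div d. v e)) =
      (\<Sum>(d, e)\<in>Sigma {Suc K..K\<^sup>2} (\<lambda>d. {1..K\<^sup>2 div d}). u d * v e)"
    by (subst sum.Sigma[symmetric]) (auto simp: sum_distrib_left)
  also have "\<dots> = (\<Sum>(e, d)\<in>Sigma {1..K} (\<lambda>e. {Suc K..K\<^sup>2 div e}). v e * u d)"
  proof (rule sum.reindex_bij_witness[of _ "\<lambda>(e, d). (d, e)" "\<lambda>(d, e). (e, d)"])
    fix a assume "a \<in> Sigma {Suc K..K\<^sup>2} (\<lambda>d. {1..K\<^sup>2 div d})"
    then obtain d e where a: "a = (d, e)" "Suc K \<le> d" "e \<ge> 1" "e \<le> K\<^sup>2 div d"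
      by auto
    then have ed: "e * d \<le> K\<^sup>2"
      by (simp add: less_eq_div_iff_mult_less_eq)
    have "e \<le> K"
    proof (rule ccontr)
      assume "\<not> e \<le> K"
      then have "K * K < e * d"
        using a assms by (intro mult_strict_mono) auto
      then show False
        using ed by (simp add: power2_eq_square)
    qed
    moreover have "d \<le> K\<^sup>2 div e"
      using ed a by (simp add: less_eq_div_iff_mult_less_eq mult.commute)
    ultimately show "(case a of (d, e) \<Rightarrow> (e, d)) \<in> Sigma {1..K} (\<lambda>e. {Suc K..K\<^sup>2 div e})"
      using a by auto
  next
    fix b assume "b \<in> Sigma {1..K} (\<lambda>e. {Suc K..K\<^sup>2 div e})"
    then obtain d e where b: "b = (e, d)" "Suc K \<le> d" "e \<ge> 1" "d \<le> K\<^sup>2 div e"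
      by auto
    then have ed: "d * e \<le> K\<^sup>2"
      by (simp add: less_eq_div_iff_mult_less_eq)
    moreover have "d * 1 \<le> d * e"
      using b by (intro mult_le_mono) auto
    ultimately have "d \<le> K\<^sup>2"
      by linarith
    moreover have "e \<le> K\<^sup>2 div d"
      using b ed by (simp add: less_eq_div_iff_mult_less_eq mult.commute)
    ultimately show "(case b of (e, d) \<Rightarrow> (d, e)) \<in> Sigma {Suc K..K\<^sup>2} (\<lambda>d. {1..K\<^sup>2 div d})"
      using b by auto
  qed (auto simp: mult.commute)
  also have "\<dots> = (\<Sum>e=1..K. v e * (\<Sum>d=Suc K..K\<^sup>2 div e. u d))"
    by (subst sum.Sigma[symmetric]) (auto simp: sum_distrib_left)
  finally show ?thesis .
qed

section \<open>Divisor sums of a real character\<close>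

context
  fixes h :: "nat \<Rightarrow> real" and m :: nat
  assumes h_mult: "\<And>a b. h (a * b) = h a * h b" and h_range: "\<And>a. h a \<in> {-1, 0, 1}"
    and h_coprime: "\<And>a. coprime a m \<Longrightarrow> h a \<noteq> 0" and m: "m > 0"
begin

text \<open>The coefficients of zeta(s) L(s,\<chi>) when \<open>h\<close> is the real character
  \<chi>.\<close>

definition div_sum :: "nat \<Rightarrow> real" where "div_sum = dconv (\<lambda>_. 1) h"

text \<open>The logarithmic derivative of zeta(s) L(s,\<chi>), written on coefficients. Its own
  coefficients \<open>mangoldt d * (1 + h d)\<close> are nonnegative, so lower bounds for
  \<open>div_sum\<close> follow by induction without a factorization of \<open>n\<close>.\<close>

lemma ln_mult_div_sum: "ln (real n) * div_sum n = dconv (\<lambda>d. mangoldt d * (1 + h d)) div_sum n"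
proof -
  have "ln (real n) * div_sum n =
      dconv (\<lambda>d. ln (real d) * 1) h n + dconv (\<lambda>_. 1) (\<lambda>d. ln (real d) * h d) n"
    unfolding div_sum_def by (rule dconv_derivation) (simp add: ln_mult)
  also have "(\<lambda>d. ln (real d) * 1) = dconv mangoldt (\<lambda>_. 1)"
    by (simp add: dconv_mangoldt_one fun_eq_iff)
  also have "(\<lambda>d. ln (real d) * h d) = dconv (\<lambda>d. h d * mangoldt d) h"
  proof
    fix d
    have "ln (real d) * h d = h d * dconv mangoldt (\<lambda>_. 1) d"
      by (simp add: dconv_mangoldt_one)
    then show "ln (real d) * h d = dconv (\<lambda>d. h d * mangoldt d) h d"
      using dconv_completely_multiplicative[of h d mangoldt "\<lambda>_. 1"] h_mult by simp
  qed
  also have "dconv (dconv mangoldt (\<lambda>_. 1)) h = dconv mangoldt div_sum"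
    by (simp add: div_sum_def dconv_assoc)
  also have "dconv (\<lambda>_. 1) (dconv (\<lambda>d. h d * mangoldt d) h) = dconv (\<lambda>d. h d * mangoldt d) div_sum"
    unfolding div_sum_def by (metis dconv_assoc dconv_commute)
  finally show ?thesis
    by (simp add: dconv_add_left[symmetric] algebra_simps)
qed

lemma one_plus_h_nonneg: "1 + h d \<ge> 0"
  using h_range[of d] by auto

lemma h_1: "h 1 = 1"
  using h_mult[of 1 1] h_coprime[of 1] by simp

lemma div_sum_1: "div_sum 1 = 1"
  using h_1 by (simp add: div_sum_def dconv_def)

lemma div_sum_nonneg: "div_sum n \<ge> 0"
proof (induction n rule: less_induct)
  case (less n)
  consider "n = 0" | "n = 1" | "n > 1"
    by linarith
  then show ?case
  proof cases
    case 3
    have "0 \<le> ln (real n) * div_sum n"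
      unfolding ln_mult_div_sum dconv_def
    proof (intro sum_nonneg)
      fix d assume d: "d \<in> {d. d dvd n}"
      show "0 \<le> mangoldt d * (1 + h d) * div_sum (n div d)"
      \<comment> \<open>The term \<open>d = 1\<close>, whose cofactor is \<open>n\<close> itself,
        drops out because \<open>mangoldt 1 = 0\<close>.\<close>
      proof (cases "d = 1")
        case False
        then have "n div d < n"
          using d 3 by (intro div_less_dividend) (auto intro!: Nat.gr0I simp: nat_neq_iff)
        then show ?thesis
          using less one_plus_h_nonneg mangoldt_nonneg by simp
      qed simp
    qed
    then show ?thesis
      using 3 by (simp add: zero_le_mult_iff)
  next
    case 1
    then show ?thesis by (simp add: div_sum_def)
  next
    case 2
    then show ?thesis using div_sum_1 by simp
  qed
qed

text \<open>Only the summands at the square divisors \<open>e\<^sup>2\<close> of \<open>k\<^sup>2\<close> are kept; at these \<open>1 + h = 2\<close>.\<close>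

lemma div_sum_square_ge_1:
  assumes "coprime k m" "k > 0"
  shows "div_sum (k\<^sup>2) \<ge> 1"
  using assms
proof (induction k rule: less_induct)
  case (less k)
  show ?case
  proof (cases "k = 1")
    case False
    with less.prems have k: "k > 1"
      by simp
    have h2: "h (e\<^sup>2) = 1" if "e dvd k" for e
    proof -
      have "coprime e m"
        using that less.prems(1) by (meson coprime_divisors dvd_refl)
      then show ?thesis
        using h_coprime[of e] h_range[of e] by (auto simp: power2_eq_square h_mult)
    qed
    have mang: "mangoldt (e\<^sup>2) = (mangoldt e :: real)" for e :: nat
    proof (cases "primepow e")
      case True
      then obtain p j where "prime p" "j > 0" "e = p ^ j"
        by (auto simp: primepow_def)
      then show ?thesis
        by (simp flip: power_mult)
    next
      case False
      then have "\<not> primepow (e\<^sup>2)"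
        by (cases "e = 0") (auto simp: primepow_power_iff_nat)
      then show ?thesis
        using False by (simp add: mangoldt_def)
    qed
    have "2 * ln (real k) = (\<Sum>e | e dvd k. 2 * mangoldt e)"
      using k by (simp add: mangoldt_sum flip: sum_distrib_left)
    also have "\<dots> \<le> (\<Sum>e | e dvd k. mangoldt (e\<^sup>2) * (1 + h (e\<^sup>2)) * div_sum (k\<^sup>2 div e\<^sup>2))"
    proof (intro sum_mono)
      fix e assume e: "e \<in> {e. e dvd k}"
      show "2 * mangoldt e \<le> mangoldt (e\<^sup>2) * (1 + h (e\<^sup>2)) * div_sum (k\<^sup>2 div e\<^sup>2)"
      proof (cases "e = 1")
        case False
        obtain f where f: "k = e * f"
          using e by auto
        have ef: "e > 1" "f > 0"
          using k f False by (auto intro!: Nat.gr0I simp: nat_neq_iff)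
        then have "f < k" "coprime f m"
          using less.prems(1) by (auto simp: f)
        then have "div_sum (f\<^sup>2) \<ge> 1"
          using less.IH[of f] ef by simp
        moreover have "k\<^sup>2 div e\<^sup>2 = f\<^sup>2"
          using ef by (simp add: f power_mult_distrib)
        ultimately show ?thesis
          using e h2[of e] mangoldt_nonneg[of e] mult_left_mono[of 1 "div_sum (f\<^sup>2)" "mangoldt e * 2"]
          by (simp add: mang)
      qed simp
    qed
    also have "\<dots> = (\<Sum>d\<in>(\<lambda>e. e\<^sup>2) ` {e. e dvd k}. mangoldt d * (1 + h d) * div_sum (k\<^sup>2 div d))"
      by (subst sum.reindex) (auto intro!: inj_onI)
    also have "\<dots> \<le> (\<Sum>d | d dvd k\<^sup>2. mangoldt d * (1 + h d) * div_sum (k\<^sup>2 div d))"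
      using k one_plus_h_nonneg mangoldt_nonneg div_sum_nonneg by (intro sum_mono2) auto
    also have "\<dots> = ln (real (k\<^sup>2)) * div_sum (k\<^sup>2)"
      unfolding ln_mult_div_sum by (simp add: dconv_def)
    finally have "2 * ln (real k) * 1 \<le> 2 * ln (real k) * div_sum (k\<^sup>2)"
      using k by (simp add: ln_realpow)
    then show ?thesis
      using k by (subst (asm) mult_le_cancel_left_pos) auto
  qed (use div_sum_1 in simp)
qed

text \<open>Each number \<open>1 + m * j\<close> is prime to \<open>m\<close>, so its square
  contributes at least \<open>1 / (1 + m * j)\<close>, and the harmonic series supplies the
  logarithm.\<close>

lemma sum_div_sum_over_sqrt_ge:
  "(\<Sum>n=1..(1 + m * J)\<^sup>2. div_sum n / sqrt (real n)) \<ge> ln (real (Suc J)) / (2 * real m)"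
proof -
  define f where "f = (\<lambda>j. (1 + m * j)\<^sup>2)"
  have "ln (real (Suc J)) \<le> (\<Sum>j=1..J. 1 / real j)"
    by (rule ln_le_harmonic)
  also have "\<dots> \<le> (\<Sum>j=1..J. 2 * real m * (div_sum (f j) / sqrt (real (f j))))"
  proof (intro sum_mono)
    fix j assume j: "j \<in> {1..J}"
    have "coprime (1 + m * j) m"
      by (metis coprime_1_left coprime_commute coprime_iff_gcd_eq_1 gcd_add_mult mult.commute add.commute)
    then have "div_sum (f j) \<ge> 1"
      unfolding f_def by (intro div_sum_square_ge_1) auto
    moreover have "sqrt (real (f j)) = 1 + real m * real j"
      by (simp add: f_def)
    moreover have "1 + real m * real j \<le> 2 * real m * real j"
      using m j mult_mono[of 1 "real m" 1 "real j"] by (simp add: mult.commute)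
    ultimately have "1 / real j \<le> 2 * real m * (1 / (1 + real m * real j))"
      using m j by (simp add: field_simps add_pos_nonneg)
    also have "\<dots> \<le> 2 * real m * (div_sum (f j) / (1 + real m * real j))"
      using \<open>div_sum (f j) \<ge> 1\<close> by (intro mult_left_mono divide_right_mono) auto
    finally show "1 / real j \<le> 2 * real m * (div_sum (f j) / sqrt (real (f j)))"
      by (simp add: f_def)
  qed
  also have "\<dots> = 2 * real m * (\<Sum>n\<in>f ` {1..J}. div_sum n / sqrt (real n))"
  proof (subst sum.reindex)
    show "inj_on f {1..J}"
      using m by (auto simp: f_def inj_on_def)
  qed (simp add: sum_distrib_left)
  also have "\<dots> \<le> 2 * real m * (\<Sum>n=1..(1 + m * J)\<^sup>2. div_sum n / sqrt (real n))"
  proof (intro mult_left_mono sum_mono2)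
    show "f ` {1..J} \<subseteq> {1..(1 + m * J)\<^sup>2}"
      by (auto simp: f_def intro!: power_mono)
  qed (use div_sum_nonneg in auto)
  finally show ?thesis
    using m by (simp add: field_simps)
qed

end

subsection \<open>Mertens' theorem for the residue class 1\<close>

text \<open>Were L(1,\<chi>) = 0, the sum of \<open>div_sum h n / sqrt n\<close> up to
  \<open>K\<^sup>2\<close> would stay bounded: its main term is \<open>2 * K\<close> times a partial
  sum of order \<open>1 / K\<close>. The squares alone make it grow like a logarithm.\<close>

lemma real_dchar_nonvanishing:
  assumes m: "m > 0" and \<chi>: "dchar m \<chi>" "\<chi> \<noteq> principal_dchar m" and real: "\<And>a. \<chi> a \<in> \<real>"
    and T: "\<And>N. norm (\<Sum>n=1..N. \<chi> (int n) / of_nat n) \<le> 2 * real m / (real N + 1)"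
  shows False
proof -
  define h where "h = (\<lambda>n. Re (\<chi> (int n)))"
  have \<chi>h: "\<chi> (int n) = of_real (h n)" for n
    using real[of "int n"] by (simp add: h_def)
  have h_mult: "h (a * b) = h a * h b" for a b
  proof -
    have "complex_of_real (h (a * b)) = of_real (h a * h b)"
      using dchar_mult[OF \<chi>(1), of "int a" "int b"] by (simp flip: \<chi>h)
    then show ?thesis
      by (simp only: of_real_eq_iff)
  qed
  have h_norm: "\<bar>h n\<bar> = (if coprime n m then 1 else 0)" for n
    using norm_dchar[OF \<chi>(1) m, of "int n"] by (simp add: \<chi>h)
  have h_range: "h n \<in> {-1, 0, 1}" for n
    using h_norm[of n] by (auto split: if_splits)
  have h_cop: "h n \<noteq> 0" if "coprime n m" for n
    using h_norm[of n] that by auto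
  define w where "w = (\<lambda>n. 1 / sqrt (real n))"
  have w_mult: "w (a * b) = w a * w b" for a b
    by (simp add: w_def real_sqrt_mult)
  obtain c where c: "\<And>N d. d \<ge> 1 \<Longrightarrow> d \<le> N \<Longrightarrow>
       \<bar>(\<Sum>e=1..N div d. 1 / sqrt (real e)) - 2 * sqrt (real N / real d) - c\<bar> \<le> 4 * sqrt (real d / real N)"
    by (rule sum_inverse_sqrt_real) blast
  have tail: "\<bar>\<Sum>d=Suc M..N. w d * h d\<bar> \<le> 2 * real m * w (Suc M)" for M N
  proof -
    have "norm (\<Sum>d=Suc M..N. \<chi> (int d) * of_real (w d)) \<le> 2 * real m * w (Suc M)"
      using norm_sum_dchar_le[OF \<chi> m]
      by (intro abel_summation_bound) (auto simp: w_def frac_le)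
    also have "(\<Sum>d=Suc M..N. \<chi> (int d) * of_real (w d)) = of_real (\<Sum>d=Suc M..N. w d * h d)"
      by (simp add: \<chi>h mult.commute)
    finally show ?thesis
      by (simp only: norm_of_real)
  qed
  have T': "\<bar>\<Sum>d=1..K. h d / real d\<bar> \<le> 2 * real m / (real K + 1)" for K
  proof -
    have "(\<Sum>n=1..K. \<chi> (int n) / of_nat n) = of_real (\<Sum>d=1..K. h d / real d)"
      by (simp add: \<chi>h)
    then show ?thesis
      using T[of K] by (simp only: norm_of_real)
  qed
  \<comment> \<open>The shares are \<open>4 * m\<close> for the main term, \<open>4 * m\<close> for
    the range \<open>d > K\<close>, \<open>2 * m * \<bar>c\<bar>\<close> for the constant in the
    inner sum, and 4 for its error.\<close>
  define C where "C = 8 * real m + 2 * real m * \<bar>c\<bar> + 4"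
  have upper: "(\<Sum>n=1..K\<^sup>2. div_sum h n / sqrt (real n)) \<le> C" if K: "K \<ge> 1" for K
  proof -
    have wK: "w d * (2 * sqrt (real (K\<^sup>2) / real d)) = 2 * real K / real d" for d
      by (simp add: w_def real_sqrt_divide)
    have "(\<Sum>n=1..K\<^sup>2. div_sum h n / sqrt (real n)) = (\<Sum>n=1..K\<^sup>2. w n * dconv h (\<lambda>_. 1) n)"
      by (simp add: w_def div_sum_def[OF h_mult h_range h_cop m] dconv_commute[of h])
    also have "\<dots> = (\<Sum>d=1..K\<^sup>2. w d * h d * (\<Sum>e=1..K\<^sup>2 div d. w e))"
      unfolding dconv_completely_multiplicative[of w, OF w_mult] sum_dconv by simp
    also have "\<dots> = (\<Sum>d=1..K. w d * h d * (\<Sum>e=1..K\<^sup>2 div d. w e)) +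
        (\<Sum>e=1..K. w e * (\<Sum>d=Suc K..K\<^sup>2 div e. w d * h d))"
      by (rule hyperbola_split[OF K])
    also have "(\<Sum>d=1..K. w d * h d * (\<Sum>e=1..K\<^sup>2 div d. w e)) =
        2 * real K * (\<Sum>d=1..K. h d / real d) + c * (\<Sum>d=1..K. w d * h d) +
        (\<Sum>d=1..K. w d * h d * ((\<Sum>e=1..K\<^sup>2 div d. w e) - 2 * sqrt (real (K\<^sup>2) / real d) - c))"
    proof -
      have "w d * h d * (\<Sum>e=1..K\<^sup>2 div d. w e) = 2 * real K * (h d / real d) + c * (w d * h d) +
          w d * h d * ((\<Sum>e=1..K\<^sup>2 div d. w e) - 2 * sqrt (real (K\<^sup>2) / real d) - c)" for d
      proof -
        have "w d * h d * ((\<Sum>e=1..K\<^sup>2 div d. w e) - 2 * sqrt (real (K\<^sup>2) / real d) - c) =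
          w d * h d * (\<Sum>e=1..K\<^sup>2 div d. w e) - h d * (w d * (2 * sqrt (real (K\<^sup>2) / real d))) - c * (w d * h d)"
          by (simp add: algebra_simps)
        then show ?thesis
          unfolding wK by simp
      qed
      then show ?thesis
        by (simp only: sum.distrib sum_distrib_left)
    qed
    also have "2 * real K * (\<Sum>d=1..K. h d / real d) \<le> 4 * real m"
    proof -
      have "2 * real K * (\<Sum>d=1..K. h d / real d) \<le> 2 * real K * (2 * real m / (real K + 1))"
        using T'[of K] by (intro mult_left_mono) auto
      also have "\<dots> \<le> 4 * real m"
        using m by (simp add: field_simps)
      finally show ?thesis .
    qed
    also have "c * (\<Sum>d=1..K. w d * h d) \<le> \<bar>c\<bar> * (2 * real m)"
    proof -
      have "c * (\<Sum>d=1..K. w d * h d) \<le> \<bar>c\<bar> * \<bar>\<Sum>d=1..K. w d * h d\<bar>"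
        by (metis abs_ge_self abs_mult)
      also have "\<dots> \<le> \<bar>c\<bar> * (2 * real m)"
        using tail[of 0 K] by (intro mult_left_mono) (auto simp: w_def)
      finally show ?thesis .
    qed
    also have "(\<Sum>d=1..K. w d * h d * ((\<Sum>e=1..K\<^sup>2 div d. w e) - 2 * sqrt (real (K\<^sup>2) / real d) - c)) \<le>
        (\<Sum>d=1..K. 4 / real K)"
    proof (intro sum_mono)
      fix d assume d: "d \<in> {1..K}"
      have "d * 1 \<le> K * K"
        using d by (intro mult_le_mono) auto
      then have dK: "d \<le> K\<^sup>2"
        by (simp add: power2_eq_square)
      have "w d * h d * ((\<Sum>e=1..K\<^sup>2 div d. w e) - 2 * sqrt (real (K\<^sup>2) / real d) - c) \<le>
        \<bar>w d * h d\<bar> * \<bar>(\<Sum>e=1..K\<^sup>2 div d. w e) - 2 * sqrt (real (K\<^sup>2) / real d) - c\<bar>"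
        by (metis abs_ge_self abs_mult)
      also have "\<dots> \<le> w d * (4 * sqrt (real d / real (K\<^sup>2)))"
        using c[of d "K\<^sup>2"] d dK h_range[of d] unfolding w_def[symmetric]
        by (intro mult_mono) (auto simp: w_def)
      also have "\<dots> = 4 / real K"
        using d by (simp add: w_def real_sqrt_divide)
      finally show "w d * h d * ((\<Sum>e=1..K\<^sup>2 div d. w e) - 2 * sqrt (real (K\<^sup>2) / real d) - c) \<le> 4 / real K" .
    qed
    also have "(\<Sum>e=1..K. w e * (\<Sum>d=Suc K..K\<^sup>2 div e. w d * h d)) \<le> (\<Sum>e=1..K. w e * (2 * real m * w (Suc K)))"
      using tail[of K] by (intro sum_mono mult_left_mono) (auto simp: w_def abs_le_iff)
    also have "\<dots> = (\<Sum>e=1..K. 1 / sqrt (real e)) * (2 * real m * w (Suc K))"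
      unfolding w_def sum_distrib_right ..
    also have "\<dots> \<le> 2 * sqrt (real K) * (2 * real m * w (Suc K))"
      by (intro mult_right_mono sum_inverse_sqrt_le) (auto simp: w_def)
    also have "\<dots> \<le> 2 * sqrt (real (Suc K)) * (2 * real m * w (Suc K))"
      by (intro mult_right_mono) (auto simp: w_def)
    also have "\<dots> = 4 * real m"
      by (simp add: w_def)
    finally show ?thesis
      using K by (simp add: C_def mult_ac)
  qed
  obtain J :: nat where J: "real J \<ge> exp (2 * real m * (C + 1))"
    using real_arch_simple by blast
  have "2 * real m * (C + 1) \<le> ln (real (Suc J))"
    using J by (subst ln_ge_iff) auto
  then have "C + 1 \<le> ln (real (Suc J)) / (2 * real m)"
    using m by (simp add: field_simps)
  also have "\<dots> \<le> (\<Sum>n=1..(1 + m * J)\<^sup>2. div_sum h n / sqrt (real n))"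
    by (rule sum_div_sum_over_sqrt_ge[OF h_mult h_range h_cop m])
  also have "\<dots> \<le> C"
    by (rule upper) simp
  finally show False
    by simp
qed

text \<open>The terms lost for not being coprime to \<open>m\<close> are nonprimes, worth at most 8
  in total, and primes up to \<open>m\<close>, worth at most 1 each.\<close>

lemma principal_mangoldt_bounds:
  assumes "m > 0" "N \<ge> 1"
  shows "\<bar>Re (\<Sum>d=1..N. principal_dchar m (int d) * mangoldt d / of_nat d) - ln (real N)\<bar> \<le> 9 + real m"
proof -
  have *: "Re (\<Sum>d=1..N. principal_dchar m (int d) * mangoldt d / of_nat d) = (\<Sum>d | d \<in> {1..N} \<and> coprime d m. mangoldt d / real d)"
  proof -
    have "Re (principal_dchar m (int d) * mangoldt d / of_nat d) = (if coprime d m then mangoldt d / real d else 0)" for d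
      by (simp add: principal_dchar_def Re_divide_of_nat)
    then show ?thesis
      by (simp add: sum.If_cases Int_def)
  qed
  have nonneg: "mangoldt d / real d \<ge> 0" for d
    using mangoldt_nonneg[of d] by simp
  have "(\<Sum>d | d \<in> {1..N} \<and> coprime d m. mangoldt d / real d) \<le> (\<Sum>d=1..N. mangoldt d / real d)"
    using nonneg by (intro sum_mono2) auto
  moreover have "(\<Sum>d=1..N. mangoldt d / real d) \<le> (\<Sum>d | d \<in> {1..N} \<and> coprime d m. mangoldt d / real d) + (8 + real m)"
  proof -
    have "(\<Sum>d=1..N. mangoldt d / real d) = (\<Sum>d | d \<in> {1..N} \<and> coprime d m. mangoldt d / real d) +
        (\<Sum>d | d \<in> {1..N} \<and> \<not> coprime d m. mangoldt d / real d)"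
      by (subst sum.union_disjoint[symmetric]) (auto intro!: sum.cong)
    also have "(\<Sum>d | d \<in> {1..N} \<and> \<not> coprime d m. mangoldt d / real d) \<le>
        (\<Sum>d\<in>{d \<in> {1..N}. \<not> prime d} \<union> {d \<in> {1..m}. prime d}. mangoldt d / real d)"
    proof (intro sum_mono2)
      show "{d \<in> {1..N}. \<not> coprime d m} \<subseteq> {d \<in> {1..N}. \<not> prime d} \<union> {d \<in> {1..m}. prime d}"
        using assms(1) by (auto dest: prime_imp_coprime intro: dvd_imp_le)
    qed (use nonneg in auto)
    also have "\<dots> = (\<Sum>d | d \<in> {1..N} \<and> \<not> prime d. mangoldt d / real d) + (\<Sum>d | d \<in> {1..m} \<and> prime d. mangoldt d / real d)"
      by (subst sum.union_disjoint[symmetric]) auto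
    also have "\<dots> \<le> 8 + (\<Sum>d | d \<in> {1..m} \<and> prime d. 1)"
    proof (intro add_mono sum_mangoldt_nonprime_le sum_mono)
      fix d assume d: "d \<in> {d \<in> {1..m}. prime d}"
      then show "mangoldt d / real d \<le> 1"
        using mangoldt_le[of d] ln_le_minus_one[of "real d"] by auto
    qed
    also have "\<dots> \<le> 8 + real m"
    proof -
      have "card {d \<in> {1..m}. prime d} \<le> card {1..m}"
        by (intro card_mono) auto
      then show ?thesis
        by simp
    qed
    finally show ?thesis
      by simp
  qed
  ultimately show ?thesis
    unfolding * using sum_mangoldt_over_n_bounds[OF assms(2)] by (simp add: abs_le_iff)
qed

lemma sum_dchars_mangoldt:
  assumes "squarefree m" "m > 0"
  shows "(\<Sum>\<chi> | dchar m \<chi>. \<Sum>d=1..N. \<chi> (int d) * mangoldt d / of_nat d) =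
    of_real (real (card {\<chi>. dchar m \<chi>}) * (\<Sum>d | d \<in> {1..N} \<and> [d = 1] (mod m). mangoldt d / real d))"
proof -
  have "(\<Sum>\<chi> | dchar m \<chi>. \<Sum>d=1..N. \<chi> (int d) * mangoldt d / of_nat d) =
     (\<Sum>d=1..N. (\<Sum>\<chi> | dchar m \<chi>. \<chi> (int d)) * mangoldt d / of_nat d)"
    by (subst sum.swap) (simp add: sum_distrib_right sum_divide_distrib)
  also have "\<dots> = (\<Sum>d=1..N. of_real (if [d = 1] (mod m) then real (card {\<chi>. dchar m \<chi>}) * (mangoldt d / real d) else 0))"
    unfolding sum_dchars[OF assms] by (intro sum.cong) (use cong_int_iff[of _ 1 m] in auto)
  also have "\<dots> = of_real (real (card {\<chi>. dchar m \<chi>}) * (\<Sum>d | d \<in> {1..N} \<and> [d = 1] (mod m). mangoldt d / real d))"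
    by (simp add: sum.If_cases Int_def sum_distrib_left flip: of_real_sum)
  finally show ?thesis .
qed

text \<open>If L(1,\<chi>) = 0 then \<chi> is not real, and its conjugate is a second such
  character. The sum over all characters is nonnegative by orthogonality, yet these two contribute
  \<open>- 2 * ln N\<close> against a single \<open>ln N\<close> from the principal
  character.\<close>

lemma nonprincipal_mangoldt_bounded:
  assumes sqf: "squarefree m" and m: "m > 0" and \<chi>: "dchar m \<chi>" "\<chi> \<noteq> principal_dchar m"
  obtains B where "\<And>N. N \<ge> 1 \<Longrightarrow> \<bar>Re (\<Sum>d=1..N. \<chi> (int d) * mangoldt d / of_nat d)\<bar> \<le> B"
proof -
  define X where "X = {\<chi>. dchar m \<chi>}"
  have finX: "finite X"
    unfolding X_def using m by (rule finite_dchars)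
  define M where "M = (\<lambda>\<chi> N. \<Sum>d=1..N. \<chi> (int d) * mangoldt d / complex_of_nat d)"
  have dichotomy: "(\<exists>B. \<forall>N\<ge>1. norm (M \<psi> N) \<le> B) \<or>
      (\<forall>N\<ge>1. norm (M \<psi> N + of_real (ln (real N))) \<le> 2 * real m) \<and> cnj \<circ> \<psi> \<noteq> \<psi>"
    if \<psi>: "dchar m \<psi>" "\<psi> \<noteq> principal_dchar m" for \<psi>
  proof -
    obtain L where L: "\<And>N. norm ((\<Sum>n=1..N. \<psi> (int n) / of_nat n) - L) \<le> 2 * real m / (real N + 1)"
      by (rule dchar_sum_limit[OF m \<psi>]) blast
    show ?thesis
    proof (cases "L = 0")
      case True
      have "cnj \<circ> \<psi> \<noteq> \<psi>"
      proof
        assume "cnj \<circ> \<psi> = \<psi>"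
        then have "cnj (\<psi> a) = \<psi> a" for a
          by (metis comp_apply)
        then have "\<psi> a \<in> \<real>" for a
          by (simp add: complex_eq_iff complex_is_Real_iff)
        then show False
          using real_dchar_nonvanishing[OF m \<psi>] L True by simp
      qed
      then show ?thesis
        using dchar_mangoldt_vanishing[OF m \<psi>(1)] L True by (simp add: M_def)
    next
      case False
      then show ?thesis
        using dchar_mangoldt_bounded[OF m \<psi> L] unfolding M_def by metis
    qed
  qed
  \<comment> \<open>Upper bounds suffice for the remaining characters: further zeros would only add
    more copies of \<open>- ln N\<close>.\<close>
  have upper: "\<exists>B. \<forall>N\<ge>1. Re (M \<psi> N) \<le> B" if \<psi>: "dchar m \<psi>" "\<psi> \<noteq> principal_dchar m" for \<psi>
    using dichotomy[OF \<psi>]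
  proof
    assume "\<exists>B. \<forall>N\<ge>1. norm (M \<psi> N) \<le> B"
    then show ?thesis
      by (meson complex_Re_le_cmod order.trans)
  next
    assume *: "(\<forall>N\<ge>1. norm (M \<psi> N + of_real (ln (real N))) \<le> 2 * real m) \<and> cnj \<circ> \<psi> \<noteq> \<psi>"
    have "Re (M \<psi> N) \<le> 2 * real m" if "N \<ge> 1" for N
    proof -
      have "Re (M \<psi> N + of_real (ln (real N))) \<le> 2 * real m"
        using * that by (meson complex_Re_le_cmod order.trans)
      moreover have "ln (real N) \<ge> 0"
        using that by simp
      ultimately show ?thesis
        by simp
    qed
    then show ?thesis
      by blast
  qed
  then obtain b where b: "\<And>\<psi> N. dchar m \<psi> \<Longrightarrow> \<psi> \<noteq> principal_dchar m \<Longrightarrow> N \<ge> 1 \<Longrightarrow> Re (M \<psi> N) \<le> b \<psi>"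
    by metis
  have "\<exists>B. \<forall>N\<ge>1. norm (M \<chi> N) \<le> B"
  proof (rule ccontr)
    assume contra: "\<not> ?thesis"
    define \<psi> where "\<psi> = cnj \<circ> \<chi>"
    have van: "\<And>N. N \<ge> 1 \<Longrightarrow> norm (M \<chi> N + of_real (ln (real N))) \<le> 2 * real m" and ne: "\<psi> \<noteq> \<chi>"
      using dichotomy[OF \<chi>] contra by (auto simp: \<psi>_def)
    have \<psi>: "dchar m \<psi>"
      using dchar_cnj[OF \<chi>(1)] by (simp add: \<psi>_def o_def)
    have \<psi>np: "\<psi> \<noteq> principal_dchar m"
    proof
      assume "\<psi> = principal_dchar m"
      then have "cnj (cnj (\<chi> a)) = cnj (principal_dchar m a)" for a
        by (simp add: \<psi>_def fun_eq_iff)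
      then have "\<chi> = principal_dchar m"
        by (auto simp: principal_dchar_def)
      then show False
        using \<chi> by simp
    qed
    have M\<psi>: "Re (M \<psi> N) = Re (M \<chi> N)" for N
      unfolding M_def \<psi>_def Re_sum by (intro sum.cong) (auto simp: mangoldt_def Re_divide_of_nat)
    define C where "C = 4 * real m + (9 + real m) + (\<Sum>\<phi>\<in>X - {principal_dchar m, \<chi>, \<psi>}. b \<phi>)"
    have bound: "ln (real N) \<le> C" if N: "N \<ge> 1" for N
    proof -
      have "0 \<le> Re (\<Sum>\<phi>\<in>X. M \<phi> N)"
        unfolding X_def M_def sum_dchars_mangoldt[OF sqf m] Re_complex_of_real
        by (intro mult_nonneg_nonneg sum_nonneg) (auto simp: mangoldt_nonneg)
      also have "(\<Sum>\<phi>\<in>X. M \<phi> N) = M (principal_dchar m) N + (M \<chi> N + (M \<psi> N + (\<Sum>\<phi>\<in>X - {principal_dchar m, \<chi>, \<psi>}. M \<phi> N)))"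
      proof -
        define Y where "Y = X - {principal_dchar m, \<chi>, \<psi>}"
        have "X = insert (principal_dchar m) (insert \<chi> (insert \<psi> Y))"
          using \<chi>(1) \<psi> dchar_principal_dchar[of m] by (auto simp: Y_def X_def)
        moreover have "finite Y" "principal_dchar m \<notin> Y" "\<chi> \<notin> Y" "\<psi> \<notin> Y"
          using finX by (auto simp: Y_def)
        ultimately have "(\<Sum>\<phi>\<in>X. M \<phi> N) =
            M (principal_dchar m) N + (M \<chi> N + (M \<psi> N + (\<Sum>\<phi>\<in>Y. M \<phi> N)))"
          using \<chi>(2) \<psi>np ne by simp
        then show ?thesis
          by (simp only: Y_def)
      qed
      also have "Re \<dots> = Re (M (principal_dchar m) N) + 2 * Re (M \<chi> N) + (\<Sum>\<phi>\<in>X - {principal_dchar m, \<chi>, \<psi>}. Re (M \<phi> N))"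
        by (simp add: M\<psi>)
      also have "Re (M (principal_dchar m) N) \<le> ln (real N) + (9 + real m)"
        using principal_mangoldt_bounds[OF m N] by (simp add: M_def abs_le_iff)
      also have "2 * Re (M \<chi> N) \<le> 4 * real m - 2 * ln (real N)"
        using complex_Re_le_cmod[of "M \<chi> N + of_real (ln (real N))"] van[OF N] by simp
      also have "(\<Sum>\<phi>\<in>X - {principal_dchar m, \<chi>, \<psi>}. Re (M \<phi> N)) \<le> (\<Sum>\<phi>\<in>X - {principal_dchar m, \<chi>, \<psi>}. b \<phi>)"
        using b N by (intro sum_mono) (auto simp: X_def)
      finally show ?thesis
        by (simp add: C_def)
    qed
    obtain N :: nat where N: "real N \<ge> exp (C + 1)"
      using real_arch_simple by blast
    then have "real N > 0"
      using exp_gt_zero[of "C + 1"] by linarith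
    then have "N \<ge> 1"
      by simp
    moreover from this have "C + 1 \<le> ln (real N)"
      using N by (subst ln_ge_iff) auto
    ultimately show False
      using bound[of N] by simp
  qed
  then show ?thesis
    using that unfolding M_def by (meson abs_Re_le_cmod order.trans)
qed

text \<open>Here \<open>c\<close> is the number of characters modulo \<open>m\<close>. By
  orthogonality \<open>c\<close> times the sum over the class 1 is the sum over all characters,
  where only the principal one is unbounded; passing from prime powers to primes costs
  \<open>8 * c\<close>.\<close>

theorem mertens_class_one:
  assumes sqf: "squarefree m" and m: "m > 0"
  obtains c B :: real where "c > 0"
    "\<And>N. N \<ge> 1 \<Longrightarrow> \<bar>c * (\<Sum>p | p \<in> {1..N} \<and> prime p \<and> [p = 1] (mod m). ln (real p) / real p) - ln (real N)\<bar> \<le> B"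
proof -
  define X where "X = {\<chi>. dchar m \<chi>}"
  have finX: "finite X"
    unfolding X_def using m by (rule finite_dchars)
  define c where "c = real (card X)"
  have pX: "principal_dchar m \<in> X"
    by (simp add: X_def dchar_principal_dchar)
  then have c: "c > 0"
    using finX by (auto simp: c_def card_gt_0_iff)
  define M where "M = (\<lambda>\<chi> N. \<Sum>d=1..N. \<chi> (int d) * mangoldt d / complex_of_nat d)"
  obtain b where b: "\<And>\<chi> N. \<chi> \<in> X - {principal_dchar m} \<Longrightarrow> N \<ge> 1 \<Longrightarrow> \<bar>Re (M \<chi> N)\<bar> \<le> b \<chi>"
  proof -
    have "\<exists>B. \<forall>N\<ge>1. \<bar>Re (M \<chi> N)\<bar> \<le> B" if "\<chi> \<in> X - {principal_dchar m}" for \<chi>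
      using nonprincipal_mangoldt_bounded[OF sqf m, of \<chi>] that unfolding M_def X_def
      by (metis Diff_iff insertI1 mem_Collect_eq)
    then show ?thesis
      using that by metis
  qed
  define B where "B = 9 + real m + (\<Sum>\<chi>\<in>X - {principal_dchar m}. b \<chi>)"
  have "\<bar>c * (\<Sum>p | p \<in> {1..N} \<and> prime p \<and> [p = 1] (mod m). ln (real p) / real p) - ln (real N)\<bar> \<le> B + 8 * c"
    if N: "N \<ge> 1" for N
  proof -
    define G where "G = (\<Sum>d | d \<in> {1..N} \<and> [d = 1] (mod m). mangoldt d / real d)"
    define P where "P = (\<Sum>p | p \<in> {1..N} \<and> prime p \<and> [p = 1] (mod m). mangoldt p / real p)"
    have "c * G = Re (\<Sum>\<chi>\<in>X. M \<chi> N)"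
      unfolding X_def M_def sum_dchars_mangoldt[OF sqf m] by (simp add: G_def c_def X_def)
    also have "\<dots> = Re (M (principal_dchar m) N) + (\<Sum>\<chi>\<in>X - {principal_dchar m}. Re (M \<chi> N))"
      using finX pX by (simp add: sum.remove[of X "principal_dchar m"])
    finally have "c * G - ln (real N) =
        (Re (M (principal_dchar m) N) - ln (real N)) + (\<Sum>\<chi>\<in>X - {principal_dchar m}. Re (M \<chi> N))"
      by simp
    also have "\<bar>\<dots>\<bar> \<le> (9 + real m) + (\<Sum>\<chi>\<in>X - {principal_dchar m}. b \<chi>)"
      using principal_mangoldt_bounds[OF m N] b[OF _ N] unfolding M_def
      by (intro order.trans[OF abs_triangle_ineq] add_mono order.trans[OF sum_abs] sum_mono) auto
    finally have 1: "\<bar>c * G - ln (real N)\<bar> \<le> B"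
      by (simp add: B_def)
    have nonneg: "mangoldt d / real d \<ge> 0" for d
      using mangoldt_nonneg[of d] by simp
    have "G = P + (\<Sum>d | d \<in> {1..N} \<and> [d = 1] (mod m) \<and> \<not> prime d. mangoldt d / real d)"
      unfolding G_def P_def by (subst sum.union_disjoint[symmetric]) (auto intro!: sum.cong)
    moreover have "(\<Sum>d | d \<in> {1..N} \<and> [d = 1] (mod m) \<and> \<not> prime d. mangoldt d / real d) \<le>
        (\<Sum>d | d \<in> {1..N} \<and> \<not> prime d. mangoldt d / real d)"
      using nonneg by (intro sum_mono2) auto
    moreover have "(\<Sum>d | d \<in> {1..N} \<and> [d = 1] (mod m) \<and> \<not> prime d. mangoldt d / real d) \<ge> 0"
      using nonneg by (intro sum_nonneg) auto
    ultimately have "P \<le> G" "G \<le> P + 8"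
      using sum_mangoldt_nonprime_le[of N] by linarith+
    then have "c * P \<le> c * G" "c * G \<le> c * (P + 8)"
      using c by simp_all
    moreover have "P = (\<Sum>p | p \<in> {1..N} \<and> prime p \<and> [p = 1] (mod m). ln (real p) / real p)"
      unfolding P_def by (intro sum.cong) auto
    ultimately show ?thesis
      using 1 by (simp add: abs_le_iff algebra_simps)
  qed
  then show ?thesis
    using that c by blast
qed

subsection \<open>Bilinear character sums\<close>

lemma Cauchy_Schwarz_ineq_sum:
  fixes f g :: "'a \<Rightarrow> real"
  shows "(\<Sum>i\<in>I. f i * g i)\<^sup>2 \<le> (\<Sum>i\<in>I. (f i)\<^sup>2) * (\<Sum>i\<in>I. (g i)\<^sup>2)"
proof -
  have "0 \<le> (\<Sum>i\<in>I. \<Sum>j\<in>I. (f i * g j - f j * g i)\<^sup>2)"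
    by (intro sum_nonneg) auto
  also have "\<dots> = (\<Sum>i\<in>I. \<Sum>j\<in>I. (f i)\<^sup>2 * (g j)\<^sup>2) + (\<Sum>i\<in>I. \<Sum>j\<in>I. (f j)\<^sup>2 * (g i)\<^sup>2)
      - 2 * (\<Sum>i\<in>I. \<Sum>j\<in>I. (f i * g i) * (f j * g j))"
    by (simp add: sum.distrib sum_subtractf sum_distrib_left power2_eq_square algebra_simps)
  also have "(\<Sum>i\<in>I. \<Sum>j\<in>I. (f j)\<^sup>2 * (g i)\<^sup>2) = (\<Sum>i\<in>I. \<Sum>j\<in>I. (f i)\<^sup>2 * (g j)\<^sup>2)"
    by (rule sum.swap)
  finally show ?thesis
    by (simp add: sum_product power2_eq_square)
qed

lemma coprime_int_prime_iff:
  assumes "prime p"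
  shows "coprime y (int p) \<longleftrightarrow> \<not> int p dvd y"
proof -
  have "prime (int p)"
    using assms by simp
  then show ?thesis
    using prime_imp_coprime coprime_commute not_prime_unit by (metis coprime_def dvd_refl)
qed

context
  fixes p :: nat and \<psi> :: "int \<Rightarrow> complex" and n :: int
  assumes p: "prime p" and n: "\<not> int p dvd n"
begin

text \<open>The map from \<open>s\<close> to \<open>(r * s + n) / (r' * s + n)\<close> is fractional
  linear with determinant \<open>n * (r - r')\<close>, hence injective. It has one pole and omits
  one value, \<open>r / r'\<close>, so the sum is that of \<open>\<psi>\<close> over all residues
  but one, which is minus a single value.\<close>

lemma linear_fraction_sum:
  fixes r r' :: int
  assumes \<psi>: "dchar p \<psi>" "\<psi> \<noteq> principal_dchar p"
    and r': "\<not> int p dvd r'" and rr': "\<not> int p dvd r - r'"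
  shows "norm (\<Sum>s\<in>{0..<int p}. \<psi> (r * s + n) * cnj (\<psi> (r' * s + n))) \<le> 1"
proof -
  have p0: "p > 0"
    using p prime_gt_0_nat by blast
  have ip: "prime (int p)"
    using p by simp
  define U where "U = {0..<int p}"
  have U_eqI: "s = t" if "s \<in> U" "t \<in> U" "int p dvd s - t" for s t
  proof -
    have "[s = t] (mod int p)"
      using that(3) by (simp add: cong_iff_dvd_diff)
    then show ?thesis
      using that by (simp add: U_def cong_def)
  qed
  obtain v where v: "\<And>y. coprime y (int p) \<Longrightarrow> [y * v y = 1] (mod int p)"
  proof -
    have "\<forall>y. \<exists>x. coprime y (int p) \<longrightarrow> [y * x = 1] (mod int p)"
      using cong_solve_coprime_int by blast
    then show ?thesis
      using that by metis
  qed
  have \<psi>v: "cnj (\<psi> y) = \<psi> (v y)" if "coprime y (int p)" for y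
  proof -
    have "\<psi> y * \<psi> (v y) = 1"
      using dchar_cong[OF \<psi>(1) v[OF that]] dchar_mult[OF \<psi>(1)] dchar_1[OF \<psi>(1)] by simp
    moreover have "\<psi> y * cnj (\<psi> y) = 1"
      using dchar_mult_cnj[OF \<psi>(1) p0, of y] that by simp
    ultimately show ?thesis
      by (metis mult_cancel_left mult_zero_left zero_neq_one)
  qed
  define S where "S = {s \<in> U. coprime (r' * s + n) (int p)}"
  define u where "u = (\<lambda>s. (r * s + n) * v (r' * s + n) mod int p)"
  define t where "t = r * v r' mod int p"
  have uv: "int p dvd u s * (r' * s + n) - (r * s + n)" if "s \<in> S" for s
  proof -
    have "[u s * (r' * s + n) = (r * s + n) * ((r' * s + n) * v (r' * s + n))] (mod int p)"
      unfolding u_def by (simp add: cong_def mod_mult_left_eq mod_mult_right_eq mult_ac)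
    also have "[(r * s + n) * ((r' * s + n) * v (r' * s + n)) = (r * s + n) * 1] (mod int p)"
      using that by (intro cong_scalar_left v) (auto simp: S_def)
    finally show ?thesis
      by (simp add: cong_iff_dvd_diff)
  qed
  have tv: "int p dvd t * r' - r"
  proof -
    have "[t * r' = r * (r' * v r')] (mod int p)"
      unfolding t_def by (simp add: cong_def mod_mult_left_eq mod_mult_right_eq mult_ac)
    also have "[r * (r' * v r') = r * 1] (mod int p)"
      using r' by (intro cong_scalar_left v) (simp add: coprime_int_prime_iff[OF p])
    finally show ?thesis
      by (simp add: cong_iff_dvd_diff)
  qed
  have inj: "inj_on u S"
  proof (rule inj_onI)
    fix s s' assume s: "s \<in> S" "s' \<in> S" "u s = u s'"
    \<comment> \<open>Cross-multiplying the two defining congruences removes the division and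
      exposes the determinant.\<close>
    have "int p dvd (u s * (r' * s + n) - (r * s + n)) * (r' * s' + n) -
        (u s' * (r' * s' + n) - (r * s' + n)) * (r' * s + n)"
      by (rule dvd_diff[OF dvd_mult2[OF uv[OF s(1)]] dvd_mult2[OF uv[OF s(2)]]])
    also have "\<dots> = - (n * (r - r') * (s - s'))"
      using s(3) by (simp add: algebra_simps)
    finally have "int p dvd n * (r - r') * (s - s')"
      by simp
    then have "int p dvd s - s'"
      using n rr' ip by (simp add: prime_dvd_mult_iff)
    then show "s = s'"
      using s by (intro U_eqI) (auto simp: S_def)
  qed
  have sub: "u ` S \<subseteq> U - {t}"
  proof
    fix y assume "y \<in> u ` S"
    then obtain s where s: "s \<in> S" "y = u s"
      by auto
    have "y \<noteq> t"
    proof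
      assume "y = t"
      then have "int p dvd r' * (u s * (r' * s + n) - (r * s + n)) - (t * r' - r) * (r' * s + n)"
        by (intro dvd_diff[OF dvd_mult[OF uv[OF s(1)]] dvd_mult2[OF tv]])
      also have "\<dots> = n * (r - r')"
        using \<open>y = t\<close> s(2) by (simp add: algebra_simps)
      finally show False
        using n rr' ip by (simp add: prime_dvd_mult_iff)
    qed
    then show "y \<in> U - {t}"
      using p0 by (auto simp: s(2) u_def U_def)
  qed
  \<comment> \<open>With at most one pole, \<open>S\<close> is at least as large as
    \<open>U - {t}\<close>, so the injection \<open>u\<close> is onto.\<close>
  have "card (U - S) \<le> 1"
  proof (rule card_le_Suc0_iff_eq[THEN iffD2, simplified One_nat_def[symmetric]])
    show "\<forall>s\<in>U - S. \<forall>s'\<in>U - S. s = s'"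
    proof (intro ballI)
      fix s s' assume s: "s \<in> U - S" "s' \<in> U - S"
      then have "int p dvd (r' * s + n) - (r' * s' + n)"
        by (intro dvd_diff) (auto simp: S_def coprime_int_prime_iff[OF p])
      then have "int p dvd r' * (s - s')"
        by (simp add: algebra_simps)
      then show "s = s'"
        using r' ip s by (intro U_eqI) (auto simp: prime_dvd_mult_iff)
    qed
  qed (simp add: U_def)
  moreover have "card U = card S + card (U - S)"
  proof -
    have "S \<subseteq> U" "finite U"
      by (auto simp: S_def U_def)
    then show ?thesis
      by (metis card_Diff_subset card_mono finite_subset le_add_diff_inverse)
  qed
  moreover have "t \<in> U"
    using p0 by (simp add: t_def U_def)
  ultimately have "card (U - {t}) \<le> card (u ` S)"
    using card_image[OF inj] by (simp add: U_def)
  then have bij: "u ` S = U - {t}"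
    by (intro card_seteq sub) (auto simp: U_def)
  have "(\<Sum>s\<in>U. \<psi> (r * s + n) * cnj (\<psi> (r' * s + n))) = (\<Sum>s\<in>S. \<psi> (r * s + n) * cnj (\<psi> (r' * s + n)))"
    by (intro sum.mono_neutral_right) (auto simp: S_def U_def dchar_eq_0_iff[OF \<psi>(1)])
  also have "\<dots> = (\<Sum>s\<in>S. \<psi> (u s))"
    by (intro sum.cong refl) (simp add: u_def S_def dchar_mod[OF \<psi>(1)] dchar_mult[OF \<psi>(1)] \<psi>v)
  also have "\<dots> = (\<Sum>y\<in>U - {t}. \<psi> y)"
    unfolding bij[symmetric] by (subst sum.reindex[OF inj]) simp
  also have "\<dots> = - \<psi> t"
    using sum_dchar_period[OF \<psi> p0] \<open>t \<in> U\<close> by (simp add: sum_diff1 U_def)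
  finally show ?thesis
    using norm_dchar_le_1[OF \<psi>(1) p0] by (simp add: U_def)
qed

text \<open>If \<open>p\<close> divides \<open>r'\<close>, the omitted value \<open>r / r'\<close>
  makes no sense; then \<open>r\<close> is invertible and conjugation exchanges the two.\<close>

lemma linear_fraction_sum':
  fixes r r' :: int
  assumes \<psi>: "dchar p \<psi>" "\<psi> \<noteq> principal_dchar p" and rr': "\<not> int p dvd r - r'"
  shows "norm (\<Sum>s\<in>{0..<int p}. \<psi> (r * s + n) * cnj (\<psi> (r' * s + n))) \<le> 1"
proof (cases "int p dvd r'")
  case True
  then have r: "\<not> int p dvd r"
    using rr' dvd_diff by blast
  moreover have "\<not> int p dvd r' - r"
    using rr' by (simp add: dvd_diff_commute)
  ultimately have "norm (\<Sum>s\<in>{0..<int p}. \<psi> (r' * s + n) * cnj (\<psi> (r * s + n))) \<le> 1"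
    by (intro linear_fraction_sum \<psi>)
  also have "(\<Sum>s\<in>{0..<int p}. \<psi> (r' * s + n) * cnj (\<psi> (r * s + n))) =
      cnj (\<Sum>s\<in>{0..<int p}. \<psi> (r * s + n) * cnj (\<psi> (r' * s + n)))"
    by (simp add: mult.commute)
  finally show ?thesis
    by (simp only: complex_mod_cnj)
next
  case False
  then show ?thesis
    by (intro linear_fraction_sum assms)
qed

end

text \<open>Ordered pairs with the diagonal included, so that this is the sum of the squares of
  \<open>residue_count\<close>.\<close>

definition collisions :: "nat \<Rightarrow> nat set \<Rightarrow> real" where
  "collisions p A = real (card {(a, b) \<in> A \<times> A. [a = b] (mod p)})"

definition residue_count :: "nat \<Rightarrow> nat set \<Rightarrow> int \<Rightarrow> real" where
  "residue_count p A s = real (card {a \<in> A. int a mod int p = s})"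

lemma sum_by_residue:
  fixes F :: "int \<Rightarrow> 'a::real_algebra_1"
  assumes "finite A" "p > 0"
  shows "(\<Sum>b\<in>A. F (int b mod int p)) = (\<Sum>s\<in>{0..<int p}. of_real (residue_count p A s) * F s)"
  unfolding residue_count_def of_real_of_nat_eq
  by (rule sum_fun_comp) (use assms in auto)

lemma collisions_altdef:
  assumes "finite A" "p > 0"
  shows "collisions p A = (\<Sum>a\<in>A. \<Sum>b\<in>A. if [a = b] (mod p) then 1 else 0)"
proof -
  have "{(a, b) \<in> A \<times> A. [a = b] (mod p)} = Sigma A (\<lambda>a. {b \<in> A. [a = b] (mod p)})"
    by auto
  then show ?thesis
    using assms by (simp add: collisions_def sum.If_cases Int_def)
qed

lemma collisions_eq_sum_squares:
  assumes "finite A" "p > 0"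
  shows "collisions p A = (\<Sum>s\<in>{0..<int p}. (residue_count p A s)\<^sup>2)"
proof -
  have "collisions p A = (\<Sum>a\<in>A. residue_count p A (int a mod int p))"
    unfolding collisions_altdef[OF assms] residue_count_def
  proof (intro sum.cong refl)
    fix a
    have "{b \<in> A. [a = b] (mod p)} = {b \<in> A. int b mod int p = int a mod int p}"
      by (auto simp: cong_def simp flip: zmod_int)
    then show "(\<Sum>b\<in>A. if [a = b] (mod p) then 1 else 0) = real (card {b \<in> A. int b mod int p = int a mod int p})"
      using assms by (simp add: sum.If_cases Int_def)
  qed
  also have "\<dots> = (\<Sum>s\<in>{0..<int p}. (residue_count p A s)\<^sup>2)"
    using sum_by_residue[OF assms, of "residue_count p A"] by (simp add: power2_eq_square)
  finally show ?thesis .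
qed

lemma square_card_le_collisions:
  assumes "finite A" "p > 0"
  shows "(real (card A))\<^sup>2 \<le> real p * collisions p A"
proof -
  have "(real (card A))\<^sup>2 = (\<Sum>s\<in>{0..<int p}. 1 * residue_count p A s)\<^sup>2"
    using sum_by_residue[OF assms, of "\<lambda>_. 1 :: real"] by simp
  also have "\<dots> \<le> (\<Sum>s\<in>{0..<int p}. 1\<^sup>2) * (\<Sum>s\<in>{0..<int p}. (residue_count p A s)\<^sup>2)"
    by (rule Cauchy_Schwarz_ineq_sum)
  finally show ?thesis
    using collisions_eq_sum_squares[OF assms] by simp
qed

text \<open>Cauchy-Schwarz over the residues of \<open>b\<close> separates their counts from the
  sums \<open>F s\<close>. In the second moment of \<open>F\<close>, congruent pairs give at most
  \<open>p + 1\<close> and all others at most 1; the total of the ones,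
  \<open>(card A)\<^sup>2\<close>, is absorbed because it is at most
  \<open>p * collisions p A\<close>.\<close>

lemma bilinear_dchar_sum_bound:
  assumes p: "prime p" and n: "\<not> int p dvd n" and \<psi>: "dchar p \<psi>" "\<psi> \<noteq> principal_dchar p"
    and A: "finite A"
  shows "norm (\<Sum>a\<in>A. \<Sum>b\<in>A. \<psi> (int a * int b + n)) \<le> sqrt (2 * real p) * collisions p A"
proof -
  have p0: "p > 0"
    using p prime_gt_0_nat by blast
  define E where "E = collisions p A"
  define F where "F = (\<lambda>s. \<Sum>a\<in>A. \<psi> (int a * s + n))"
  have E0: "E \<ge> 0"
    by (simp add: E_def collisions_def)
  have F_mod: "F (s mod int p) = F s" for s
    unfolding F_def
  proof (intro sum.cong refl dchar_cong[OF \<psi>(1)])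
    fix a
    show "[int a * (s mod int p) + n = int a * s + n] (mod int p)"
      by (intro cong_add cong_mult) auto
  qed
  have "(\<Sum>a\<in>A. \<Sum>b\<in>A. \<psi> (int a * int b + n)) = (\<Sum>b\<in>A. F (int b mod int p))"
    unfolding F_mod unfolding F_def by (rule sum.swap)
  also have "\<dots> = (\<Sum>s\<in>{0..<int p}. of_real (residue_count p A s) * F s)"
    by (rule sum_by_residue[OF A p0])
  also have "norm \<dots> \<le> (\<Sum>s\<in>{0..<int p}. residue_count p A s * norm (F s))"
    by (intro sum_norm_le) (simp add: norm_mult residue_count_def)
  finally have 1: "norm (\<Sum>a\<in>A. \<Sum>b\<in>A. \<psi> (int a * int b + n)) \<le> (\<Sum>s\<in>{0..<int p}. residue_count p A s * norm (F s))" .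
  have "of_real (\<Sum>s\<in>{0..<int p}. (norm (F s))\<^sup>2) = (\<Sum>s\<in>{0..<int p}. F s * cnj (F s))"
    by (simp only: of_real_sum complex_norm_square)
  also have "\<dots> = (\<Sum>s\<in>{0..<int p}. \<Sum>a\<in>A. \<Sum>b\<in>A. \<psi> (int a * s + n) * cnj (\<psi> (int b * s + n)))"
    by (simp add: F_def sum_product)
  also have "\<dots> = (\<Sum>a\<in>A. \<Sum>b\<in>A. \<Sum>s\<in>{0..<int p}. \<psi> (int a * s + n) * cnj (\<psi> (int b * s + n)))"
    by (subst sum.swap, intro sum.cong refl, rule sum.swap)
  finally have eq: "complex_of_real (\<Sum>s\<in>{0..<int p}. (norm (F s))\<^sup>2) =
      (\<Sum>a\<in>A. \<Sum>b\<in>A. \<Sum>s\<in>{0..<int p}. \<psi> (int a * s + n) * cnj (\<psi> (int b * s + n)))" .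
  have "(\<Sum>s\<in>{0..<int p}. (norm (F s))\<^sup>2) = norm (complex_of_real (\<Sum>s\<in>{0..<int p}. (norm (F s))\<^sup>2))"
    unfolding norm_of_real by (rule abs_of_nonneg[symmetric]) (intro sum_nonneg zero_le_power2)
  also have "\<dots> = norm (\<Sum>a\<in>A. \<Sum>b\<in>A. \<Sum>s\<in>{0..<int p}. \<psi> (int a * s + n) * cnj (\<psi> (int b * s + n)))"
    by (simp only: eq)
  also have "\<dots> \<le> (\<Sum>a\<in>A. \<Sum>b\<in>A. real p * (if [a = b] (mod p) then 1 else 0) + 1)"
  proof (intro sum_norm_le)
    fix a b
    show "norm (\<Sum>s\<in>{0..<int p}. \<psi> (int a * s + n) * cnj (\<psi> (int b * s + n)))
      \<le> real p * (if [a = b] (mod p) then 1 else 0) + 1"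
    proof (cases "[a = b] (mod p)")
      case True
      have "norm (\<Sum>s\<in>{0..<int p}. \<psi> (int a * s + n) * cnj (\<psi> (int b * s + n))) \<le> (\<Sum>s\<in>{0..<int p}. 1)"
        using norm_dchar_le_1[OF \<psi>(1) p0] by (intro sum_norm_le) (simp add: norm_mult mult_le_one)
      then show ?thesis
        using True by simp
    next
      case False
      then have "\<not> int p dvd int a - int b"
        by (metis cong_iff_dvd_diff cong_int_iff)
      then show ?thesis
        using linear_fraction_sum'[OF p n \<psi>] False by simp
    qed
  qed
  also have "\<dots> = real p * E + (real (card A))\<^sup>2"
    unfolding E_def collisions_altdef[OF A p0]
    by (simp add: sum.distrib sum_distrib_left power2_eq_square)
  also have "\<dots> \<le> real p * E + real p * E"
    using square_card_le_collisions[OF A p0] by (simp add: E_def)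
  finally have 2: "(\<Sum>s\<in>{0..<int p}. (norm (F s))\<^sup>2) \<le> 2 * real p * E"
    by (simp add: mult_ac)
  have "(\<Sum>s\<in>{0..<int p}. residue_count p A s * norm (F s))\<^sup>2 \<le>
      (\<Sum>s\<in>{0..<int p}. (residue_count p A s)\<^sup>2) * (\<Sum>s\<in>{0..<int p}. (norm (F s))\<^sup>2)"
    by (rule Cauchy_Schwarz_ineq_sum)
  also have "\<dots> \<le> E * (2 * real p * E)"
    unfolding E_def[symmetric] collisions_eq_sum_squares[OF A p0, symmetric] using 2 E0 by (intro mult_left_mono)
  also have "\<dots> = (sqrt (2 * real p) * E)\<^sup>2"
    by (simp add: power_mult_distrib power2_eq_square)
  finally have "(\<Sum>s\<in>{0..<int p}. residue_count p A s * norm (F s)) \<le> sqrt (2 * real p) * E"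
    by (rule power2_le_imp_le) (use E0 in simp)
  then show ?thesis
    using 1 by (simp add: E_def)
qed

text \<open>As \<open>p\<close> does not divide \<open>n\<close>, each \<open>a\<close> admits at
  most one residue \<open>s\<close> with \<open>p\<close> dividing \<open>a * s + n\<close>, and
  \<open>s\<close> determines \<open>a\<close> modulo \<open>p\<close>. So the counts
  \<open>z s\<close> have second moment at most that of the residue counts, and the mixed sum is at
  most the mean of the two.\<close>

lemma card_zero_pairs_le_collisions:
  assumes p: "prime p" and n: "\<not> int p dvd n" and A: "finite A"
  shows "(\<Sum>a\<in>A. \<Sum>b\<in>A. if int p dvd int a * int b + n then 1 else 0) \<le> collisions p A"
proof -
  have p0: "p > 0" and ip: "prime (int p)"
    using p prime_gt_0_nat by auto
  define E where "E = collisions p A"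
  define z :: "int \<Rightarrow> real" where "z = (\<lambda>s. \<Sum>a\<in>A. if int p dvd int a * s + n then 1 else 0)"
  have z_mod: "z (s mod int p) = z s" for s
  proof -
    have "int p dvd int a * (s mod int p) + n \<longleftrightarrow> int p dvd int a * s + n" for a
    proof -
      have "[int a * (s mod int p) + n = int a * s + n] (mod int p)"
        by (intro cong_add cong_mult) auto
      then show ?thesis
        by (simp add: cong_def dvd_eq_mod_eq_0)
    qed
    then show ?thesis
      by (simp add: z_def)
  qed
  have "(\<Sum>a\<in>A. \<Sum>b\<in>A. if int p dvd int a * int b + n then 1 else 0) = (\<Sum>b\<in>A. z (int b mod int p))"
    unfolding z_mod unfolding z_def by (rule sum.swap)
  also have "\<dots> = (\<Sum>s\<in>{0..<int p}. residue_count p A s * z s)"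
    using sum_by_residue[OF A p0, of z] by simp
  also have "\<dots> \<le> (\<Sum>s\<in>{0..<int p}. ((residue_count p A s)\<^sup>2 + (z s)\<^sup>2) / 2)"
  proof (intro sum_mono)
    fix s
    show "residue_count p A s * z s \<le> ((residue_count p A s)\<^sup>2 + (z s)\<^sup>2) / 2"
      using sum_squares_bound[of "residue_count p A s" "z s"] by simp
  qed
  also have "\<dots> = (E + (\<Sum>s\<in>{0..<int p}. (z s)\<^sup>2)) / 2"
    by (simp add: E_def collisions_eq_sum_squares[OF A p0] sum.distrib flip: sum_divide_distrib)
  also have "(\<Sum>s\<in>{0..<int p}. (z s)\<^sup>2) = (\<Sum>s\<in>{0..<int p}. \<Sum>a\<in>A. \<Sum>b\<in>A.
      (if int p dvd int a * s + n \<and> int p dvd int b * s + n then 1 else 0))"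
    unfolding z_def power2_eq_square sum_product by (intro sum.cong) auto
  also have "\<dots> = (\<Sum>a\<in>A. \<Sum>b\<in>A. \<Sum>s\<in>{0..<int p}.
      (if int p dvd int a * s + n \<and> int p dvd int b * s + n then 1 else 0))"
    by (subst sum.swap, intro sum.cong refl, rule sum.swap)
  also have "\<dots> \<le> (\<Sum>a\<in>A. \<Sum>b\<in>A. if [a = b] (mod p) then 1 else 0)"
  proof (intro sum_mono)
    fix a b
    define Z where "Z = {s \<in> {0..<int p}. int p dvd int a * s + n \<and> int p dvd int b * s + n}"
    have a: "\<not> int p dvd int a" if "s \<in> Z" for s
    proof
      assume "int p dvd int a"
      moreover have "int p dvd int a * s + n"
        using that by (simp add: Z_def)
      ultimately show False
        using n by (simp add: dvd_add_right_iff)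
    qed
    have uniq: "s = t" if "s \<in> Z" "t \<in> Z" for s t
    proof -
      have "int p dvd (int a * s + n) - (int a * t + n)"
        using that by (intro dvd_diff) (auto simp: Z_def)
      then have "int p dvd int a * (s - t)"
        by (simp add: algebra_simps)
      then have "[s = t] (mod int p)"
        using a[OF that(1)] ip by (simp add: prime_dvd_mult_iff cong_iff_dvd_diff)
      then show ?thesis
        using that by (simp add: Z_def cong_def)
    qed
    have cong: "[a = b] (mod p)" if "s \<in> Z" for s
    proof -
      have "int p dvd (int a * s + n) - (int b * s + n)"
        using that by (intro dvd_diff) (auto simp: Z_def)
      then have "int p dvd (int a - int b) * s"
        by (simp add: algebra_simps)
      moreover have "\<not> int p dvd s"
      proof
        assume "int p dvd s"
        moreover have "int p dvd int a * s + n"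
          using that by (simp add: Z_def)
        ultimately show False
          using n by (simp add: dvd_add_right_iff)
      qed
      ultimately have "[int a = int b] (mod int p)"
        using ip by (simp add: prime_dvd_mult_iff cong_iff_dvd_diff)
      then show ?thesis
        by (simp add: cong_int_iff)
    qed
    have "(\<Sum>s\<in>{0..<int p}. (if int p dvd int a * s + n \<and> int p dvd int b * s + n then 1 else 0 :: real)) = real (card Z)"
      by (simp add: sum.If_cases Int_def Z_def)
    also have "\<dots> \<le> (if [a = b] (mod p) then 1 else 0)"
    proof (cases "Z = {}")
      case False
      then obtain s where "s \<in> Z" by blast
      then have "Z = {s}"
        using uniq by blast
      then show ?thesis
        using cong[OF \<open>s \<in> Z\<close>] by simp
    qed simp
    finally show "(\<Sum>s\<in>{0..<int p}. (if int p dvd int a * s + n \<and> int p dvd int b * s + n then 1 else 0 :: real)) \<le>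
      (if [a = b] (mod p) then 1 else 0)" .
  qed
  also have "\<dots> = E"
    by (simp add: E_def collisions_altdef[OF A p0])
  finally show ?thesis
    by (simp add: E_def)
qed

subsection \<open>The larger sieve for power residues\<close>

lemma cis_root_power_eq_1_iff:
  assumes "P > 0"
  shows "cis (2 * pi / real P) ^ k = 1 \<longleftrightarrow> P dvd k"
proof -
  define w where "w = cis (2 * pi / real P)"
  have wP: "w ^ P = 1"
    using assms by (simp add: w_def DeMoivre)
  have "w ^ k = w ^ (P * (k div P) + k mod P)"
    by simp
  also have "\<dots> = w ^ (k mod P)"
    unfolding power_add power_mult wP by simp
  also have "\<dots> = cis (2 * pi * real (k mod P) / real P)"
    by (simp add: w_def DeMoivre mult_ac)
  also have "\<dots> = 1 \<longleftrightarrow> k mod P = 0"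
    using inj_onD[OF bij_betw_imp_inj_on[OF bij_betw_roots_unity[OF assms]], of "k mod P" 0] assms by auto
  finally show ?thesis
    by (simp add: w_def mod_eq_0_iff_dvd)
qed

text \<open>A power \<open>z\<^sup>k\<close> with \<open>k\<close> not coprime to \<open>P\<close> cannot be mapped to a primitive \<open>P\<close>-th root of unity
  by a character of order \<open>P\<close>; detecting the fibre over such a root by characters
  gives the inequality.\<close>

lemma power_sieve_inequality:
  assumes p: "prime p" and P: "P > 1" "[p = 1] (mod P)" and n: "\<not> int p dvd n"
    and A: "finite A" and D: "D \<subseteq> A \<times> A"
    and good: "\<And>a b. a \<in> A \<Longrightarrow> b \<in> A \<Longrightarrow> (a, b) \<notin> D \<Longrightarrow> \<exists>z k. int a * int b + n = z ^ k \<and> k > 0 \<and> \<not> coprime k P"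
  shows "(real (card A))\<^sup>2 \<le> real P * real (card D) + real P * sqrt (2 * real p) * collisions p A"
proof -
  have p0: "p > 0" and p1: "p > 1"
    using p prime_gt_0_nat prime_gt_1_nat by auto
  have "P dvd p - 1"
    using P(2) by (rule cong_to_1_nat)
  then obtain q where q: "p - 1 = P * q"
    by (elim dvdE)
  then have q0: "q > 0"
    using p1 by (intro Nat.gr0I) auto
  obtain \<chi> g where \<chi>: "dchar p \<chi>" and g: "coprime g (int p)" "\<chi> g = cis (2 * pi / real (p - 1))"
    using primitive_dchar_exists[OF p] by metis
  define \<psi> where "\<psi> = (\<lambda>a. \<chi> a ^ q)"
  have \<psi>: "dchar p \<psi>"
    unfolding \<psi>_def by (intro dchar_pow \<chi> q0)
  define w where "w = cis (2 * pi / real P)"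
  have w_norm: "norm w = 1" and w_unit: "w * cnj w = 1"
    using complex_norm_square[of w] by (simp_all add: w_def)
  have \<psi>g: "\<psi> g = w"
    unfolding \<psi>_def g(2) q using q0 P by (simp add: w_def DeMoivre)
  have \<psi>P: "\<psi> y ^ P = 1" if "coprime y (int p)" for y
    using dchar_power_totient[OF \<chi> p0 that] p q
    by (simp add: \<psi>_def totient_prime mult.commute flip: power_mult)
  \<comment> \<open>On units, \<open>t\<close> is \<open>P\<close> times the indicator of
    \<open>\<psi> y = w\<close>. On multiples of \<open>p\<close> it is 1, the term
    \<open>j = 0\<close>.\<close>
  define t where "t = (\<lambda>y. \<Sum>j<P. (\<psi> y * cnj w) ^ j)"
  have x_norm: "norm (\<psi> y * cnj w) \<le> 1" for y
    using norm_dchar_le_1[OF \<psi> p0, of y] by (simp add: norm_mult w_norm)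
  have t_norm: "norm (t y) \<le> real P" for y
  proof -
    have "norm (t y) \<le> (\<Sum>j<P. 1)"
      unfolding t_def by (intro sum_norm_le) (simp only: norm_power power_le_one x_norm norm_ge_zero)
    then show ?thesis by simp
  qed
  have t_zero: "t y = 1" if "int p dvd y" for y
  proof -
    have "\<psi> y = 0"
      using that dchar_eq_0_iff[OF \<psi>, of y] coprime_int_prime_iff[OF p] by simp
    then show ?thesis
      using P by (simp add: t_def power_0_left sum.If_cases)
  qed
  have t_power: "t (z ^ k) = 0" if "\<not> int p dvd z ^ k" "\<not> coprime k P" "k > 0" for z k
  proof -
    have cop: "coprime (z ^ k) (int p)"
      using that coprime_int_prime_iff[OF p] by simp
    have z: "coprime z (int p)"
      using cop that(3) by simp
    define d where "d = gcd k P"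
    have "d \<noteq> 1"
      using that(2) unfolding d_def coprime_iff_gcd_eq_1 .
    moreover have "d > 0"
      using P(1) by (simp add: d_def)
    moreover have "d dvd k" "d dvd P"
      unfolding d_def by (rule gcd_dvd1, rule gcd_dvd2)
    ultimately have d: "d dvd k" "d dvd P" "d > 1"
      by simp_all
    \<comment> \<open>The power \<open>P div d\<close> sends \<open>\<psi> (z ^ k)\<close> to 1,
      whereas \<open>w\<close> has exact order \<open>P\<close> and \<open>d > 1\<close>.\<close>
    have "\<psi> (z ^ k) \<noteq> w"
    proof
      assume "\<psi> (z ^ k) = w"
      then have "w ^ (P div d) = \<psi> z ^ (k * (P div d))"
        by (simp add: dchar_power[OF \<psi>] power_mult)
      also have "k * (P div d) = P * (k div d)"
        using d by (auto elim!: dvdE)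
      also have "\<psi> z ^ (P * (k div d)) = 1"
        by (simp add: power_mult \<psi>P[OF z])
      finally have "P dvd P div d"
        using cis_root_power_eq_1_iff[of P "P div d"] P by (simp add: w_def)
      moreover have "P div d < P"
        using d(3) P(1) by simp
      moreover have "P div d \<noteq> 0"
        using d(2) P(1) dvd_div_eq_0_iff[of d P] by linarith
      ultimately show False
        by (auto dest: dvd_imp_le)
    qed
    then have "\<psi> (z ^ k) * cnj w \<noteq> 1"
      using w_unit by (metis mult.assoc mult.commute mult.right_neutral)
    moreover have "(\<psi> (z ^ k) * cnj w) ^ P = 1"
    proof -
      have "w ^ P = 1"
        using cis_root_power_eq_1_iff[of P P] P by (simp add: w_def)
      then have "cnj w ^ P = 1"
        by (metis complex_cnj_one complex_cnj_power)
      then show ?thesis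
        by (simp only: power_mult_distrib \<psi>P[OF cop] mult_1)
    qed
    ultimately show ?thesis
      unfolding t_def by (subst geometric_sum) auto
  qed
  define Y where "Y = (\<lambda>(a, b). int a * int b + n)"
  define E where "E = collisions p A"
  have fin: "finite (A \<times> A)"
    using A by simp
  have S_bound: "norm (\<Sum>x\<in>A \<times> A. \<psi> (Y x) ^ j) \<le> sqrt (2 * real p) * E" if "j \<in> {1..<P}" for j
  proof -
    have "dchar p (\<lambda>a. \<psi> a ^ j)"
      using that by (intro dchar_pow \<psi>) auto
    moreover have "(\<lambda>a. \<psi> a ^ j) \<noteq> principal_dchar p"
    proof
      assume "(\<lambda>a. \<psi> a ^ j) = principal_dchar p"
      then have "\<psi> g ^ j = 1"
        using g(1) by (simp add: fun_eq_iff principal_dchar_def)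
      then have "P dvd j"
        using P cis_root_power_eq_1_iff[of P j] by (simp add: \<psi>g w_def)
      then show False
        using that by (auto dest: dvd_imp_le)
    qed
    ultimately have "norm (\<Sum>a\<in>A. \<Sum>b\<in>A. \<psi> (int a * int b + n) ^ j) \<le> sqrt (2 * real p) * E"
      unfolding E_def by (rule bilinear_dchar_sum_bound[OF p n _ _ A])
    then show ?thesis
      by (simp add: sum.cartesian_product Y_def case_prod_unfold)
  qed
  have "(\<Sum>x\<in>A \<times> A. t (Y x)) = (\<Sum>j<P. cnj w ^ j * (\<Sum>x\<in>A \<times> A. \<psi> (Y x) ^ j))"
    unfolding t_def sum_distrib_left by (subst sum.swap) (simp add: power_mult_distrib mult.commute)
  also have "{..<P} = insert 0 {1..<P}"
    using P by auto
  also have "(\<Sum>j\<in>insert 0 {1..<P}. cnj w ^ j * (\<Sum>x\<in>A \<times> A. \<psi> (Y x) ^ j)) =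
      (of_nat (card A))\<^sup>2 + (\<Sum>j\<in>{1..<P}. cnj w ^ j * (\<Sum>x\<in>A \<times> A. \<psi> (Y x) ^ j))"
    by (subst sum.insert) (auto simp: card_cartesian_product power2_eq_square)
  finally have "(of_nat (card A))\<^sup>2 = (\<Sum>x\<in>A \<times> A. t (Y x)) -
      (\<Sum>j\<in>{1..<P}. cnj w ^ j * (\<Sum>x\<in>A \<times> A. \<psi> (Y x) ^ j))"
    by simp
  then have "(real (card A))\<^sup>2 = norm ((\<Sum>x\<in>A \<times> A. t (Y x)) -
      (\<Sum>j\<in>{1..<P}. cnj w ^ j * (\<Sum>x\<in>A \<times> A. \<psi> (Y x) ^ j)))"
    by (metis norm_of_nat norm_power)
  also have "\<dots> \<le> norm (\<Sum>x\<in>A \<times> A. t (Y x)) + norm (\<Sum>j\<in>{1..<P}. cnj w ^ j * (\<Sum>x\<in>A \<times> A. \<psi> (Y x) ^ j))"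
    by (rule norm_triangle_ineq4)
  also have "norm (\<Sum>j\<in>{1..<P}. cnj w ^ j * (\<Sum>x\<in>A \<times> A. \<psi> (Y x) ^ j)) \<le> (\<Sum>j\<in>{1..<P}. sqrt (2 * real p) * E)"
    using S_bound by (intro sum_norm_le) (simp add: norm_mult norm_power w_norm)
  also have "\<dots> = (real P - 1) * (sqrt (2 * real p) * E)"
    using P by simp
  also have "norm (\<Sum>x\<in>A \<times> A. t (Y x)) \<le>
      (\<Sum>x\<in>A \<times> A. (if x \<in> D then real P else 0) + (if int p dvd Y x then 1 else 0))"
  proof (intro sum_norm_le)
    fix x assume x: "x \<in> A \<times> A"
    show "norm (t (Y x)) \<le> (if x \<in> D then real P else 0) + (if int p dvd Y x then 1 else 0)"
    proof (cases "x \<in> D")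
      case True
      have "0 \<le> (if int p dvd Y x then 1 else 0 :: real)"
        by simp
      then show ?thesis
        using True t_norm[of "Y x"] by (simp only: if_True)
    next
      case False
      obtain a b where ab: "x = (a, b)" "a \<in> A" "b \<in> A"
        using x by auto
      obtain z k where zk: "Y x = z ^ k" "\<not> coprime k P" "k > 0"
        using good[OF ab(2,3)] False by (auto simp: ab(1) Y_def)
      show ?thesis
        using False t_zero[of "Y x"] t_power[of z k] zk by auto
    qed
  qed
  also have "\<dots> = real P * real (card D) + (\<Sum>a\<in>A. \<Sum>b\<in>A. if int p dvd int a * int b + n then 1 else 0)"
  proof -
    have "(\<Sum>x\<in>A \<times> A. if x \<in> D then real P else 0) = real P * real (card D)"
      using fin D by (simp add: sum.If_cases Int_absorb1)
    then show ?thesis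
      by (simp add: sum.distrib sum.cartesian_product Y_def case_prod_unfold)
  qed
  finally have "(real (card A))\<^sup>2 \<le> real P * real (card D) +
      (\<Sum>a\<in>A. \<Sum>b\<in>A. if int p dvd int a * int b + n then 1 else 0) +
      (real P - 1) * (sqrt (2 * real p) * E)"
    by this auto
  moreover have "(\<Sum>a\<in>A. \<Sum>b\<in>A. if int p dvd int a * int b + n then 1 else 0) \<le> E"
    unfolding E_def by (rule card_zero_pairs_le_collisions[OF p n A])
  \<comment> \<open>Only \<open>P - 1\<close> nontrivial powers of the character occur; the spare
    \<open>sqrt (2 * p) * E\<close> pays for the pairs with \<open>p\<close> dividing
    \<open>a * b + n\<close>.\<close>
  moreover have "1 * E \<le> sqrt (2 * real p) * E"
    using p1 by (intro mult_right_mono) (auto simp: E_def collisions_def)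
  moreover have "(real P - 1) * (sqrt (2 * real p) * E) = real P * sqrt (2 * real p) * E - sqrt (2 * real p) * E"
    by (simp add: algebra_simps)
  ultimately show ?thesis
    unfolding E_def by linarith
qed

lemma sum_ln_prime_divisors_le:
  assumes "finite S" "\<And>p. p \<in> S \<Longrightarrow> prime p" "d > 0"
  shows "(\<Sum>p | p \<in> S \<and> p dvd d. ln (real p)) \<le> ln (real d)"
proof -
  have "(\<Sum>p | p \<in> S \<and> p dvd d. ln (real p)) = (\<Sum>p | p \<in> S \<and> p dvd d. mangoldt p)"
    using assms(2) by (intro sum.cong) auto
  also have "\<dots> \<le> (\<Sum>p | p dvd d. mangoldt p)"
    using assms(3) by (intro sum_mono2) (auto simp: mangoldt_nonneg)
  also have "\<dots> = ln (real d)"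
    using assms(3) by (simp add: mangoldt_sum)
  finally show ?thesis .
qed

text \<open>Gallagher's observation: for \<open>a \<noteq> b\<close> the primes modulo which they
  agree divide a nonzero difference below \<open>x\<close>, so their logarithms sum to at most
  \<open>ln x\<close>. Only the diagonal pays the full sum over \<open>S\<close>.\<close>

lemma sum_ln_collisions_le:
  assumes A: "A \<subseteq> {a. 1 \<le> a \<and> real a \<le> x}" and finA: "finite A"
    and S: "finite S" "\<And>p. p \<in> S \<Longrightarrow> prime p" and x: "x \<ge> 1"
  shows "(\<Sum>p\<in>S. ln (real p) * collisions p A) \<le>
    real (card A) * (\<Sum>p\<in>S. ln (real p)) + (real (card A))\<^sup>2 * ln x"
proof -
  have ln_nonneg: "ln (real p) \<ge> 0" if "p \<in> S" for p
    using S(2)[OF that] prime_ge_1_nat by simp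
  have "(\<Sum>p\<in>S. ln (real p) * collisions p A) =
      (\<Sum>p\<in>S. \<Sum>a\<in>A. \<Sum>b\<in>A. if [a = b] (mod p) then ln (real p) else 0)"
  proof (intro sum.cong refl)
    fix p assume "p \<in> S"
    then have "p > 0"
      using S(2) prime_gt_0_nat by blast
    show "ln (real p) * collisions p A = (\<Sum>a\<in>A. \<Sum>b\<in>A. if [a = b] (mod p) then ln (real p) else 0)"
      unfolding collisions_altdef[OF finA \<open>p > 0\<close>] sum_distrib_left by (intro sum.cong) auto
  qed
  also have "\<dots> = (\<Sum>a\<in>A. \<Sum>b\<in>A. \<Sum>p\<in>S. if [a = b] (mod p) then ln (real p) else 0)"
    by (subst sum.swap, rule sum.cong[OF refl], rule sum.swap)
  also have "\<dots> \<le> (\<Sum>a\<in>A. \<Sum>b\<in>A. (if a = b then \<Sum>p\<in>S. ln (real p) else 0) + ln x)"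
  proof (intro sum_mono)
    fix a b assume ab: "a \<in> A" "b \<in> A"
    show "(\<Sum>p\<in>S. if [a = b] (mod p) then ln (real p) else 0) \<le> (if a = b then \<Sum>p\<in>S. ln (real p) else 0) + ln x"
    proof (cases "a = b")
      case False
      define d where "d = nat \<bar>int a - int b\<bar>"
      have "real a \<ge> 1" "real a \<le> x" "real b \<ge> 1" "real b \<le> x"
        using ab A by auto
      then have d: "d > 0" "real d \<le> x"
        using False by (simp_all add: d_def abs_le_iff)
      have "[a = b] (mod p) \<longleftrightarrow> p dvd d" for p
        unfolding d_def by (metis cong_iff_dvd_diff cong_int_iff dvd_nat_abs_iff)
      then have "(\<Sum>p\<in>S. if [a = b] (mod p) then ln (real p) else 0) = (\<Sum>p | p \<in> S \<and> p dvd d. ln (real p))"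
        using S(1) by (simp add: sum.If_cases Int_def)
      also have "\<dots> \<le> ln (real d)"
        by (intro sum_ln_prime_divisors_le S d)
      also have "\<dots> \<le> ln x"
        using d by simp
      finally show ?thesis
        using False by simp
    qed (use x in \<open>simp add: sum_nonneg\<close>)
  qed
  also have "\<dots> = real (card A) * (\<Sum>p\<in>S. ln (real p)) + (real (card A))\<^sup>2 * ln x"
    using finA by (simp add: sum.distrib power2_eq_square distrib_left mult.assoc)
  finally show ?thesis .
qed

text \<open>The weights \<open>ln p / sqrt p\<close> cancel the loss of \<open>sqrt p\<close> in the
  collision hypothesis. The factor 2 in the lower bound on their sum lets the off-diagonal term be
  absorbed into half of the left side.\<close>

lemma larger_sieve:
  assumes A: "A \<subseteq> {a. 1 \<le> a \<and> real a \<le> x}" and finA: "finite A"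
    and S: "finite S" "\<And>p. p \<in> S \<Longrightarrow> prime p" "\<And>p. p \<in> S \<Longrightarrow> sqrt (real p) \<le> Q"
    and K: "K > 0" and x: "x > 1"
    and coll: "\<And>p. p \<in> S \<Longrightarrow> (real (card A))\<^sup>2 \<le> K * sqrt (real p) * collisions p A"
    and T: "(\<Sum>p\<in>S. ln (real p) / sqrt (real p)) \<ge> 2 * K * ln x"
  shows "real (card A) \<le> 2 * K * Q"
proof (cases "card A = 0")
  case False
  define N where "N = real (card A)"
  have N: "N > 0"
    using False by (simp add: N_def)
  define T where "T = (\<Sum>p\<in>S. ln (real p) / sqrt (real p))"
  have T_pos: "T > 0" and T_ge: "2 * K * ln x \<le> T"
  proof -
    show "2 * K * ln x \<le> T"
      using T by (simp add: T_def)
    moreover have "2 * K * ln x > 0"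
      using K x by simp
    ultimately show "T > 0"
      by linarith
  qed
  have ln_nonneg: "ln (real p) \<ge> 0" and pos: "real p > 0" if "p \<in> S" for p
    using S(2)[OF that] prime_ge_1_nat[of p] by auto
  have "N\<^sup>2 * T = (\<Sum>p\<in>S. ln (real p) / sqrt (real p) * N\<^sup>2)"
    by (simp add: T_def sum_distrib_left mult_ac)
  also have "\<dots> \<le> (\<Sum>p\<in>S. ln (real p) / sqrt (real p) * (K * sqrt (real p) * collisions p A))"
    using coll ln_nonneg by (intro sum_mono mult_left_mono) (auto simp: N_def)
  also have "\<dots> = K * (\<Sum>p\<in>S. ln (real p) * collisions p A)"
    unfolding sum_distrib_left by (intro sum.cong) (use pos in auto)
  also have "\<dots> \<le> K * (N * (\<Sum>p\<in>S. ln (real p)) + N\<^sup>2 * ln x)"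
    unfolding N_def using K x by (intro mult_left_mono sum_ln_collisions_le A finA S) auto
  also have "(\<Sum>p\<in>S. ln (real p)) \<le> Q * T"
    unfolding T_def sum_distrib_left
  proof (intro sum_mono)
    fix p assume p: "p \<in> S"
    have "ln (real p) = sqrt (real p) * (ln (real p) / sqrt (real p))"
      using pos[OF p] by simp
    also have "\<dots> \<le> Q * (ln (real p) / sqrt (real p))"
      using S(3)[OF p] ln_nonneg[OF p] by (intro mult_right_mono) auto
    finally show "ln (real p) \<le> Q * (ln (real p) / sqrt (real p))" .
  qed
  finally have "N\<^sup>2 * T \<le> K * (N * (Q * T) + N\<^sup>2 * ln x)"
    using N K by simp
  also have "\<dots> = K * N * Q * T + N\<^sup>2 * (2 * K * ln x) / 2"
    by (simp add: algebra_simps)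
  also have "\<dots> \<le> K * N * Q * T + N\<^sup>2 * T / 2"
    using T_ge by (intro add_left_mono divide_right_mono mult_left_mono) auto
  finally have "N * T * N \<le> N * T * (2 * K * Q)"
    by (simp add: power2_eq_square algebra_simps)
  then show ?thesis
    using N T_pos by (simp add: N_def)
next
  case True
  have "S \<noteq> {}"
  proof
    assume "S = {}"
    then have "2 * K * ln x \<le> 0"
      using T by simp
    moreover have "2 * K * ln x > 0"
      using K x by simp
    ultimately show False
      by linarith
  qed
  then obtain p where "p \<in> S" by blast
  then have "Q \<ge> 0"
    using S(3)[of p] real_sqrt_ge_zero[of "real p"] by linarith
  then show ?thesis
    using True K by simp
qed

subsection \<open>Large exponents\<close>

text \<open>Multiplying a relation with three summands on each side by \<open>(T\<^sup>m)\<^sup>k\<close> for \<open>m < 4\<close>, where \<open>T\<close>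
  exceeds all six bases, and adding the results gives a relation with twelve distinct summands
  on each side.\<close>

lemma LPS_three_terms:
  fixes u v :: "nat \<Rightarrow> nat"
  assumes "LPS_special_case" "k \<ge> 25"
    and pos: "\<And>i. i < 3 \<Longrightarrow> u i \<ge> 1 \<and> v i \<ge> 1"
    and inj: "inj_on u {..<3}" "inj_on v {..<3}" and disj: "u ` {..<3} \<inter> v ` {..<3} = {}"
  shows "(\<Sum>i<3. u i ^ k) \<noteq> (\<Sum>i<3. v i ^ k)"
proof
  assume eq: "(\<Sum>i<3. u i ^ k) = (\<Sum>i<3. v i ^ k)"
  define T where "T = 1 + (\<Sum>i<3. u i) + (\<Sum>i<3. v i)"
  have uT: "u i < T" and vT: "v i < T" if "i < 3" for i
    using that member_le_sum[of i "{..<3}" u] member_le_sum[of i "{..<3}" v] by (auto simp: T_def)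
  \<comment> \<open>The products with exponent \<open>l\<close> lie between \<open>T ^ l\<close> and
    \<open>T ^ Suc l\<close>, the latter excluded, and these blocks are disjoint.\<close>
  have digits: "l = l' \<and> y = y'"
    if "T ^ l * y = T ^ l' * y'" "1 \<le> y" "y < T" "1 \<le> y'" "y' < T" for l l' y y'
    using that
  proof (induction l l' arbitrary: y y' rule: linorder_wlog)
    case (le l l')
    have T0: "T > 0"
      by (simp add: T_def)
    then have "y = T ^ (l' - l) * y'"
      using le by (metis le_add_diff_inverse mult.assoc mult_left_cancel power_add power_not_zero not_gr_zero)
    moreover have "l' - l = 0"
    proof (rule ccontr)
      assume "l' - l \<noteq> 0"
      then have "T ^ 1 * 1 \<le> T ^ (l' - l) * y'"
        using T0 le by (intro mult_le_mono power_increasing) auto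
      then show False
        using \<open>y = T ^ (l' - l) * y'\<close> le by simp
    qed
    ultimately show ?case
      using le by simp
  next
    case (sym l l')
    from sym.IH[of y' y] sym.prems show ?case
      by auto
  qed
  \<comment> \<open>Index \<open>i\<close> encodes a scaling and a term: after a shift to start at
    0, the quotient by 3 is the exponent of \<open>T\<close> and the remainder selects the
    term.\<close>
  define a b where "a = (\<lambda>i. T ^ ((i - 1) div 3) * u ((i - 1) mod 3))"
    and "b = (\<lambda>i. T ^ ((i - 1) div 3) * v ((i - 1) mod 3))"
  have lt3: "(i - 1) mod 3 < 3" for i :: nat
    by simp
  have T1: "T \<ge> 1"
    by (simp add: T_def)
  have index: "i = j" if "i \<in> {1..12}" "j \<in> {1..12}" "(i - 1) div 3 = (j - 1) div 3" "(i - 1) mod 3 = (j - 1) mod 3"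
    for i j :: nat
  proof -
    have "i - 1 = j - 1"
      using that(3,4) by (metis div_mult_mod_eq)
    then show ?thesis
      using that(1,2) by auto
  qed
  have "inj_on a {1..12}"
  proof (rule inj_onI)
    fix i j assume ij: "i \<in> {1..12}" "j \<in> {1..12}" "a i = a j"
    then have "(i - 1) div 3 = (j - 1) div 3 \<and> u ((i - 1) mod 3) = u ((j - 1) mod 3)"
      unfolding a_def by (intro digits) (use pos uT lt3 in auto)
    moreover from this have "(i - 1) mod 3 = (j - 1) mod 3"
      using inj_onD[OF inj(1), of "(i - 1) mod 3" "(j - 1) mod 3"] lt3 by simp
    ultimately show "i = j"
      using index[OF ij(1,2)] by blast
  qed
  moreover have "inj_on b {1..12}"
  proof (rule inj_onI)
    fix i j assume ij: "i \<in> {1..12}" "j \<in> {1..12}" "b i = b j"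
    then have "(i - 1) div 3 = (j - 1) div 3 \<and> v ((i - 1) mod 3) = v ((j - 1) mod 3)"
      unfolding b_def by (intro digits) (use pos vT lt3 in auto)
    moreover from this have "(i - 1) mod 3 = (j - 1) mod 3"
      using inj_onD[OF inj(2), of "(i - 1) mod 3" "(j - 1) mod 3"] lt3 by simp
    ultimately show "i = j"
      using index[OF ij(1,2)] by blast
  qed
  moreover have "a ` {1..12} \<inter> b ` {1..12} = {}"
  proof -
    have "a i \<noteq> b j" for i j
    proof
      assume "a i = b j"
      then have "(i - 1) div 3 = (j - 1) div 3 \<and> u ((i - 1) mod 3) = v ((j - 1) mod 3)"
        unfolding a_def b_def by (intro digits) (use pos uT vT lt3 in auto)
      moreover have "u ((i - 1) mod 3) \<in> u ` {..<3}" "v ((j - 1) mod 3) \<in> v ` {..<3}"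
        by auto
      ultimately show False
        using disj by (metis disjoint_iff)
    qed
    then show ?thesis by blast
  qed
  moreover have "\<forall>i\<in>{1..12}. a i \<ge> 1 \<and> b i \<ge> 1"
    using pos lt3 T1 by (auto simp: a_def b_def Suc_le_eq)
  moreover have "(\<Sum>i=1..12. a i ^ k) = (\<Sum>i=1..12. b i ^ k)"
  proof -
    have split: "(\<Sum>i=1..12. (T ^ ((i - 1) div 3) * f ((i - 1) mod 3)) ^ k) = (\<Sum>l<4. (T ^ l) ^ k) * (\<Sum>i<3. f i ^ k)"
      for f :: "nat \<Rightarrow> nat"
    proof -
      have "{1..12::nat} = {1,2,3,4,5,6,7,8,9,10,11,12}" "{..<4::nat} = {0,1,2,3}" "{..<3::nat} = {0,1,2}"
        by (simp_all only: set_eq_iff atLeastAtMost_iff lessThan_iff insert_iff empty_iff) presburger+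
      then show ?thesis
        by (simp add: power_mult_distrib algebra_simps power3_eq_cube numeral_2_eq_2)
    qed
    show ?thesis
      unfolding a_def b_def split eq ..
  qed
  ultimately show False
    using assms(1,2) unfolding LPS_special_case_def by blast
qed

text \<open>The equality of the two sums expresses that the points \<open>(x\<^sub>i\<^sup>k, y\<^sub>i\<^sup>k)\<close> lie on a line, that is,
  the vanishing of the \<open>3 \<times> 3\<close> determinant with rows \<open>(x\<^sub>i\<^sup>k, y\<^sub>i\<^sup>k, 1)\<close>. The assumptions
  exclude coincidences between summands on the same side; coincidences across
  the sides never occur.\<close>

lemma three_collinear_powers:
  fixes x y :: "nat \<Rightarrow> nat" and a a' :: nat and b :: "nat \<Rightarrow> nat" and n :: int
  assumes LPS: "LPS_special_case" and k: "k \<ge> 25" and n: "n \<noteq> 0" and aa': "a \<noteq> a'"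
    and pos: "\<And>i. i < 3 \<Longrightarrow> x i \<ge> 1 \<and> y i \<ge> 1" and a: "a \<ge> 1" "a' \<ge> 1"
    and X: "\<And>i. i < 3 \<Longrightarrow> int a * int (b i) + n = int (x i ^ k)"
    and Y: "\<And>i. i < 3 \<Longrightarrow> int a' * int (b i) + n = int (y i ^ k)"
    and b: "b 0 \<noteq> b 1" "b 0 \<noteq> b 2" "b 1 \<noteq> b 2"
    and ne1: "x 0 * y 1 \<noteq> x 1 * y 2" "x 1 * y 2 \<noteq> x 2 * y 0" "x 2 * y 0 \<noteq> x 0 * y 1"
    and ne2: "x 1 * y 0 \<noteq> x 2 * y 1" "x 2 * y 1 \<noteq> x 0 * y 2" "x 0 * y 2 \<noteq> x 1 * y 0"
  shows False
proof -
  define u where "u = (\<lambda>i::nat. if i = 0 then x 0 * y 1 else if i = 1 then x 1 * y 2 else x 2 * y 0)"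
  define v where "v = (\<lambda>i::nat. if i = 0 then x 1 * y 0 else if i = 1 then x 2 * y 1 else x 0 * y 2)"
  have set3: "{..<3::nat} = {0, 1, 2}"
    by auto
  have k0: "k > 0"
    using k by simp
  have x_ne: "x i \<noteq> x j" if "i < 3" "j < 3" "b i \<noteq> b j" for i j
  proof
    assume "x i = x j"
    then have "int a * int (b i) + n = int a * int (b j) + n"
      using X[OF that(1)] X[OF that(2)] by metis
    then show False
      using that(3) a by auto
  qed
  have y_ne: "y i \<noteq> y j" if "i < 3" "j < 3" "b i \<noteq> b j" for i j
  proof
    assume "y i = y j"
    then have "int a' * int (b i) + n = int a' * int (b j) + n"
      using Y[OF that(1)] Y[OF that(2)] by metis
    then show False
      using that(3) a by auto
  qed
  have cross: "x i * y j \<noteq> x j * y i" if "i < 3" "j < 3" "b i \<noteq> b j" for i j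
  proof
    assume "x i * y j = x j * y i"
    then have "int (x i ^ k) * int (y j ^ k) = int (x j ^ k) * int (y i ^ k)"
      by (metis of_nat_mult power_mult_distrib)
    then have "(int a * int (b i) + n) * (int a' * int (b j) + n) = (int a * int (b j) + n) * (int a' * int (b i) + n)"
      using X Y that by metis
    then have "n * (int a - int a') * (int (b i) - int (b j)) = 0"
      by (simp add: algebra_simps)
    then show False
      using n aa' that by simp
  qed
  have xy0: "x i \<noteq> 0" "y i \<noteq> 0" if "i < 3" for i
    using pos[OF that] by auto
  have "(\<Sum>i<3. u i ^ k) \<noteq> (\<Sum>i<3. v i ^ k)"
  proof (rule LPS_three_terms[OF LPS k])
    show "u i \<ge> 1 \<and> v i \<ge> 1" if "i < 3" for i
      using pos[of 0] pos[of 1] pos[of 2] by (auto simp: u_def v_def Suc_le_eq)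
    show "inj_on u {..<3}" "inj_on v {..<3}"
      using ne1 ne2 unfolding set3 inj_on_def u_def v_def by (auto simp: eq_commute)
    \<comment> \<open>Of the nine comparisons across the sides, three are of the type
      \<open>cross\<close>, three share a factor \<open>y\<close> and three share a factor
      \<open>x\<close>.\<close>
    have "x 0 * y 1 \<noteq> x 1 * y 0" "x 1 * y 2 \<noteq> x 2 * y 1" "x 2 * y 0 \<noteq> x 0 * y 2"
      using cross b by auto
    moreover have "x 0 * y 1 \<noteq> x 2 * y 1" "x 1 * y 2 \<noteq> x 0 * y 2" "x 2 * y 0 \<noteq> x 1 * y 0"
      using x_ne[of 0 2] x_ne[of 1 0] x_ne[of 2 1] b xy0 by auto
    moreover have "x 0 * y 1 \<noteq> x 0 * y 2" "x 1 * y 2 \<noteq> x 1 * y 0" "x 2 * y 0 \<noteq> x 2 * y 1"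
      using y_ne[of 1 2] y_ne[of 2 0] y_ne[of 0 1] b xy0 by auto
    ultimately show "u ` {..<3} \<inter> v ` {..<3} = {}"
      unfolding set3 u_def v_def by auto
  qed
  moreover have "int (\<Sum>i<3. u i ^ k) = int (\<Sum>i<3. v i ^ k)"
  proof -
    have "int (\<Sum>i<3. u i ^ k) = int (x 0 ^ k) * int (y 1 ^ k) + int (x 1 ^ k) * int (y 2 ^ k) + int (x 2 ^ k) * int (y 0 ^ k)"
      by (simp add: set3 u_def power_mult_distrib)
    also have "\<dots> = int (x 1 ^ k) * int (y 0 ^ k) + int (x 2 ^ k) * int (y 1 ^ k) + int (x 0 ^ k) * int (y 2 ^ k)"
    proof -
      have "int (x 0 ^ k) = int a * int (b 0) + n" "int (x 1 ^ k) = int a * int (b 1) + n"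
        "int (x 2 ^ k) = int a * int (b 2) + n" "int (y 0 ^ k) = int a' * int (b 0) + n"
        "int (y 1 ^ k) = int a' * int (b 1) + n" "int (y 2 ^ k) = int a' * int (b 2) + n"
        using X Y by auto
      then show ?thesis
        by (simp only:) (simp add: algebra_simps)
    qed
    also have "\<dots> = int (\<Sum>i<3. v i ^ k)"
      by (simp add: set3 v_def power_mult_distrib)
    finally show ?thesis .
  qed
  ultimately show False
    by (simp only: of_nat_eq_iff)
qed

section \<open>Pairs with a fixed large exponent\<close>

definition power_pairs :: "nat \<Rightarrow> int \<Rightarrow> nat set \<Rightarrow> (nat \<times> nat) set" where
  "power_pairs k n A = {(a, b) \<in> A \<times> A. \<exists>z\<ge>1. int a * int b + n = int (z ^ k)}"

text \<open>Fix two common partners \<open>b1\<close> and \<open>b2\<close>. Each of the six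
  coincidences that \<open>three_collinear_powers\<close> excludes holds for at most one third
  partner, so 2 + 6 elements are ruled out and a ninth would contradict the conjecture.\<close>

lemma codegree_le_8:
  assumes LPS: "LPS_special_case" and k: "k \<ge> 25" and n: "n \<noteq> 0" and aa': "a \<noteq> a'"
    and A: "finite A" "\<And>a. a \<in> A \<Longrightarrow> a \<ge> 1" "a \<in> A" "a' \<in> A"
  shows "card {b \<in> A. (a, b) \<in> power_pairs k n A \<and> (a', b) \<in> power_pairs k n A} \<le> 8"
proof (rule ccontr)
  define C where "C = {b \<in> A. (a, b) \<in> power_pairs k n A \<and> (a', b) \<in> power_pairs k n A}"
  assume "\<not> ?thesis"
  then have C: "card C \<ge> 9" "finite C"
    using A(1) by (auto simp: C_def)
  have "\<forall>b\<in>C. \<exists>z. z \<ge> 1 \<and> int a * int b + n = int (z ^ k)"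
    unfolding C_def power_pairs_def by blast
  then obtain x where x: "\<And>b. b \<in> C \<Longrightarrow> x b \<ge> 1" "\<And>b. b \<in> C \<Longrightarrow> int a * int b + n = int (x b ^ k)"
    by metis
  have "\<forall>b\<in>C. \<exists>z. z \<ge> 1 \<and> int a' * int b + n = int (z ^ k)"
    unfolding C_def power_pairs_def by blast
  then obtain y where y: "\<And>b. b \<in> C \<Longrightarrow> y b \<ge> 1" "\<And>b. b \<in> C \<Longrightarrow> int a' * int b + n = int (y b ^ k)"
    by metis
  have a: "a \<ge> 1" "a' \<ge> 1"
    using A by auto
  have x_inj: "b = c" if "b \<in> C" "c \<in> C" "x b = x c" for b c
  proof -
    have "int a * int b + n = int a * int c + n"
      using x(2)[OF that(1)] x(2)[OF that(2)] that(3) by metis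
    then show ?thesis
      using a by auto
  qed
  have y_inj: "b = c" if "b \<in> C" "c \<in> C" "y b = y c" for b c
  proof -
    have "int a' * int b + n = int a' * int c + n"
      using y(2)[OF that(1)] y(2)[OF that(2)] that(3) by metis
    then show ?thesis
      using a by auto
  qed
  \<comment> \<open>The ratio of \<open>y b\<close> to \<open>x b\<close> determines
    \<open>b\<close>: its \<open>k\<close>-th power is a fractional linear function of
    \<open>b\<close> with nonzero determinant \<open>n * (a' - a)\<close>.\<close>
  have ratio_inj: "b = c" if bc: "b \<in> C" "c \<in> C" and uv: "u * y b = v * x b" "u * y c = v * x c" "u \<ge> 1" "v \<ge> 1" for b c u v
  proof -
    have "(u * v) * (y b * x c) = (u * y b) * (v * x c)"
      by (simp add: mult_ac)
    also have "\<dots> = (v * x b) * (u * y c)"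
      using uv by simp
    also have "\<dots> = (u * v) * (y c * x b)"
      by (simp add: mult_ac)
    finally have "y b * x c = y c * x b"
      using uv by simp
    then have "int (y b ^ k) * int (x c ^ k) = int (y c ^ k) * int (x b ^ k)"
      by (metis of_nat_mult power_mult_distrib)
    then have "(int a' * int b + n) * (int a * int c + n) = (int a' * int c + n) * (int a * int b + n)"
      using x(2) y(2) bc by metis
    then have "n * (int a' - int a) * (int b - int c) = 0"
      by (simp add: algebra_simps)
    then show ?thesis
      using n aa' by simp
  qed
  have "C \<noteq> {}"
    using C by auto
  then obtain b1 where b1: "b1 \<in> C"
    by blast
  have "C - {b1} \<noteq> {}"
    using C b1 card_Diff_singleton[of b1 C] by (intro notI) simp
  then obtain b2 where b2: "b2 \<in> C" "b2 \<noteq> b1"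
    by blast
  \<comment> \<open>The negations of \<open>ne1\<close> and \<open>ne2\<close> in
    \<open>three_collinear_powers\<close>, in order, with \<open>b\<close> as the third
    point.\<close>
  define bad where "bad = (\<lambda>i::nat. {b \<in> C. (if i = 0 then x b1 * y b2 = x b2 * y b
     else if i = 1 then x b2 * y b = y b1 * x b
     else if i = 2 then x b * y b1 = x b1 * y b2
     else if i = 3 then x b2 * y b1 = x b * y b2
     else if i = 4 then x b1 * y b = y b2 * x b
     else x b1 * y b = x b2 * y b1)})"
  have pos: "x b1 \<ge> 1" "x b2 \<ge> 1" "y b1 \<ge> 1" "y b2 \<ge> 1"
    using x(1) y(1) b1 b2 by auto
  have card_bad: "card (bad i) \<le> 1" for i
  proof -
    have "b = c" if "b \<in> bad i" "c \<in> bad i" for b c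
    proof -
      have bc: "b \<in> C" "c \<in> C"
        using that by (auto simp: bad_def)
      consider "i = 0" | "i = 1" | "i = 2" | "i = 3" | "i = 4" | "i \<ge> 5"
        by linarith
      then show ?thesis
      proof cases
        case 1
        then have "x b2 * y b = x b2 * y c"
          using that by (simp add: bad_def)
        then show ?thesis using y_inj[OF bc] pos by simp
      next
        case 2
        then show ?thesis
          using that ratio_inj[OF bc, of "x b2" "y b1"] pos by (simp add: bad_def)
      next
        case 3
        then have "x b * y b1 = x c * y b1"
          using that by (simp add: bad_def)
        then show ?thesis using x_inj[OF bc] pos by simp
      next
        case 4
        then have "x b * y b2 = x c * y b2"
          using that by (simp add: bad_def)
        then show ?thesis using x_inj[OF bc] pos by simp
      next
        case 5
        then show ?thesis
          using that ratio_inj[OF bc, of "x b1" "y b2"] pos by (simp add: bad_def)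
      next
        case 6
        then have "x b1 * y b = x b1 * y c"
          using that by (simp add: bad_def)
        then show ?thesis using y_inj[OF bc] pos by simp
      qed
    qed
    moreover have "finite (bad i)"
      using C(2) by (simp add: bad_def)
    ultimately show ?thesis
      by (simp add: card_le_Suc0_iff_eq)
  qed
  have "card (\<Union>i<6. bad i) \<le> (\<Sum>i<6. card (bad i))"
    by (rule card_UN_le) simp
  also have "\<dots> \<le> (\<Sum>i<(6::nat). 1)"
    by (intro sum_mono card_bad)
  finally have "card (\<Union>i<6. bad i) \<le> 6"
    by simp
  then have "card ({b1, b2} \<union> (\<Union>i<6. bad i)) < card C"
    using card_Un_le[of "{b1, b2}" "\<Union>i<6. bad i"] C b2 by simp
  then have "\<not> C \<subseteq> {b1, b2} \<union> (\<Union>i<6. bad i)"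
  proof (intro notI)
    assume lt: "card ({b1, b2} \<union> (\<Union>i<6. bad i)) < card C" and sub: "C \<subseteq> {b1, b2} \<union> (\<Union>i<6. bad i)"
    have "finite ({b1, b2} \<union> (\<Union>i<6. bad i))"
      using C(2) by (auto simp: bad_def)
    then show False
      using card_mono[OF _ sub] lt by linarith
  qed
  then obtain b3 where b3: "b3 \<in> C" "b3 \<noteq> b1" "b3 \<noteq> b2" "\<And>i. i < 6 \<Longrightarrow> b3 \<notin> bad i"
    by blast
  define \<beta> where "\<beta> = (\<lambda>i::nat. if i = 0 then b1 else if i = 1 then b2 else b3)"
  have \<beta>C: "\<beta> i \<in> C" for i
    using b1 b2 b3 by (simp add: \<beta>_def)
  have ne: "x b1 * y b2 \<noteq> x b2 * y b3" "x b2 * y b3 \<noteq> x b3 * y b1" "x b3 * y b1 \<noteq> x b1 * y b2"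
    "x b2 * y b1 \<noteq> x b3 * y b2" "x b3 * y b2 \<noteq> x b1 * y b3" "x b1 * y b3 \<noteq> x b2 * y b1"
    using b3(4)[of 0] b3(4)[of 1] b3(4)[of 2] b3(4)[of 3] b3(4)[of 4] b3(4)[of 5] b3(1)
    by (simp_all add: bad_def mult.commute)
  show False
    by (rule three_collinear_powers[OF LPS k n aa', of "\<lambda>i. x (\<beta> i)" "\<lambda>i. y (\<beta> i)" \<beta>])
       (use x y \<beta>C a ne b2 b3 in \<open>auto simp: \<beta>_def\<close>)
qed

text \<open>The Kovari-Sos-Turan count: by Cauchy-Schwarz the squared number of pairs is at most
  \<open>N\<close> times the sum of all codegrees. Diagonal codegrees are at most \<open>N\<close>
  and the others at most 8, which gives \<open>9 * N\<^sup>2\<close>.\<close>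

lemma card_power_pairs_le:
  assumes LPS: "LPS_special_case" and k: "k \<ge> 25" and n: "n \<noteq> 0"
    and A: "finite A" "\<And>a. a \<in> A \<Longrightarrow> a \<ge> 1"
  shows "real (card (power_pairs k n A)) \<le> 3 * real (card A) * sqrt (real (card A))"
proof -
  define N where "N = real (card A)"
  define e :: "nat \<Rightarrow> nat \<Rightarrow> real" where "e = (\<lambda>a b. if (a, b) \<in> power_pairs k n A then 1 else 0)"
  have "power_pairs k n A \<subseteq> A \<times> A"
    by (auto simp: power_pairs_def)
  then have "real (card (power_pairs k n A)) = (\<Sum>x\<in>A \<times> A. if x \<in> power_pairs k n A then 1 else 0)"
    using A(1) by (simp add: sum.If_cases Int_absorb1)
  also have "\<dots> = (\<Sum>a\<in>A. \<Sum>b\<in>A. e a b)"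
    by (simp add: sum.cartesian_product e_def case_prod_unfold)
  also have "\<dots> = (\<Sum>b\<in>A. 1 * (\<Sum>a\<in>A. e a b))"
    by (simp add: sum.swap[of e])
  finally have "(real (card (power_pairs k n A)))\<^sup>2 = (\<Sum>b\<in>A. 1 * (\<Sum>a\<in>A. e a b))\<^sup>2"
    by simp
  also have "\<dots> \<le> (\<Sum>b\<in>A. 1\<^sup>2) * (\<Sum>b\<in>A. (\<Sum>a\<in>A. e a b)\<^sup>2)"
    by (rule Cauchy_Schwarz_ineq_sum)
  also have "(\<Sum>b\<in>A. (\<Sum>a\<in>A. e a b)\<^sup>2) = (\<Sum>b\<in>A. \<Sum>a\<in>A. \<Sum>a'\<in>A. e a b * e a' b)"
    by (simp add: power2_eq_square sum_product)
  also have "\<dots> = (\<Sum>a\<in>A. \<Sum>a'\<in>A. \<Sum>b\<in>A. e a b * e a' b)"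
    by (subst sum.swap, rule sum.cong[OF refl], rule sum.swap)
  also have "\<dots> \<le> (\<Sum>a\<in>A. \<Sum>a'\<in>A. (if a = a' then N else 0) + 8)"
  proof (intro sum_mono)
    fix a a' assume a: "a \<in> A" "a' \<in> A"
    have "(\<Sum>b\<in>A. e a b * e a' b) = (\<Sum>b\<in>A. if (a, b) \<in> power_pairs k n A \<and> (a', b) \<in> power_pairs k n A then 1 else 0)"
      by (intro sum.cong) (auto simp: e_def)
    also have "\<dots> = real (card {b \<in> A. (a, b) \<in> power_pairs k n A \<and> (a', b) \<in> power_pairs k n A})"
      using A(1) by (simp add: sum.If_cases Int_def)
    also have "\<dots> \<le> (if a = a' then N else 0) + 8"
    proof (cases "a = a'")
      case True
      have "card {b \<in> A. (a, b) \<in> power_pairs k n A \<and> (a', b) \<in> power_pairs k n A} \<le> card A"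
        using A(1) by (intro card_mono) auto
      then show ?thesis
        using True by (simp add: N_def)
    next
      case False
      then show ?thesis
        using codegree_le_8[OF LPS k n False A a] by simp
    qed
    finally show "(\<Sum>b\<in>A. e a b * e a' b) \<le> (if a = a' then N else 0) + 8" .
  qed
  also have "\<dots> = 9 * N\<^sup>2"
    using A(1) by (simp add: sum.distrib N_def power2_eq_square)
  finally have "(real (card (power_pairs k n A)))\<^sup>2 \<le> (\<Sum>b\<in>A. 1\<^sup>2) * (9 * N\<^sup>2)"
    by this (rule mult_left_mono, auto)
  also have "\<dots> = N * (9 * N\<^sup>2)"
    by (simp add: N_def)
  also have "\<dots> = (3 * N * sqrt N)\<^sup>2"
    by (simp add: N_def power_mult_distrib power2_eq_square)
  finally show ?thesis
    unfolding N_def[symmetric] by (rule power2_le_imp_le) (simp add: N_def)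
qed

text \<open>Every exponent from 2 to 24 has a prime factor below 25, the threshold of
  \<open>LPS_special_case\<close>. Taking each prime once keeps the modulus squarefree, as
  \<open>mertens_class_one\<close> demands.\<close>

definition small_primes_product :: nat where
  "small_primes_product = \<Prod>{p. prime p \<and> p < 25}"

lemma finite_small_primes: "finite {p::nat. prime p \<and> p < 25}"
  by (rule finite_subset[of _ "{..<25}"]) auto

lemma squarefree_small_primes_product: "squarefree small_primes_product"
  unfolding small_primes_product_def
  by (intro squarefree_prod_coprime) (auto intro: primes_coprime squarefree_prime)

lemma small_primes_product_gt_1: "small_primes_product > 1"
proof -
  have "2 dvd small_primes_product"
    unfolding small_primes_product_def by (intro dvd_prodI finite_small_primes) auto
  moreover have "small_primes_product > 0"
    unfolding small_primes_product_def by (intro prod_pos) (auto intro: prime_gt_0_nat)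
  ultimately show ?thesis
    by (auto dest: dvd_imp_le)
qed

lemma not_coprime_small_primes_product:
  assumes "2 \<le> k" "k < 25"
  shows "\<not> coprime k small_primes_product"
proof -
  obtain q where q: "prime q" "q dvd k"
    using assms prime_factor_nat[of k] by auto
  then have "q < 25"
    using assms dvd_imp_le[of q k] by simp
  then have "q dvd small_primes_product"
    unfolding small_primes_product_def using q by (intro dvd_prodI finite_small_primes) auto
  then show ?thesis
    using q not_coprimeI[of q k] not_prime_unit by blast
qed

text \<open>Beyond \<open>Y\<close> the weight \<open>1 / sqrt p\<close> exceeds
  \<open>1 / p\<close> by a factor of at least \<open>sqrt Y\<close>. The primes dividing
  \<open>n\<close>, for which the character bounds fail, cost at most
  \<open>ln \<bar>n\<bar>\<close>.\<close>

lemma sum_ln_over_sqrt_ge: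
  assumes S: "S = {p. p \<in> {1..Y\<^sup>2} \<and> prime p \<and> [p = 1] (mod m)}" and Y: "Y \<ge> 1" and n: "n \<noteq> 0"
    and G: "(\<Sum>p | p \<in> S \<and> p > Y. ln (real p) / real p) \<ge> 2"
  shows "(\<Sum>p | p \<in> S \<and> p > Y \<and> \<not> int p dvd n. ln (real p) / sqrt (real p)) \<ge> 2 * sqrt (real Y) - ln (real_of_int \<bar>n\<bar>)"
proof -
  have finS: "finite S"
    by (simp add: S)
  have prime: "prime p" if "p \<in> S" for p
    using that by (simp add: S)
  have ln_nonneg: "ln (real p) \<ge> 0" and pos: "real p > 0" if "p \<in> S" for p
    using prime[OF that] prime_ge_1_nat[of p] by auto
  have "sqrt (real Y) * 2 \<le> sqrt (real Y) * (\<Sum>p | p \<in> S \<and> p > Y. ln (real p) / real p)"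
    using G by (intro mult_left_mono) auto
  also have "\<dots> \<le> (\<Sum>p | p \<in> S \<and> p > Y. ln (real p) / sqrt (real p))"
    unfolding sum_distrib_left
  proof (intro sum_mono)
    fix p assume p: "p \<in> {p. p \<in> S \<and> p > Y}"
    have "sqrt (real Y) * (ln (real p) / real p) \<le> sqrt (real p) * (ln (real p) / real p)"
      using p ln_nonneg by (intro mult_right_mono) auto
    also have "\<dots> = ln (real p) / sqrt (real p)"
      using p pos[of p] by (simp add: field_simps)
    finally show "sqrt (real Y) * (ln (real p) / real p) \<le> ln (real p) / sqrt (real p)" .
  qed
  also have "\<dots> = (\<Sum>p | p \<in> S \<and> p > Y \<and> \<not> int p dvd n. ln (real p) / sqrt (real p)) +
      (\<Sum>p | p \<in> S \<and> p > Y \<and> int p dvd n. ln (real p) / sqrt (real p))"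
    using finS by (subst sum.union_disjoint[symmetric]) (auto intro!: sum.cong)
  also have "(\<Sum>p | p \<in> S \<and> p > Y \<and> int p dvd n. ln (real p) / sqrt (real p)) \<le>
      (\<Sum>p | p \<in> S \<and> p > Y \<and> int p dvd n. ln (real p))"
  proof (intro sum_mono)
    fix p assume p: "p \<in> {p. p \<in> S \<and> p > Y \<and> int p dvd n}"
    then have "sqrt (real p) \<ge> 1"
      using pos[of p] by simp
    then show "ln (real p) / sqrt (real p) \<le> ln (real p)"
      using ln_nonneg[of p] p mult_left_mono[of 1 "sqrt (real p)" "ln (real p)"] by (simp add: field_simps)
  qed
  also have "\<dots> \<le> (\<Sum>p | p \<in> S \<and> p dvd nat \<bar>n\<bar>. ln (real p))"
    using finS ln_nonneg by (intro sum_mono2) auto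
  also have "\<dots> \<le> ln (real (nat \<bar>n\<bar>))"
    using n by (intro sum_ln_prime_divisors_le finS prime) auto
  finally show ?thesis
    by simp
qed

subsection \<open>The main estimate\<close>

lemma card_property_D_le:
  fixes c B :: real and n :: int
  defines "P \<equiv> small_primes_product"
  assumes LPS: "LPS_special_case" and c: "c > 0"
    and B: "\<And>N. N \<ge> 1 \<Longrightarrow>
      \<bar>c * (\<Sum>p | p \<in> {1..N} \<and> prime p \<and> [p = 1] (mod P). ln (real p) / real p) - ln (real N)\<bar> \<le> B"
    and x1: "x > 1" and x: "ln x \<ge> 1" "ln x \<ge> exp (2 * B + 2 * c)"
    and n: "1 \<le> \<bar>n\<bar>" "real_of_int \<bar>n\<bar> \<le> x"
    and A: "A \<subseteq> {a. 1 \<le> a \<and> real a \<le> x}" "has_property_D n A"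
  shows "real (card A) \<le> 3600 * real P ^ 3 * (ln x)\<^sup>2"
proof (rule ccontr)
  define L where "L = ln x"
  define N where "N = real (card A)"
  assume "\<not> ?thesis"
  then have N_gt: "N > 3600 * real P ^ 3 * L\<^sup>2"
    by (simp add: N_def L_def)
  have L: "L \<ge> 1"
    using x by (simp add: L_def)
  have finA: "finite A"
    by (rule finite_subset[of _ "{..nat \<lfloor>x\<rfloor>}"]) (use A(1) in \<open>auto simp: le_nat_floor\<close>)
  have P: "P > 1"
    unfolding P_def by (rule small_primes_product_gt_1)
  then have P1: "real P \<ge> 1"
    by simp
  have n0: "n \<noteq> 0"
    using n by auto
  \<comment> \<open>For a base \<open>z \<ge> 2\<close> one has
    \<open>2 ^ k \<le> 2 * x\<^sup>2\<close>, and \<open>ln 2 \<ge> 1 / 2\<close> turns this into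
    \<open>k \<le> 1 + 4 * L\<close>.\<close>
  define K where "K = nat \<lfloor>1 + 4 * L\<rfloor>"
  have K: "real K \<le> 5 * L"
  proof -
    have "real K \<le> 1 + 4 * L"
      unfolding K_def using L by (intro of_nat_floor) simp
    then show ?thesis
      using L by linarith
  qed
  \<comment> \<open>The exceptional pairs: the diagonal, about which \<open>has_property_D\<close>
    says nothing, and the pairs with a large exponent.\<close>
  define D where "D = (\<lambda>a. (a, a)) ` A \<union> (\<Union>k\<in>{25..K}. power_pairs k n A)"
  have D_sub: "D \<subseteq> A \<times> A"
    by (auto simp: D_def power_pairs_def)
  have good: "\<exists>z k. int a * int b + n = z ^ k \<and> k > 0 \<and> \<not> coprime k P"
    if ab: "a \<in> A" "b \<in> A" "(a, b) \<notin> D" for a b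
  proof -
    have "a \<noteq> b"
      using ab by (auto simp: D_def)
    then have "int a * int b + n \<in> V\<^sub>\<infinity>"
      using A(2) ab by (simp add: has_property_D_def)
    then obtain z k where zk: "int a * int b + n = int (z ^ k)" "z \<ge> 1" "k \<ge> 2"
      by (auto simp: perfect_powers_def)
    show ?thesis
    proof (cases "k < 25")
      case True
      then show ?thesis
        using zk not_coprime_small_primes_product[of k]
        by (intro exI[of _ "int z"] exI[of _ k]) (auto simp: P_def)
    next
      case False
      \<comment> \<open>The base 1 escapes the bound on \<open>k\<close>, but the value 1 is also a
        square, so the exponent 2 serves.\<close>
      have "z = 1"
      proof (rule ccontr)
        assume "z \<noteq> 1"
        then have z2: "z \<ge> 2"
          using zk by simp
        have "real_of_int (int a * int b + n) \<le> x * x + x"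
        proof -
          have "real a * real b \<le> x * x"
            using A(1) ab x1 by (intro mult_mono) auto
          moreover have "real_of_int n \<le> x"
            using n(2) by linarith
          ultimately show ?thesis
            by simp
        qed
        also have "\<dots> \<le> 2 * x\<^sup>2"
          using x1 by (simp add: power2_eq_square)
        finally have "2 ^ k \<le> 2 * x\<^sup>2"
          unfolding zk(1) using power_mono[of 2 "real z" k] z2 by simp
        then have "ln (2 ^ k) \<le> ln (2 * x\<^sup>2)"
          using x1 by (subst ln_le_cancel_iff) auto
        then have *: "real k * ln 2 \<le> ln 2 + 2 * L"
          using x1 by (simp add: ln_mult ln_realpow L_def)
        have "1 / 2 \<le> ln (2 :: real)"
          using exp_half_le2 by (subst ln_ge_iff) auto
        then have "(real k - 1) * (1 / 2) \<le> (real k - 1) * ln 2"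
          using zk(3) by (intro mult_left_mono) auto
        also have "\<dots> = real k * ln 2 - ln 2"
          by (simp add: left_diff_distrib)
        also have "\<dots> \<le> 2 * L"
          using * by (simp only: diff_le_eq add.commute)
        finally have "real k \<le> 1 + 4 * L"
          by simp
        then have "k \<le> K"
          unfolding K_def by (rule le_nat_floor)
        then have "(a, b) \<in> D"
          using ab zk False by (auto simp: D_def power_pairs_def)
        then show False
          using ab by simp
      qed
      then show ?thesis
        using zk not_coprime_small_primes_product[of 2]
        by (intro exI[of _ 1] exI[of _ 2]) (auto simp: P_def)
    qed
  qed
  have N0: "N \<ge> 0"
    by (simp add: N_def)
  have card_D: "real P * real (card D) \<le> N\<^sup>2 / 2"
  proof -
    have "card D \<le> card ((\<lambda>a. (a, a)) ` A) + card (\<Union>k\<in>{25..K}. power_pairs k n A)"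
      unfolding D_def by (rule card_Un_le)
    also have "card ((\<lambda>a. (a, a)) ` A) = card A"
      by (simp add: card_image inj_on_def)
    also have "card (\<Union>k\<in>{25..K}. power_pairs k n A) \<le> (\<Sum>k=25..K. card (power_pairs k n A))"
      by (rule card_UN_le) simp
    finally have "real (card D) \<le> N + real (\<Sum>k=25..K. card (power_pairs k n A))"
      unfolding N_def of_nat_add[symmetric] of_nat_le_iff by this auto
    also have "real (\<Sum>k=25..K. card (power_pairs k n A)) \<le> (\<Sum>k=25..K. 3 * N * sqrt N)"
      unfolding of_nat_sum N_def
      using A(1) by (intro sum_mono card_power_pairs_le LPS n0 finA) auto
    also have "\<dots> \<le> real K * (3 * N * sqrt N)"
      using N0 by (simp add: mult_right_mono)
    also have "\<dots> \<le> 5 * L * (3 * N * sqrt N)"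
      using K N0 by (intro mult_right_mono) auto
    finally have card_D: "real (card D) \<le> N + 15 * L * N * sqrt N"
      by simp
    \<comment> \<open>The constant 3600 is \<open>60\<^sup>2\<close>: once
      \<open>sqrt N \<ge> 60 * P * L\<close>, the at most \<open>15 * L * N * sqrt N\<close> pairs
      with large exponents take no more than \<open>N\<^sup>2 / (4 * P)\<close>, and the diagonal
      fits into as much again.\<close>
    have "(60 * real P * L)\<^sup>2 \<le> 3600 * real P ^ 3 * L\<^sup>2"
    proof -
      have "real P ^ 2 * L\<^sup>2 \<le> real P ^ 3 * L\<^sup>2"
        using P1 by (intro mult_right_mono power_increasing) auto
      then show ?thesis
        by (simp add: power_mult_distrib)
    qed
    then have "sqrt ((60 * real P * L)\<^sup>2) \<le> sqrt N"
      using N_gt by (intro real_sqrt_le_mono) simp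
    then have sqrt_N: "60 * real P * L \<le> sqrt N"
      using L by simp
    have "15 * L * N * sqrt N * real P \<le> N * N / 4"
    proof -
      have "N * sqrt N * (60 * real P * L) \<le> N * sqrt N * sqrt N"
        using sqrt_N N0 by (intro mult_left_mono) auto
      also have "\<dots> = N * N"
        using N0 by simp
      finally show ?thesis
        by (simp add: mult_ac)
    qed
    moreover have "N * real P \<le> N * N / 4"
    proof -
      have "1 * 1 \<le> real P * L"
        using P1 L by (intro mult_mono) auto
      then have "sqrt N \<ge> 1"
        using sqrt_N by linarith
      then have "sqrt N * 1 \<le> sqrt N * sqrt N"
        by (intro mult_left_mono) auto
      then have "sqrt N \<le> N"
        using N0 by simp
      moreover have "real P * 1 \<le> real P * L"
        using L by (intro mult_left_mono) auto
      ultimately have "4 * real P \<le> N"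
        using sqrt_N by linarith
      then show ?thesis
        using N0 mult_left_mono[of "4 * real P" N N] by simp
    qed
    moreover have "real P * real (card D) \<le> real P * (N + 15 * L * N * sqrt N)"
      using card_D by (intro mult_left_mono) auto
    ultimately show ?thesis
      by (simp add: power2_eq_square algebra_simps)
  qed
  \<comment> \<open>This makes \<open>2 * sqrt Y - ln \<bar>n\<bar>\<close> at least
    \<open>7 * P * L\<close>, above the \<open>6 * P * L\<close> that \<open>larger_sieve\<close>
    asks for with \<open>K = 3 * P\<close>.\<close>
  define Y where "Y = nat \<lceil>(4 * real P * L)\<^sup>2\<rceil>"
  have Y_ge: "real Y \<ge> (4 * real P * L)\<^sup>2"
    by (simp add: Y_def real_nat_ceiling_ge)
  have PL: "real P * L \<ge> 1"
    using P1 L mult_mono[of 1 "real P" 1 L] by simp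
  have PL2: "(real P * L)\<^sup>2 \<ge> 1"
    using PL by (simp add: one_le_power)
  have Y_le: "real Y \<le> 17 * (real P * L)\<^sup>2"
  proof -
    have "real Y \<le> (4 * real P * L)\<^sup>2 + 1"
    proof -
      have "\<lceil>(4 * real P * L)\<^sup>2\<rceil> \<ge> 0"
        using zero_le_power2[of "4 * real P * L"] by linarith
      then have "real Y = real_of_int \<lceil>(4 * real P * L)\<^sup>2\<rceil>"
        unfolding Y_def by simp
      then show ?thesis
        using of_int_ceiling_le_add_one[of "(4 * real P * L)\<^sup>2"] by simp
    qed
    also have "(4 * real P * L)\<^sup>2 = 16 * (real P * L)\<^sup>2"
      by (simp add: power_mult_distrib)
    finally show ?thesis
      using PL2 by linarith
  qed
  have Y1: "Y \<ge> 1"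
  proof -
    have "(4 * real P * L)\<^sup>2 = 16 * (real P * L)\<^sup>2"
      by (simp add: power_mult_distrib)
    then have "real Y \<ge> 1"
      using Y_ge PL2 by linarith
    then show ?thesis
      by simp
  qed
  have sqrt_Y: "sqrt (real Y) \<ge> 4 * real P * L"
    using Y_ge L by (intro real_le_rsqrt) auto
  have ln_Y: "ln (real Y) \<ge> 2 * B + 2 * c"
  proof -
    have "1 * L \<le> (4 * real P) * L"
      using L P1 by (intro mult_right_mono) auto
    then have "L \<le> (4 * real P * L) * 1"
      by simp
    also have "\<dots> \<le> (4 * real P * L)\<^sup>2"
      using PL L unfolding power2_eq_square by (intro mult_left_mono) auto
    finally have "exp (2 * B + 2 * c) \<le> real Y"
      using x Y_ge by (simp add: L_def)
    then show ?thesis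
      using Y1 by (subst ln_ge_iff) auto
  qed
  define S where "S = {p. p \<in> {1..Y\<^sup>2} \<and> prime p \<and> [p = 1] (mod P)}"
  \<comment> \<open>The difference of the Mertens estimates at \<open>Y\<^sup>2\<close> and
    \<open>Y\<close> is at least \<open>ln Y - 2 * B\<close>, which \<open>ln_Y\<close> makes at
    least \<open>2 * c\<close>.\<close>
  have G: "(\<Sum>p | p \<in> S \<and> p > Y. ln (real p) / real p) \<ge> 2"
  proof -
    have YY: "Y \<le> Y\<^sup>2"
      using Y1 by (simp add: power2_eq_square)
    have "S = {p. p \<in> {1..Y} \<and> prime p \<and> [p = 1] (mod P)} \<union> {p. p \<in> S \<and> p > Y}"
      using YY by (auto simp: S_def)
    moreover have "finite S"
      by (simp add: S_def)
    ultimately have "(\<Sum>p\<in>S. ln (real p) / real p) =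
        (\<Sum>p | p \<in> {1..Y} \<and> prime p \<and> [p = 1] (mod P). ln (real p) / real p) +
        (\<Sum>p | p \<in> S \<and> p > Y. ln (real p) / real p)"
      by (subst sum.union_disjoint[symmetric]) auto
    moreover have "c * (\<Sum>p\<in>S. ln (real p) / real p) \<ge> ln (real (Y\<^sup>2)) - B"
      using B[of "Y\<^sup>2"] Y1 unfolding S_def by (simp add: abs_le_iff)
    moreover have "c * (\<Sum>p | p \<in> {1..Y} \<and> prime p \<and> [p = 1] (mod P). ln (real p) / real p) \<le> ln (real Y) + B"
      using B[OF Y1] by (simp add: abs_le_iff)
    moreover have "ln (real (Y\<^sup>2)) = 2 * ln (real Y)"
      using Y1 by (simp add: ln_realpow)
    ultimately have "c * 2 \<le> c * (\<Sum>p | p \<in> S \<and> p > Y. ln (real p) / real p)"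
      using ln_Y by (simp add: distrib_left)
    then show ?thesis
      using c by simp
  qed
  define S' where "S' = {p. p \<in> S \<and> p > Y \<and> \<not> int p dvd n}"
  have "N \<le> 2 * (3 * real P) * real Y"
    unfolding N_def
  proof (rule larger_sieve[OF A(1) finA, of S' _ _])
    show "finite S'"
      by (simp add: S'_def S_def)
    show "prime p" if "p \<in> S'" for p
      using that by (simp add: S'_def S_def)
    show "sqrt (real p) \<le> real Y" if "p \<in> S'" for p
    proof (rule real_le_lsqrt)
      show "real p \<le> (real Y)\<^sup>2"
        using that by (simp add: S'_def S_def flip: of_nat_power)
    qed simp_all
    show "3 * real P > 0" "x > 1"
      using P x1 by simp_all
    \<comment> \<open>Losing at most half of \<open>N\<^sup>2\<close> to \<open>D\<close> doubles
      the other term, and \<open>2 * sqrt 2 \<le> 3\<close> gives the constant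
      \<open>3 * P\<close>.\<close>
    show "(real (card A))\<^sup>2 \<le> 3 * real P * sqrt (real p) * collisions p A" if p: "p \<in> S'" for p
    proof -
      have "N\<^sup>2 \<le> real P * real (card D) + real P * sqrt (2 * real p) * collisions p A"
        unfolding N_def
        by (rule power_sieve_inequality[OF _ P _ _ finA D_sub good]) (use p in \<open>auto simp: S'_def S_def\<close>)
      then have "N\<^sup>2 \<le> 2 * (real P * sqrt (2 * real p) * collisions p A)"
        using card_D by linarith
      also have "\<dots> = 2 * sqrt 2 * (real P * sqrt (real p) * collisions p A)"
        by (simp add: real_sqrt_mult)
      also have "\<dots> \<le> 3 * (real P * sqrt (real p) * collisions p A)"
      proof (rule mult_right_mono)
        have "sqrt 2 \<le> 3 / 2"
          by (rule real_le_lsqrt) (simp_all add: power2_eq_square)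
        then show "2 * sqrt 2 \<le> (3 :: real)"
          by simp
      qed (simp add: collisions_def)
      finally show ?thesis
        by (simp add: N_def mult_ac)
    qed
    have "ln (real_of_int \<bar>n\<bar>) \<le> L"
      unfolding L_def using n by (subst ln_le_cancel_iff) auto
    moreover have "L \<le> real P * L"
      using P1 L mult_right_mono[of 1 "real P" L] by simp
    moreover have "(\<Sum>p\<in>S'. ln (real p) / sqrt (real p)) \<ge> 2 * sqrt (real Y) - ln (real_of_int \<bar>n\<bar>)"
      unfolding S'_def by (rule sum_ln_over_sqrt_ge[OF S_def Y1 n0 G])
    moreover have "4 * (real P * L) \<le> sqrt (real Y)"
      using sqrt_Y by (simp only: mult.assoc)
    ultimately have "6 * (real P * L) \<le> (\<Sum>p\<in>S'. ln (real p) / sqrt (real p))"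
      using PL by linarith
    then show "2 * (3 * real P) * ln x \<le> (\<Sum>p\<in>S'. ln (real p) / sqrt (real p))"
      by (simp add: L_def)
  qed
  also have "\<dots> \<le> 2 * (3 * real P) * (17 * (real P * L)\<^sup>2)"
    using Y_le by (intro mult_left_mono) auto
  also have "\<dots> = 102 * (real P ^ 3 * L\<^sup>2)"
    by (simp add: power_mult_distrib power3_eq_cube power2_eq_square)
  also have "\<dots> \<le> 3600 * (real P ^ 3 * L\<^sup>2)"
    by (intro mult_right_mono) auto
  finally show False
    using N_gt by simp
qed

theorem theorem2p15:
  assumes "LPS_special_case"
  shows "\<exists>C::real. \<forall>\<^sub>F x::real in at_top. real (f_tilde x) \<le> C * (ln x) ^ 4"
proof -
  obtain c B :: real where c: "c > 0" and B: "\<And>N. N \<ge> 1 \<Longrightarrow>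
    \<bar>c * (\<Sum>p | p \<in> {1..N} \<and> prime p \<and> [p = 1] (mod small_primes_product). ln (real p) / real p) - ln (real N)\<bar> \<le> B"
    by (rule mertens_class_one[OF squarefree_small_primes_product]) (use small_primes_product_gt_1 in auto)
  define C where "C = 3600 * real small_primes_product ^ 3"
  \<comment> \<open>The constants \<open>c\<close> and \<open>B\<close> of Mertens' theorem enter
    only this threshold for \<open>ln x\<close>, not \<open>C\<close>.\<close>
  define M where "M = max 1 (exp (2 * B + 2 * c))"
  have "real (f_tilde x) \<le> C * (ln x) ^ 4" if x: "x \<ge> exp M" for x
  proof -
    have "x > 0"
      using x exp_gt_zero[of M] by linarith
    then have lnx: "ln x \<ge> M"
      using x by (simp add: ln_ge_iff)
    have "1 < exp M"
      by (simp add: M_def less_max_iff_disj)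
    then have x1: "x > 1"
      using x by linarith
    then have "f_tilde x \<in> D_set_sizes x"
      unfolding f_tilde_def by (intro Max_in finite_D_set_sizes D_set_sizes_nonempty) simp
    then obtain A n where A: "f_tilde x = card A" "A \<subseteq> {a. 1 \<le> a \<and> real a \<le> x}" "has_property_D n A"
      and n: "1 \<le> \<bar>n\<bar>" "real_of_int \<bar>n\<bar> \<le> x"
      by (auto simp: D_set_sizes_def)
    have ln1: "ln x \<ge> 1" "ln x \<ge> exp (2 * B + 2 * c)"
      using lnx by (simp_all add: M_def)
    have "real (f_tilde x) \<le> C * (ln x)\<^sup>2"
      unfolding A(1) C_def by (rule card_property_D_le[OF assms c B x1 ln1 n A(2,3)])
    also have "\<dots> \<le> C * (ln x) ^ 4"
      using ln1 by (intro mult_left_mono power_increasing) (auto simp: C_def)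
    finally show ?thesis .
  qed
  then show ?thesis
    by (intro exI[of _ C]) (auto simp: eventually_at_top_linorder)
qed

end
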